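(* Let $d\ge 2$, let $z=z(t)$, $t\ge 0$, be a real-valued function of time, and let $g_2,\dots,g_d:[0,\infty)\to[0,\infty)$ each satisfy Conditions (A), (B) and (C). Suppose that $$\lim_{t\to\infty}\mathbb{E}_{\{g_i\}}[N_t]=\lambda<\infty .$$ (i) If $d\ge 4$, then under $\mathbb{P}_{\{g_i\}}$, $N_t$ converges in distribution to $\mathrm{Poisson}(\lambda)$ as $t\to\infty$. (ii) If $d\in\{2,3\}$ and in addition, as $t\to\infty$, $E_0[G(\zeta_{t/d}-z)1(\zeta_{t/d}>z)]$ is $o((\log t)^{-1/2})$ when $d=3$, respectively $o(t^{-1/4})$ when $d=2$, then under $\mathbb{P}_{\{g_i\}}$, $N_t$ converges in distribution to $\mathrm{Poisson}(\lambda)$ as $t\to\infty$.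
   Context: Exclusion process. $\{\eta_t\}_{t\ge0}$ is the symmetric simple exclusion process on $\mathbb{Z}^d$: the Markov process on $\{0,1\}^{\mathbb{Z}^d}$ with generator $\mathcal{L}_d f(\eta)=\frac{1}{2d}\sum_{x\in\mathbb{Z}^d}\sum_{|y-x|=1}\eta(x)(1-\eta(y))(f(\eta^{x,y})-f(\eta))$ for local functions $f$, where $\eta^{x,y}$ is $\eta$ with the values at $x$ and $y$ exchanged. Initial profiles. For $g_2,\dots,g_d:[0,\infty)\to[0,\infty)$, let $\mathcal{R}_{\{g_i\}}=\{x\in\mathbb{Z}^d: x_1\le 0,\ |x_i|\le g_i(-x_1)\text{ for } i=2,\dots,d\}$ and $\eta_{\{g_i\}}(x)=1(x\in\mathcal{R}_{\{g_i\}})$; $\mathbb{P}_{\{g_i\}},\mathbb{E}_{\{g_i\}}$ denote law and expectation of the process started from $\eta_{\{g_i\}}$. $N_t=\sum_{x\in\mathbb{Z}^d,\,x_1>z}\eta_t(x)$ with $z=z(t)$. $\mathrm{Poisson}(0)$ is the point mass at $0$. Conditions on $g:[0,\infty)\to[0,\infty)$. (A) $g$ is nondecreasing. (B) $g$ is continuously differentiable and $\sup_{m\in\Delta(g)}\frac{|g(m)-g(m-1)|}{g'(m)}<\infty$, where $\Delta(g)=\{m\in\{1,2,\dots\}:g(m)\ne g(m-1)\}$ (in particular $g'(m)\neq 0$ for $m\in\Delta(g)$ is required; the condition is vacuous if $\Delta(g)=\varnothing$). (C) $g$ is continuously differentiable with $\lim_{u\to\infty}g'(u)/g(u)=0$.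 $G(u)=\prod_{i=2}^d(2g_i(u)+1)$. $\zeta_t$ is the continuous-time simple symmetric random walk on $\mathbb{Z}$ with jump rate $1$; $P_j,E_j$ denote law and expectation with $\zeta_0=j$. *)

theory Defs
  imports "HOL-Probability.Probability" "HOL-Library.Landau_Symbols"
begin

section \<open>The symmetric simple exclusion process\<close>

text \<open>
  The lattice is \<open>int ^ 'd\<close>, of dimension \<open>CARD('d)\<close>. A configuration in \<open>{0,1}\<close> to the lattice is a
  predicate on sites (\<open>\<eta> x\<close> iff \<open>x\<close> is occupied). The library topology on this function type is the
  product topology, for which the space is compact; \<open>borel\<close> is its product sigma-algebra.
\<close>

type_synonym 'd config = "int ^ 'd \<Rightarrow> bool"

definition neighbours :: "int ^ 'd::finite \<Rightarrow> (int ^ 'd) set" where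
  "neighbours x = {y. (\<Sum>i\<in>UNIV. \<bar>y $ i - x $ i\<bar>) = 1}"

definition exchange :: "'d::finite config \<Rightarrow> int ^ 'd \<Rightarrow> int ^ 'd \<Rightarrow> 'd config" where
  "exchange \<eta> x y = \<eta>(x := \<eta> y, y := \<eta> x)"

definition local_fun :: "('d::finite config \<Rightarrow> real) \<Rightarrow> bool" where
  "local_fun f \<longleftrightarrow>
     (\<exists>A. finite A \<and> (\<forall>\<eta> \<xi>. (\<forall>x\<in>A. \<eta> x = \<xi> x) \<longrightarrow> f \<eta> = f \<xi>))"

text \<open>For local \<open>f\<close> only finitely many \<open>x\<close> contribute to the infinite sum.\<close>

definition sep_generator :: "('d::finite config \<Rightarrow> real) \<Rightarrow> 'd config \<Rightarrow> real" where
  "sep_generator f \<eta> =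
     1 / (2 * real CARD('d)) *
     (\<Sum>\<^sub>\<infinity>x. \<Sum>y\<in>neighbours x.
        of_bool (\<eta> x) * (1 - of_bool (\<eta> y)) * (f (exchange \<eta> x y) - f \<eta>))"

text \<open>
  \<open>P t \<eta>\<close> is the law at time \<open>t\<close> started from \<open>\<eta>\<close>. The Feller semigroup it induces is required to have
  an infinitesimal generator that agrees with \<open>sep_generator\<close> on local functions. Local functions form
  a core (Liggett), so this determines \<open>P\<close> uniquely on nonnegative times.
\<close>

definition sep_transition :: "(real \<Rightarrow> 'd::finite config \<Rightarrow> 'd config measure) \<Rightarrow> bool" where
  "sep_transition P \<longleftrightarrow>
     (\<forall>t\<ge>0. P t \<in> borel \<rightarrow>\<^sub>M prob_algebra borel) \<and>
     (\<forall>\<eta>. P 0 \<eta> = return borel \<eta>) \<and>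
     (\<forall>s\<ge>0. \<forall>t\<ge>0. \<forall>\<eta>. P (s + t) \<eta> = P s \<eta> \<bind> P t) \<and>
     (\<forall>f :: 'd config \<Rightarrow> real. continuous_on UNIV f \<longrightarrow>
        (\<forall>t\<ge>0. continuous_on UNIV (\<lambda>\<eta>. \<integral>\<xi>. f \<xi> \<partial>P t \<eta>)) \<and>
        uniform_limit UNIV (\<lambda>t \<eta>. \<integral>\<xi>. f \<xi> \<partial>P t \<eta>) f (at_right 0)) \<and>
     (\<forall>f. local_fun f \<longrightarrow>
        uniform_limit UNIV (\<lambda>t \<eta>. ((\<integral>\<xi>. f \<xi> \<partial>P t \<eta>) - f \<eta>) / t) (sep_generator f) (at_right 0))"

definition history :: "'w measure \<Rightarrow> (real \<Rightarrow> 'w \<Rightarrow> 'd::finite config) \<Rightarrow> real \<Rightarrow> 'w measure" where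
  "history M \<eta> s =
     sigma (space M) {\<eta> r -` B \<inter> space M | r B. 0 \<le> r \<and> r \<le> s \<and> B \<in> sets borel}"

text \<open>
  Under \<open>M\<close>, the family \<open>\<eta> t\<close>, \<open>t \<ge> 0\<close>, is the symmetric simple exclusion process started from \<open>\<eta>\<^sub>0\<close>;
  values at negative times are irrelevant.
\<close>

definition ssep ::
  "'w measure \<Rightarrow> (real \<Rightarrow> 'w \<Rightarrow> 'd::finite config) \<Rightarrow> 'd config \<Rightarrow> bool" where
  "ssep M \<eta> \<eta>\<^sub>0 \<longleftrightarrow>
     prob_space M \<and>
     (\<forall>t\<ge>0. \<eta> t \<in> M \<rightarrow>\<^sub>M borel) \<and>
     (AE \<omega> in M. \<eta> 0 \<omega> = \<eta>\<^sub>0) \<and>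
     (\<exists>P. sep_transition P \<and>
        (\<forall>s\<ge>0. \<forall>t\<ge>0. \<forall>f :: 'd config \<Rightarrow> real. continuous_on UNIV f \<longrightarrow>
           (AE \<omega> in M. real_cond_exp M (history M \<eta> s) (\<lambda>\<omega>. f (\<eta> (s + t) \<omega>)) \<omega>
                        = (\<integral>\<xi>. f \<xi> \<partial>P t (\<eta> s \<omega>)))))"

section \<open>Initial profiles and particle count\<close>

text \<open>
  The argument \<open>e\<close> is the index of the distinguished (first) coordinate. The profile functions are
  indexed by all coordinates, but \<open>g e\<close> is never used.
\<close>

definition profile :: "'d::finite \<Rightarrow> ('d \<Rightarrow> real \<Rightarrow> real) \<Rightarrow> 'd config" where
  "profile e g x \<longleftrightarrow>
     x $ e \<le> 0 \<and> (\<forall>i. i \<noteq> e \<longrightarrow> real_of_int \<bar>x $ i\<bar> \<le> g i (real_of_int (- x $ e)))"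

definition particles_beyond :: "'d::finite \<Rightarrow> real \<Rightarrow> 'd config \<Rightarrow> ennreal" where
  "particles_beyond e z \<eta> = (\<Sum>\<^sub>\<infinity>x\<in>{x. real_of_int (x $ e) > z}. of_bool (\<eta> x))"

definition cross_section :: "'d::finite \<Rightarrow> ('d \<Rightarrow> real \<Rightarrow> real) \<Rightarrow> real \<Rightarrow> real" where
  "cross_section e g u = (\<Prod>i\<in>UNIV - {e}. (2 * g i u + 1))"

section \<open>Conditions on the profile functions\<close>

text \<open>The domain is \<open>[0,\<infinity>)\<close>, so the derivative at 0 is one-sided.\<close>

definition deriv0 :: "(real \<Rightarrow> real) \<Rightarrow> real \<Rightarrow> real" where
  "deriv0 g u = vector_derivative g (at u within {0..})"

definition cont_diff :: "(real \<Rightarrow> real) \<Rightarrow> bool" where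
  "cont_diff g \<longleftrightarrow> g differentiable_on {0..} \<and> continuous_on {0..} (deriv0 g)"

definition jumps :: "(real \<Rightarrow> real) \<Rightarrow> nat set" where
  "jumps g = {m. 1 \<le> m \<and> g (real m) \<noteq> g (real m - 1)}"

definition condA :: "(real \<Rightarrow> real) \<Rightarrow> bool" where
  "condA g \<longleftrightarrow> mono_on {0..} g"

definition condB :: "(real \<Rightarrow> real) \<Rightarrow> bool" where
  "condB g \<longleftrightarrow> cont_diff g \<and>
     (\<forall>m\<in>jumps g. deriv0 g (real m) \<noteq> 0) \<and>
     bdd_above ((\<lambda>m. \<bar>g (real m) - g (real m - 1)\<bar> / deriv0 g (real m)) ` jumps g)"

text \<open>
  The quotient has to be defined for large \<open>u\<close>. This excludes only \<open>g = 0\<close> among nondecreasing nonnegative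
  functions, and \<open>g = 0\<close> gives the same initial profile as the admissible constant \<open>1/2\<close>.
\<close>

definition condC :: "(real \<Rightarrow> real) \<Rightarrow> bool" where
  "condC g \<longleftrightarrow> cont_diff g \<and>
     (\<forall>\<^sub>F u in at_top. g u \<noteq> 0) \<and> ((\<lambda>u. deriv0 g u / g u) \<longlongrightarrow> 0) at_top"

section \<open>Random walk and Poisson limits\<close>

text \<open>The library's \<open>poisson_pmf\<close> is specified for positive rates only.\<close>

definition poisson0_pmf :: "real \<Rightarrow> nat pmf" where
  "poisson0_pmf r = (if r = 0 then return_pmf 0 else poisson_pmf r)"

primrec srw_pmf :: "int \<Rightarrow> nat \<Rightarrow> int pmf" where
  "srw_pmf j 0 = return_pmf j"
| "srw_pmf j (Suc n) = srw_pmf j n \<bind> (\<lambda>x. pmf_of_set {x - 1, x + 1})"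

text \<open>
  The law at time \<open>s\<close> of the walk with jump rate 1 started at \<open>j\<close>: holding times are independent
  standard exponentials, so the number of jumps made by time \<open>s\<close> is Poisson with mean \<open>s\<close>.
\<close>

definition ctrw_pmf :: "int \<Rightarrow> real \<Rightarrow> int pmf" where
  "ctrw_pmf j s = poisson0_pmf s \<bind> srw_pmf j"

text \<open>
  \<open>E\<^sub>0[G(\<zeta>\<^bsub>t/d\<^esub> - z) 1(\<zeta>\<^bsub>t/d\<^esub> > z)]\<close>. Under \<open>condC\<close> the function \<open>G\<close> grows subexponentially, so the
  integrand is integrable.
\<close>

definition walk_moment :: "'d::finite \<Rightarrow> ('d \<Rightarrow> real \<Rightarrow> real) \<Rightarrow> real \<Rightarrow> real \<Rightarrow> real" where
  "walk_moment e g z t =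
     measure_pmf.expectation (ctrw_pmf 0 (t / real CARD('d)))
       (\<lambda>k. cross_section e g (real_of_int k - z) * of_bool (real_of_int k > z))"

text \<open>
  Convergence in distribution as \<open>t \<rightarrow> \<infinity>\<close> through the reals, for real random variables on a common
  probability space: weak convergence along every sequence of times tending to infinity.
\<close>

definition converges_in_distr :: "'w measure \<Rightarrow> (real \<Rightarrow> 'w \<Rightarrow> real) \<Rightarrow> real measure \<Rightarrow> bool" where
  "converges_in_distr M X \<mu> \<longleftrightarrow>
     (\<forall>s :: nat \<Rightarrow> real. filterlim s at_top sequentially \<longrightarrow>
        weak_conv_m (\<lambda>n. distr M borel (X (s n))) \<mu>)"

definition poisson_law :: "real \<Rightarrow> real measure" where
  "poisson_law r = distr (measure_pmf (poisson0_pmf r)) borel real"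

text \<open>
  The count is almost surely finite whenever its expectation is finite; on the remaining null set,
  \<open>enn2real\<close> replaces infinity by 0.
\<close>

definition count_tends_to_poisson ::
  "'w measure \<Rightarrow> 'd::finite \<Rightarrow> (real \<Rightarrow> real) \<Rightarrow> (real \<Rightarrow> 'w \<Rightarrow> 'd config) \<Rightarrow> real \<Rightarrow> bool" where
  "count_tends_to_poisson M e z \<eta> r \<longleftrightarrow>
     converges_in_distr M (\<lambda>t \<omega>. enn2real (particles_beyond e (z t) (\<eta> t \<omega>))) (poisson_law r)"

end

theory Submission
  imports Defs
begin

text \<open>
  Write \<open>A\<close> for the half space \<open>x\<^sub>e > z\<close>, \<open>R\<close> for the initial profile, and \<open>q\<^sub>s(x)\<close>, \<open>u\<^sub>s(x)\<close> for the
  probabilities that a simple random walk from \<open>x\<close> is at time \<open>s\<close> in \<open>A\<close>, respectively in \<open>R\<close>.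
  By self-duality the binomial moment \<open>E (N choose k)\<close> is the sum over \<open>k\<close>-subsets \<open>B\<close> of \<open>R\<close> of the
  probability that exclusion moves \<open>B\<close> into \<open>A\<close>. The product of \<open>q\<^sub>t\<close> over \<open>B\<close> solves the same
  evolution equation up to the nonnegative source \<open>(q\<^sub>s(x) - q\<^sub>s(y))\<^sup>2\<close> on pairs of adjacent points of
  \<open>B\<close>. Duhamel's formula gives the upper bound by independent walks (Liggett's inequality), and,
  with the same bound applied to \<open>u\<close>, shows that the error is at most the integral over \<open>s \<le> t\<close> of
  the sum over bonds \<open>xy\<close> of \<open>(q\<^sub>s(x) - q\<^sub>s(y))\<^sup>2 u\<^bsub>t-s\<^esub>(x) u\<^bsub>t-s\<^esub>(y)\<close>, times a power of \<open>E N\<close>.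

  Only bonds in direction \<open>e\<close> contribute, since \<open>q\<close> depends on \<open>x\<^sub>e\<close> alone. The transverse
  coordinates of the walk started in \<open>R\<close> supply a factor \<open>(1 + t - s)\<^bsup>-(d-1)/2\<^esup>\<close>, and convolving
  the remaining one-dimensional kernels leaves essentially the square of
  \<open>E\<^sub>0[G(\<zeta>\<^bsub>t/d\<^esub> - z) 1(\<zeta>\<^bsub>t/d\<^esub> > z)]\<close>. So the error is this square times \<open>t\<^bsup>1/2\<^esup>\<close>, \<open>log t\<close> or a
  constant for \<open>d = 2\<close>, \<open>d = 3\<close>, \<open>d \<ge> 4\<close>; for \<open>d \<ge> 4\<close> it vanishes because condition (C) makes
  consecutive values of \<open>G\<close> asymptotically equal. The binomial moments therefore converge to
  \<open>\<lambda>\<^sup>k / k!\<close>, with a domination that allows summation to characteristic functions.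
\<close>

section \<open>The exclusion semigroup on finite sets\<close>

text \<open>The profile is infinite, so the argument stays in \<open>ennreal\<close> as long as
  possible. With suppressed jumps counted as null moves, the generator is a nonnegative operator
  minus a constant, its semigroup is a series of nonnegative terms, and sums and integrals are
  exchanged by Tonelli or monotone convergence. The same encoding makes the semigroup symmetric for
  counting measure, and symmetry acts three times. It moves the semigroup from the profile to the
  half space; it moves it, inside the Duhamel integral, from the source to the profile, where the
  product bound for \<open>u\<close> applies; and it shows that the sum over all sites of
  \<open>q\<close> at time \<open>s\<close> times \<open>u\<close> at time \<open>t - s\<close>
  equals the expected count for every \<open>s\<close>, which is why the particles off the bond
  contribute a power of that count. The square in the error comes from the squared gradient of
  \<open>q\<close>: one factor is paired with \<open>u\<close> and bounded uniformly in the site, at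
  the cost of the transverse kernel, and the other is summed over all sites. The main term is an
  elementary symmetric function with small weights, that is, the Poisson limit for independent
  indicators.\<close>

definition ksets :: "nat \<Rightarrow> 'a set set" where
  "ksets k = {B. finite B \<and> card B = k}"

text \<open>
  If \<open>x\<close> and \<open>y\<close> both lie in \<open>B\<close>, the exchange fixes \<open>B\<close>: suppressed jumps are counted as null
  moves. Hence every \<open>k\<close>-subset has the same total weight \<open>2dk\<close>, and the sum is symmetric.
\<close>

definition hopsum :: "((int ^ 'd::finite) set \<Rightarrow> 'b::comm_monoid_add) \<Rightarrow> (int ^ 'd) set \<Rightarrow> 'b" where
  "hopsum f B = (\<Sum>x\<in>B. \<Sum>y\<in>neighbours x. f (Transposition.transpose x y ` B))"

lemma abs_sum_eq_1_iff:
  fixes v :: "'d::finite \<Rightarrow> int"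
  shows "(\<Sum>i\<in>UNIV. \<bar>v i\<bar>) = 1 \<longleftrightarrow> (\<exists>i. \<bar>v i\<bar> = 1 \<and> (\<forall>j. j \<noteq> i \<longrightarrow> v j = 0))"
proof
  assume s: "(\<Sum>i\<in>UNIV. \<bar>v i\<bar>) = 1"
  then obtain i where i: "v i \<noteq> 0"
    by (metis abs_zero sum.neutral zero_neq_one)
  have "(\<Sum>i\<in>UNIV. \<bar>v i\<bar>) = \<bar>v i\<bar> + (\<Sum>j\<in>UNIV - {i}. \<bar>v j\<bar>)"
    by (simp add: sum.remove)
  moreover have "0 \<le> (\<Sum>j\<in>UNIV - {i}. \<bar>v j\<bar>)"
    by (simp add: sum_nonneg)
  ultimately have "\<bar>v i\<bar> = 1" and z: "(\<Sum>j\<in>UNIV - {i}. \<bar>v j\<bar>) = 0"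
    using s i by linarith+
  moreover have "\<forall>j. j \<noteq> i \<longrightarrow> v j = 0"
    using z by (subst (asm) sum_nonneg_eq_0_iff) auto
  ultimately show "\<exists>i. \<bar>v i\<bar> = 1 \<and> (\<forall>j. j \<noteq> i \<longrightarrow> v j = 0)" by blast
next
  assume "\<exists>i. \<bar>v i\<bar> = 1 \<and> (\<forall>j. j \<noteq> i \<longrightarrow> v j = 0)"
  then obtain i where "\<bar>v i\<bar> = 1" "\<forall>j. j \<noteq> i \<longrightarrow> v j = 0" by blast
  then have "(\<Sum>i\<in>UNIV. \<bar>v i\<bar>) = (\<Sum>j\<in>UNIV. if j = i then 1 else 0)"
    by (intro sum.cong) auto
  then show "(\<Sum>i\<in>UNIV. \<bar>v i\<bar>) = 1" by simp
qed

lemma neighbours_eq: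
  "neighbours x = (\<lambda>(i, s). x + axis i s) ` (UNIV \<times> {1, -1})"
proof -
  have "y \<in> neighbours x \<longleftrightarrow> (\<exists>i. \<exists>s\<in>{1,-1}. y = x + axis i s)" for y
  proof -
    have "(\<exists>s\<in>{1,-1}. y = x + axis i s) \<longleftrightarrow> \<bar>y $ i - x $ i\<bar> = 1 \<and> (\<forall>j. j \<noteq> i \<longrightarrow> y $ j - x $ j = 0)" for i
    proof
      assume a: "\<bar>y $ i - x $ i\<bar> = 1 \<and> (\<forall>j. j \<noteq> i \<longrightarrow> y $ j - x $ j = 0)"
      then have "y = x + axis i (y $ i - x $ i)"
        by (auto simp: vec_eq_iff axis_def)
      moreover have "y $ i - x $ i \<in> {1,-1}" using a by auto
      ultimately show "\<exists>s\<in>{1,-1}. y = x + axis i s" by blast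
    qed (auto simp: axis_def)
    then show ?thesis
      unfolding neighbours_def mem_Collect_eq abs_sum_eq_1_iff by simp
  qed
  then show ?thesis by (auto simp: image_iff)
qed

lemma inj_axis_steps: "inj_on (\<lambda>(i, s). x + axis i (s::int)) (UNIV \<times> {1, -1})"
  by (auto simp: inj_on_def axis_eq_axis)

lemma finite_neighbours [simp]: "finite (neighbours x)"
  by (simp add: neighbours_eq)

lemma sum_neighbours:
  "(\<Sum>y\<in>neighbours x. f y) = (\<Sum>i\<in>UNIV. f (x + axis i 1) + f (x - axis i 1))"
proof -
  have *: "x + axis i (-1) = x - axis i 1" for i
    by (simp add: vec_eq_iff axis_def)
  show ?thesis
    unfolding neighbours_eq sum.reindex[OF inj_axis_steps] comp_def
    using sum.cartesian_product[of "\<lambda>i s. f (x + axis i s)" "{1,-1}" UNIV]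
    by (simp add: case_prod_beta *)
qed

lemma card_neighbours [simp]: "card (neighbours (x :: int ^ 'd::finite)) = 2 * CARD('d)"
  unfolding neighbours_eq card_image[OF inj_axis_steps] by simp

lemma neighbours_sym: "y \<in> neighbours x \<longleftrightarrow> x \<in> neighbours y"
  by (simp add: neighbours_def abs_minus_commute)

lemma not_neighbour_self [simp]: "x \<notin> neighbours x"
  by (simp add: neighbours_def)

text \<open>Transpositions preserve cardinality, so iterating \<open>hopsum\<close> from a
  \<open>k\<close>-set evaluates the function at \<open>k\<close>-sets alone. This is why bounds,
  derivatives and congruences below are asked for on \<open>ksets k\<close> only.\<close>

lemma ksets_transpose [simp]: "Transposition.transpose x y ` B \<in> ksets k \<longleftrightarrow> B \<in> ksets k"
  by (auto simp: ksets_def card_image finite_image_iff)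

lemma hopsum_cong: "B \<in> ksets k \<Longrightarrow> (\<And>B. B \<in> ksets k \<Longrightarrow> f B = g B) \<Longrightarrow> hopsum f B = hopsum g B"
  by (simp add: hopsum_def)

lemma hopsum_pow_cong:
  "B \<in> ksets k \<Longrightarrow> (\<And>B. B \<in> ksets k \<Longrightarrow> f B = g B) \<Longrightarrow> (hopsum ^^ n) f B = (hopsum ^^ n) g B"
proof (induction n arbitrary: B)
  case (Suc n)
  then show ?case by (simp del: funpow.simps add: funpow.simps(2)) (auto intro!: hopsum_cong)
qed simp

lemma hopsum_nonneg:
  fixes f :: "(int ^ 'd::finite) set \<Rightarrow> real"
  shows "B \<in> ksets k \<Longrightarrow> (\<And>B. B \<in> ksets k \<Longrightarrow> 0 \<le> f B) \<Longrightarrow> 0 \<le> hopsum f B"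
  by (simp add: hopsum_def sum_nonneg)

lemma hopsum_pow_nonneg:
  fixes f :: "(int ^ 'd::finite) set \<Rightarrow> real"
  shows "B \<in> ksets k \<Longrightarrow> (\<And>B. B \<in> ksets k \<Longrightarrow> 0 \<le> f B) \<Longrightarrow> 0 \<le> (hopsum ^^ n) f B"
proof (induction n arbitrary: B)
  case (Suc n)
  then show ?case by (auto intro!: hopsum_nonneg)
qed simp

lemma hopsum_pow_ennreal:
  fixes f :: "(int ^ 'd::finite) set \<Rightarrow> real"
  assumes "B \<in> ksets k" "\<And>B. B \<in> ksets k \<Longrightarrow> 0 \<le> f B"
  shows "(hopsum ^^ n) (\<lambda>B. ennreal (f B)) B = ennreal ((hopsum ^^ n) f B)"
  using assms(1)
proof (induction n arbitrary: B)
  case (Suc n)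
  have "(hopsum ^^ Suc n) (\<lambda>B. ennreal (f B)) B = hopsum (\<lambda>B. ennreal ((hopsum ^^ n) f B)) B"
    using Suc by (auto intro!: hopsum_cong)
  also have "\<dots> = ennreal ((hopsum ^^ Suc n) f B)"
    using Suc.prems assms(2)
    by (simp add: hopsum_def sum_nonneg hopsum_pow_nonneg flip: sum_ennreal)
  finally show ?case .
qed simp

text \<open>There are \<open>k\<close> points with \<open>2d\<close> neighbours each, so every
  application multiplies a constant bound by \<open>2dk\<close>. Against the factorials of the
  exponential series this growth is harmless.\<close>

lemma hopsum_pow_le:
  fixes f :: "(int ^ 'd::finite) set \<Rightarrow> real"
  assumes "B \<in> ksets k" "\<And>B. B \<in> ksets k \<Longrightarrow> f B \<le> C"
  shows "(hopsum ^^ n) f B \<le> C * (real k * (2 * real CARD('d))) ^ n"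
  using assms(1)
proof (induction n arbitrary: B)
  case (Suc n)
  have "(hopsum ^^ Suc n) f B \<le> (\<Sum>x\<in>B. \<Sum>y\<in>neighbours x. C * (real k * (2 * real CARD('d))) ^ n)"
    unfolding funpow.simps o_def hopsum_def[of "(hopsum ^^ n) f"] using Suc by (intro sum_mono) simp
  also have "\<dots> = C * (real k * (2 * real CARD('d))) ^ Suc n"
    using Suc.prems by (simp add: ksets_def)
  finally show ?case .
qed (use assms(2) in simp)

lemma hopsum_pow_cmult:
  fixes f :: "(int ^ 'd::finite) set \<Rightarrow> 'b::comm_semiring_0"
  shows "(hopsum ^^ n) (\<lambda>B. c * f B) B = c * (hopsum ^^ n) f B"
proof (induction n arbitrary: B)
  case (Suc n)
  then show ?case by (simp add: hopsum_def sum_distrib_left)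
qed simp

lemma hopsum_pow_add:
  fixes f g :: "(int ^ 'd::finite) set \<Rightarrow> real"
  shows "(hopsum ^^ n) (\<lambda>B. f B + g B) B = (hopsum ^^ n) f B + (hopsum ^^ n) g B"
proof (induction n arbitrary: B)
  case (Suc n)
  then show ?case by (simp add: hopsum_def sum.distrib)
qed simp

lemma hopsum_pow_deriv:
  fixes F :: "real \<Rightarrow> (int ^ 'd::finite) set \<Rightarrow> real"
  assumes "B \<in> ksets k"
    and "\<And>B. B \<in> ksets k \<Longrightarrow> ((\<lambda>s. F s B) has_real_derivative F' B) (at s within X)"
  shows "((\<lambda>s. (hopsum ^^ n) (F s) B) has_real_derivative (hopsum ^^ n) F' B) (at s within X)"
  using assms(1)
proof (induction n arbitrary: B)
  case (Suc n)
  then show ?case by (auto simp: hopsum_def intro!: DERIV_sum)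
qed (use assms(2) in simp)

lemma hopsum_pow_continuous:
  fixes F :: "real \<Rightarrow> (int ^ 'd::finite) set \<Rightarrow> real"
  assumes "B \<in> ksets k"
    and "\<And>B. B \<in> ksets k \<Longrightarrow> continuous_on X (\<lambda>s. F s B)"
  shows "continuous_on X (\<lambda>s. (hopsum ^^ n) (F s) B)"
  using assms(1)
proof (induction n arbitrary: B)
  case (Suc n)
  then show ?case by (auto simp: hopsum_def intro!: continuous_on_sum)
qed (use assms(2) in simp)

text \<open>
  The semigroup with generator \<open>hopsum / 2d - k\<close> on functions of \<open>k\<close>-subsets, as an exponential
  series whose terms are all nonnegative.
\<close>

definition sg :: "nat \<Rightarrow> real \<Rightarrow> ((int ^ 'd::finite) set \<Rightarrow> ennreal) \<Rightarrow> (int ^ 'd) set \<Rightarrow> ennreal" where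
  "sg k t f B = (\<Sum>n. ennreal (exp (- (real k * t)) * ((t / (2 * real CARD('d))) ^ n / fact n)) * (hopsum ^^ n) f B)"

section \<open>Duhamel's formula for the exclusion equation with a source\<close>

lemma nn_integral_FTC_within:
  fixes f F :: "real \<Rightarrow> real"
  assumes "a \<le> b" and "\<And>x. a \<le> x \<Longrightarrow> x \<le> b \<Longrightarrow> (F has_real_derivative f x) (at x within {a..b})"
    and "continuous_on {a..b} f" and nn: "\<And>x. a \<le> x \<Longrightarrow> x \<le> b \<Longrightarrow> 0 \<le> f x"
  shows "(\<integral>\<^sup>+x. ennreal (f x) * indicator {a..b} x \<partial>lborel) = ennreal (F b - F a)" and "F a \<le> F b"
proof -
  have *: "has_bochner_integral lborel (\<lambda>x. indicator {a .. b} x *\<^sub>R f x) (F b - F a)"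
    by (rule has_bochner_integral_FTC_Icc)
       (use assms in \<open>auto simp: has_real_derivative_iff_has_vector_derivative[symmetric]\<close>)
  then have "(\<integral>\<^sup>+x. ennreal (indicator {a .. b} x *\<^sub>R f x) \<partial>lborel) = ennreal (F b - F a)"
    using nn by (subst nn_integral_eq_integral)
      (auto simp: has_bochner_integral_iff intro!: AE_I2 split: split_indicator)
  also have "(\<integral>\<^sup>+x. ennreal (indicator {a .. b} x *\<^sub>R f x) \<partial>lborel)
      = (\<integral>\<^sup>+x. ennreal (f x) * indicator {a..b} x \<partial>lborel)"
    by (intro nn_integral_cong) (auto split: split_indicator)
  finally show "(\<integral>\<^sup>+x. ennreal (f x) * indicator {a..b} x \<partial>lborel) = ennreal (F b - F a)" .
  have "0 \<le> (\<integral>x. indicator {a .. b} x *\<^sub>R f x \<partial>lborel)"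
    using nn by (intro integral_nonneg_AE AE_I2) (auto split: split_indicator)
  then show "F a \<le> F b" using * by (simp add: has_bochner_integral_iff)
qed

lemma deriv_taylor_weight:
  "((\<lambda>s. (t - s) ^ Suc n / fact (Suc n)) has_real_derivative - ((t - s) ^ n / fact n)) (at s within X)"
proof -
  have "((\<lambda>s. t - s) has_real_derivative - 1) (at s within X)"
    by (auto intro!: derivative_eq_intros)
  from DERIV_power_Suc[OF this, of n]
  have "((\<lambda>s. (t - s) ^ Suc n / fact (Suc n))
      has_real_derivative (real (Suc n) * (t - s) ^ n * (- 1)) / fact (Suc n)) (at s within X)"
    by (intro DERIV_cdivide) (simp add: mult_ac)
  moreover have "(real (Suc n) * (t - s) ^ n * (- 1)) / fact (Suc n) = - ((t - s) ^ n / fact n)"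
    by (simp add: field_simps del: of_nat_Suc)
  ultimately show ?thesis by simp
qed

text \<open>A Taylor expansion in \<open>t - s\<close> whose remainder vanishes because
  \<open>f\<close> is bounded by 1. Uniqueness for the infinite system of equations comes with it:
  every solution in \<open>[0, 1]\<close> is given by the series. The source only has to be
  nonnegative and continuous in time for each set, since its contribution is obtained as a monotone
  limit.\<close>

lemma
  fixes f r :: "real \<Rightarrow> (int ^ 'd::finite) set \<Rightarrow> real"
  assumes deriv: "\<And>s B. 0 \<le> s \<Longrightarrow> B \<in> ksets k \<Longrightarrow> ((\<lambda>s. f s B) has_real_derivative
        (hopsum (f s) B / (2 * real CARD('d)) - real k * f s B + r s B)) (at s within {0..})"
    and r_cont: "\<And>B. B \<in> ksets k \<Longrightarrow> continuous_on {0..} (\<lambda>s. r s B)"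
    and r_nn: "\<And>s B. 0 \<le> s \<Longrightarrow> B \<in> ksets k \<Longrightarrow> 0 \<le> r s B"
    and f_nn: "\<And>s B. 0 \<le> s \<Longrightarrow> B \<in> ksets k \<Longrightarrow> 0 \<le> f s B"
    and f_le: "\<And>s B. 0 \<le> s \<Longrightarrow> B \<in> ksets k \<Longrightarrow> f s B \<le> 1"
    and t: "0 \<le> t" and B: "B \<in> ksets k"
  shows duhamel: "ennreal (f t B) = sg k t (\<lambda>B. ennreal (f 0 B)) B
     + (\<integral>\<^sup>+s. sg k (t - s) (\<lambda>B. ennreal (r s B)) B * indicator {0..t} s \<partial>lborel)"
    and duhamel_measurable: "(\<lambda>s. sg k (t - s) (\<lambda>B. ennreal (r s B)) B * indicator {0..t} s) \<in> borel_measurable lborel"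
proof -
  define c where "c = 1 / (2 * real CARD('d))"
  have c0: "0 \<le> c" by (simp add: c_def)
  \<comment> \<open>The integrating factor \<open>exp (k * s)\<close> absorbs the term
    \<open>- k * f\<close>, so that only the positivity preserving operator \<open>hopsum\<close> is
    left.\<close>
  define F where "F s B = exp (real k * s) * f s B" for s B
  define R where "R s B = exp (real k * s) * r s B" for s B
  have F': "((\<lambda>s. F s B) has_real_derivative c * hopsum (F s) B + R s B) (at s within {0..t})"
    if "s \<in> {0..t}" "B \<in> ksets k" for s B
  proof -
    have d: "((\<lambda>s. f s B) has_real_derivative
        (hopsum (f s) B / (2 * real CARD('d)) - real k * f s B + r s B)) (at s within {0..t})"
      using that by (intro has_field_derivative_subset[OF deriv]) auto
    have h: "hopsum (F s) B = exp (real k * s) * hopsum (f s) B"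
      using hopsum_pow_cmult[where n = 1 and f = "f s" and c = "exp (real k * s)" and B = B]
      by (simp add: F_def[abs_def])
    show ?thesis
      unfolding h unfolding F_def R_def c_def
      by (auto intro!: derivative_eq_intros d simp: algebra_simps)
  qed
  have Fc: "continuous_on {0..t} (\<lambda>s. (hopsum ^^ n) (F s) B)" for n
    using hopsum_pow_deriv[OF B F'] by (intro DERIV_continuous_on)
  have Rc: "continuous_on {0..t} (\<lambda>s. (hopsum ^^ n) (R s) B)" for n
  proof (rule hopsum_pow_continuous[OF B])
    show "continuous_on {0..t} (\<lambda>s. R s B)" if "B \<in> ksets k" for B
      unfolding R_def using that
      by (intro continuous_intros continuous_on_subset[OF r_cont]) auto
  qed
  \<comment> \<open>The truncated series applied to \<open>F s\<close> interpolates between \<open>s = 0\<close> and \<open>F t\<close> at \<open>s = t\<close>; only finite sums are differentiated.\<close>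
  define H where "H N s = (\<Sum>n<N. (t - s) ^ n / fact n * c ^ n * (hopsum ^^ n) (F s) B)" for N s
  define D where "D N s = (\<Sum>n<N. (t - s) ^ n / fact n * c ^ n * (hopsum ^^ n) (R s) B)" for N s
  define E where "E N s = (t - s) ^ N / fact N * c ^ Suc N * (hopsum ^^ Suc N) (F s) B" for N s
  have H': "(H (Suc N) has_real_derivative D (Suc N) s + E N s) (at s within {0..t})"
    if s: "s \<in> {0..t}" for N s
  proof (induction N)
    case 0
    show ?case
      using F'[OF s B] by (simp add: H_def[abs_def] D_def E_def add.commute)
  next
    case (Suc N)
    have T: "((\<lambda>s. (hopsum ^^ Suc N) (F s) B) has_real_derivative
        c * (hopsum ^^ Suc (Suc N)) (F s) B + (hopsum ^^ Suc N) (R s) B) (at s within {0..t})"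
    proof -
      have "(hopsum ^^ Suc N) (\<lambda>B. c * hopsum (F s) B + R s B) B
          = c * (hopsum ^^ Suc (Suc N)) (F s) B + (hopsum ^^ Suc N) (R s) B"
        unfolding hopsum_pow_add hopsum_pow_cmult
        by (simp del: funpow.simps add: funpow_Suc_right)
      then show ?thesis
        by (intro DERIV_cong[OF hopsum_pow_deriv[OF B F'[OF s]]])
    qed
    \<comment> \<open>Differentiating the Taylor weight of the new term produces
      \<open>- E N s\<close>, which cancels the old remainder. What stays is the next source term
      and the new remainder \<open>E (Suc N) s\<close>.\<close>
    have "((\<lambda>s. H (Suc N) s + (t - s) ^ Suc N / fact (Suc N) * (c ^ Suc N * (hopsum ^^ Suc N) (F s) B))
       has_real_derivative (D (Suc N) s + E N s) +
         (- ((t - s) ^ N / fact N) * (c ^ Suc N * (hopsum ^^ Suc N) (F s) B)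
          + c ^ Suc N * (c * (hopsum ^^ Suc (Suc N)) (F s) B + (hopsum ^^ Suc N) (R s) B) * ((t - s) ^ Suc N / fact (Suc N)))) (at s within {0..t})"
      by (intro DERIV_add Suc.IH DERIV_mult' DERIV_cmult deriv_taylor_weight T, rule DERIV_cong,
          rule DERIV_mult, rule deriv_taylor_weight, rule DERIV_cmult, rule T) (simp add: algebra_simps)
    moreover have "(\<lambda>s. H (Suc N) s + (t - s) ^ Suc N / fact (Suc N) * (c ^ Suc N * (hopsum ^^ Suc N) (F s) B)) = H (Suc (Suc N))"
      unfolding H_def by (rule ext, subst (2) sum.lessThan_Suc) (simp add: mult_ac)
    moreover have "(D (Suc N) s + E N s) +
         (- ((t - s) ^ N / fact N) * (c ^ Suc N * (hopsum ^^ Suc N) (F s) B)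
          + c ^ Suc N * (c * (hopsum ^^ Suc (Suc N)) (F s) B + (hopsum ^^ Suc N) (R s) B) * ((t - s) ^ Suc N / fact (Suc N)))
        = D (Suc (Suc N)) s + E (Suc N) s"
    proof -
      have "D (Suc (Suc N)) s = D (Suc N) s + (t - s) ^ Suc N / fact (Suc N) * c ^ Suc N * (hopsum ^^ Suc N) (R s) B"
        unfolding D_def by (rule sum.lessThan_Suc)
      then show ?thesis
        unfolding E_def power_Suc[of c "Suc N"] by (simp only: algebra_simps)
    qed
    ultimately show ?case by simp
  qed
  have F_nn: "0 \<le> F s B" if "0 \<le> s" "B \<in> ksets k" for s B
    using f_nn that by (simp add: F_def)
  have R_nn: "0 \<le> R s B" if "0 \<le> s" "B \<in> ksets k" for s B
    using r_nn that by (simp add: R_def)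
  have D_nn: "0 \<le> D N s" if "s \<in> {0..t}" for N s
    unfolding D_def using that c0 by (intro sum_nonneg mult_nonneg_nonneg hopsum_pow_nonneg[OF B R_nn]) auto
  have E_nn: "0 \<le> E N s" if "s \<in> {0..t}" for N s
    unfolding E_def using that c0 by (intro mult_nonneg_nonneg hopsum_pow_nonneg[OF B F_nn]) auto
  define C where "C = real k * (2 * real CARD('d))"
  \<comment> \<open>The term of an exponential series that results from
    \<open>F s B \<le> exp (k * t)\<close> and the factor \<open>C\<close> per application of
    \<open>hopsum\<close>.\<close>
  define M where "M N = c * exp (real k * t) * C * ((t * c * C) ^ N / fact N)" for N
  have E_le: "E N s \<le> M N" if s: "s \<in> {0..t}" for N s
  proof -
    have "(hopsum ^^ Suc N) (F s) B \<le> exp (real k * t) * C ^ Suc N"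
      unfolding C_def
    proof (rule hopsum_pow_le[OF B])
      show "F s B \<le> exp (real k * t)" if "B \<in> ksets k" for B
        using f_le[of s B] f_nn[of s B] that s unfolding F_def
        by (intro mult_le_one[THEN order_trans] order_trans[OF mult_left_le]) (auto intro: mult_left_mono)
    qed
    then have "E N s \<le> t ^ N / fact N * c ^ Suc N * (exp (real k * t) * C ^ Suc N)"
      unfolding E_def using s c0
      by (intro mult_mono divide_right_mono power_mono hopsum_pow_nonneg[OF B F_nn]) auto
    also have "\<dots> = M N" by (simp add: M_def power_mult_distrib)
    finally show ?thesis .
  qed
  have M0: "M \<longlonglongrightarrow> 0"
    unfolding M_def by (intro tendsto_mult_right_zero summable_LIMSEQ_zero)
      (use summable_exp[of "t * c * C"] in \<open>simp add: field_simps\<close>)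
  have Dc: "continuous_on {0..t} (D N)" for N
    unfolding D_def[abs_def] by (intro continuous_intros Rc) auto
  have Ec: "continuous_on {0..t} (E N)" for N
    unfolding E_def[abs_def] by (intro continuous_intros Fc) auto
  have meas: "(\<lambda>s. ennreal (h s) * indicator {0..t} s) \<in> borel_measurable lborel"
    if "continuous_on {0..t} h" for h :: "real \<Rightarrow> real"
  proof -
    have "(\<lambda>s. ennreal (indicator {0..t} s *\<^sub>R h s)) \<in> borel_measurable lborel"
      by (intro measurable_compose[OF _ measurable_ennreal]) (use borel_measurable_continuous_on_indicator[OF _ that] in simp)
    also have "(\<lambda>s. ennreal (indicator {0..t} s *\<^sub>R h s)) = (\<lambda>s. ennreal (h s) * indicator {0..t} s)"
      by (auto split: split_indicator)
    finally show ?thesis .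
  qed
  note measD = meas[OF Dc] and measE = meas[OF Ec]
  have main: "ennreal (F t B) = ennreal (H (Suc N) 0) +
      ((\<integral>\<^sup>+s. ennreal (D (Suc N) s) * indicator {0..t} s \<partial>lborel) + (\<integral>\<^sup>+s. ennreal (E N s) * indicator {0..t} s \<partial>lborel))" for N
  proof -
    have "(\<integral>\<^sup>+s. ennreal (D (Suc N) s + E N s) * indicator {0..t} s \<partial>lborel)
        = ennreal (H (Suc N) t - H (Suc N) 0)"
      using t by (intro nn_integral_FTC_within(1) H' continuous_on_add Dc Ec add_nonneg_nonneg D_nn E_nn) auto
    also have "(\<integral>\<^sup>+s. ennreal (D (Suc N) s + E N s) * indicator {0..t} s \<partial>lborel)
       = (\<integral>\<^sup>+s. ennreal (D (Suc N) s) * indicator {0..t} s + ennreal (E N s) * indicator {0..t} s \<partial>lborel)"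
      by (intro nn_integral_cong) (use D_nn E_nn in \<open>auto split: split_indicator\<close>)
    also have "\<dots> = (\<integral>\<^sup>+s. ennreal (D (Suc N) s) * indicator {0..t} s \<partial>lborel) + (\<integral>\<^sup>+s. ennreal (E N s) * indicator {0..t} s \<partial>lborel)"
      by (rule nn_integral_add[OF measD measE])
    finally have eq: "\<dots> = ennreal (H (Suc N) t - H (Suc N) 0)" .
    have "H (Suc N) t = F t B"
      unfolding H_def sum.lessThan_Suc_shift by simp
    moreover have "0 \<le> H (Suc N) 0"
      unfolding H_def using t c0 by (intro sum_nonneg mult_nonneg_nonneg hopsum_pow_nonneg[OF B F_nn]) auto
    \<comment> \<open>\<open>ennreal\<close> truncates negative differences to 0; monotonicity
      ensures that \<open>H (Suc N) t - H (Suc N) 0\<close> is not truncated.\<close>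
    moreover have "H (Suc N) 0 \<le> H (Suc N) t"
    proof (rule nn_integral_FTC_within(2)[OF t])
      show "(H (Suc N) has_real_derivative D (Suc N) s + E N s) (at s within {0..t})" if "0 \<le> s" "s \<le> t" for s
        using that by (intro H') auto
      show "0 \<le> D (Suc N) s + E N s" if "0 \<le> s" "s \<le> t" for s
        using that by (intro add_nonneg_nonneg D_nn E_nn) auto
    qed (intro continuous_on_add Dc Ec)
    ultimately show ?thesis unfolding eq by (simp flip: ennreal_plus)
  qed
  have series: "(\<lambda>N. ennreal (\<Sum>n<Suc N. (t - s) ^ n / fact n * c ^ n * (hopsum ^^ n) (\<lambda>B. exp (real k * s) * g B) B))
      \<longlonglongrightarrow> ennreal (exp (real k * t)) * sg k (t - s) (\<lambda>B. ennreal (g B)) B"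
    if s: "s \<in> {0..t}" and g: "\<And>B. B \<in> ksets k \<Longrightarrow> 0 \<le> g B" for s g
  proof -
    let ?w = "\<lambda>n. exp (- (real k * (t - s))) * (((t - s) / (2 * real CARD('d))) ^ n / fact n)"
    have "(\<lambda>N. \<Sum>n<Suc N. ennreal (?w n) * (hopsum ^^ n) (\<lambda>B. ennreal (g B)) B)
        \<longlonglongrightarrow> sg k (t - s) (\<lambda>B. ennreal (g B)) B"
      unfolding sg_def using summable_LIMSEQ[OF summableI] by (rule LIMSEQ_Suc)
    then have lim: "(\<lambda>N. ennreal (exp (real k * t)) * (\<Sum>n<Suc N. ennreal (?w n) * (hopsum ^^ n) (\<lambda>B. ennreal (g B)) B))
       \<longlonglongrightarrow> ennreal (exp (real k * t)) * sg k (t - s) (\<lambda>B. ennreal (g B)) B"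
      by (intro ennreal_tendsto_cmult) auto
    have "ennreal (exp (real k * t)) * (\<Sum>n<Suc N. ennreal (?w n) * (hopsum ^^ n) (\<lambda>B. ennreal (g B)) B)
       = ennreal (\<Sum>n<Suc N. (t - s) ^ n / fact n * c ^ n * (hopsum ^^ n) (\<lambda>B. exp (real k * s) * g B) B)" for N
    proof -
      have hn: "0 \<le> (hopsum ^^ n) g B" for n
        by (rule hopsum_pow_nonneg[OF B g])
      have w: "0 \<le> ?w n" for n using s by simp
      have "(\<Sum>n<Suc N. ennreal (?w n) * (hopsum ^^ n) (\<lambda>B. ennreal (g B)) B)
          = (\<Sum>n<Suc N. ennreal (?w n * (hopsum ^^ n) g B))"
        by (intro sum.cong refl) (simp only: hopsum_pow_ennreal[OF B g] ennreal_mult[OF w hn])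
      also have "\<dots> = ennreal (\<Sum>n<Suc N. ?w n * (hopsum ^^ n) g B)"
        by (intro sum_ennreal mult_nonneg_nonneg w hn)
      finally have "ennreal (exp (real k * t)) * (\<Sum>n<Suc N. ennreal (?w n) * (hopsum ^^ n) (\<lambda>B. ennreal (g B)) B)
          = ennreal (exp (real k * t) * (\<Sum>n<Suc N. ?w n * (hopsum ^^ n) g B))"
        using ennreal_mult[OF exp_ge_zero, of "\<Sum>n<Suc N. ?w n * (hopsum ^^ n) g B"] w hn
        by (simp only: sum_nonneg mult_nonneg_nonneg)
      also have "exp (real k * t) * (\<Sum>n<Suc N. ?w n * (hopsum ^^ n) g B)
          = (\<Sum>n<Suc N. (t - s) ^ n / fact n * c ^ n * (hopsum ^^ n) (\<lambda>B. exp (real k * s) * g B) B)"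
        unfolding sum_distrib_left hopsum_pow_cmult
      proof (intro sum.cong refl)
        fix n
        have "exp (real k * t) * exp (- (real k * (t - s))) = exp (real k * s)"
          by (simp add: algebra_simps flip: exp_add)
        then show "exp (real k * t) * (?w n * (hopsum ^^ n) g B)
            = (t - s) ^ n / fact n * c ^ n * (exp (real k * s) * (hopsum ^^ n) g B)"
          by (simp add: c_def power_divide power_mult_distrib mult_ac)
      qed
      finally show ?thesis .
    qed
    then show ?thesis using lim by simp
  qed
  have Hlim: "(\<lambda>N. ennreal (H (Suc N) 0)) \<longlonglongrightarrow> ennreal (exp (real k * t)) * sg k t (\<lambda>B. ennreal (f 0 B)) B"
    using series[of 0 "f 0"] t f_nn by (simp add: H_def F_def[abs_def] del: sum.lessThan_Suc)
  have Dlim: "(\<lambda>N. ennreal (D (Suc N) s)) \<longlonglongrightarrow> ennreal (exp (real k * t)) * sg k (t - s) (\<lambda>B. ennreal (r s B)) B"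
    if "s \<in> {0..t}" for s
    using series[OF that, of "r s"] that r_nn by (simp add: D_def R_def[abs_def] del: sum.lessThan_Suc)
  \<comment> \<open>The partial sums increase with \<open>N\<close>, all terms being nonnegative, so
    monotone convergence applies to a source without a bound that is uniform over sets.\<close>
  have Dint: "(\<lambda>N. \<integral>\<^sup>+s. ennreal (D (Suc N) s) * indicator {0..t} s \<partial>lborel)
     \<longlonglongrightarrow> (\<integral>\<^sup>+s. ennreal (exp (real k * t)) * sg k (t - s) (\<lambda>B. ennreal (r s B)) B * indicator {0..t} s \<partial>lborel)"
  proof (rule nn_integral_LIMSEQ)
    show "incseq (\<lambda>N s. ennreal (D (Suc N) s) * indicator {0..t} s)"
    proof (intro incseq_SucI le_funI)
      fix N s
      have "D (Suc N) s \<le> D (Suc (Suc N)) s" if s: "s \<in> {0..t}"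
        unfolding D_def using s c0 R_nn
        by (intro sum_mono2 mult_nonneg_nonneg hopsum_pow_nonneg[OF B R_nn]) auto
      then show "ennreal (D (Suc N) s) * indicator {0..t} s
          \<le> ennreal (D (Suc (Suc N)) s) * indicator {0..t} s"
        by (auto split: split_indicator intro: ennreal_leI)
    qed
    show "(\<lambda>N. ennreal (D (Suc N) s) * indicator {0..t} s) \<longlonglongrightarrow>
        ennreal (exp (real k * t)) * sg k (t - s) (\<lambda>B. ennreal (r s B)) B * indicator {0..t} s" for s
      using Dlim[of s] by (auto split: split_indicator)
  qed (rule measD)
  have Eint: "(\<lambda>N. \<integral>\<^sup>+s. ennreal (E N s) * indicator {0..t} s \<partial>lborel) \<longlonglongrightarrow> 0"
  proof (rule tendsto_sandwich[OF _ _ tendsto_const])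
    show "\<forall>\<^sub>F N in sequentially. (\<integral>\<^sup>+s. ennreal (E N s) * indicator {0..t} s \<partial>lborel)
        \<le> ennreal (M N) * ennreal t"
    proof (intro always_eventually allI)
      fix N
      have "(\<integral>\<^sup>+s. ennreal (E N s) * indicator {0..t} s \<partial>lborel)
          \<le> (\<integral>\<^sup>+s. ennreal (M N) * indicator {0..t} s \<partial>lborel)"
        using E_le by (intro nn_integral_mono) (auto split: split_indicator intro: ennreal_leI)
      then show "(\<integral>\<^sup>+s. ennreal (E N s) * indicator {0..t} s \<partial>lborel) \<le> ennreal (M N) * ennreal t"
        using t by (simp add: nn_integral_cmult_indicator)
    qed
    have "(\<lambda>N. ennreal t * ennreal (M N)) \<longlonglongrightarrow> ennreal t * ennreal 0"
      by (intro ennreal_tendsto_cmult tendsto_ennrealI M0) auto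
    then show "(\<lambda>N. ennreal (M N) * ennreal t) \<longlonglongrightarrow> 0" by (simp add: mult.commute)
  qed auto
  have meas_sg: "(\<lambda>s. sg k (t - s) (\<lambda>B. ennreal (r s B)) B * indicator {0..t} s) \<in> borel_measurable lborel"
  proof -
    have m: "(\<lambda>s. (ennreal (D (Suc N) s) * indicator {0..t} s)) \<in> borel_measurable lborel" for N
      by (rule measD)
    have "(\<lambda>s. ennreal (exp (real k * t)) * sg k (t - s) (\<lambda>B. ennreal (r s B)) B * indicator {0..t} s) \<in> borel_measurable lborel"
      by (rule borel_measurable_LIMSEQ_order[where u
          = "\<lambda>N s. ennreal (D (Suc N) s) * indicator {0..t} s", OF _ m]) (use Dlim in \<open>auto split: split_indicator\<close>)
    then have "(\<lambda>s. ennreal (exp (- (real k * t))) * (ennreal (exp (real k * t)) * sg k (t - s) (\<lambda>B. ennreal (r s B)) B * indicator {0..t} s)) \<in> borel_measurable lborel"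
      by measurable
    then show ?thesis by (simp add: mult.assoc[symmetric] ennreal_mult[symmetric] flip: exp_add)
  qed
  have "(\<lambda>N. ennreal (H (Suc N) 0) +
      ((\<integral>\<^sup>+s. ennreal (D (Suc N) s) * indicator {0..t} s \<partial>lborel) + (\<integral>\<^sup>+s. ennreal (E N s) * indicator {0..t} s \<partial>lborel)))
    \<longlonglongrightarrow> ennreal (exp (real k * t)) * sg k t (\<lambda>B. ennreal (f 0 B)) B
     + ((\<integral>\<^sup>+s. ennreal (exp (real k * t)) * sg k (t - s) (\<lambda>B. ennreal (r s B)) B * indicator {0..t} s \<partial>lborel) + 0)"
    by (intro tendsto_add Hlim Dint Eint)
  then have "ennreal (F t B) = ennreal (exp (real k * t)) * sg k t (\<lambda>B. ennreal (f 0 B)) B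
     + (\<integral>\<^sup>+s. ennreal (exp (real k * t)) * sg k (t - s) (\<lambda>B. ennreal (r s B)) B * indicator {0..t} s \<partial>lborel)"
    unfolding main[symmetric] LIMSEQ_const_iff by simp
  also have "\<dots> = ennreal (exp (real k * t)) * (sg k t (\<lambda>B. ennreal (f 0 B)) B
     + (\<integral>\<^sup>+s. sg k (t - s) (\<lambda>B. ennreal (r s B)) B * indicator {0..t} s \<partial>lborel))"
    unfolding mult.assoc nn_integral_cmult[OF meas_sg] distrib_left ..
  also have "ennreal (F t B) = ennreal (exp (real k * t)) * ennreal (f t B)"
    using f_nn[OF t B] by (simp add: F_def ennreal_mult)
  finally show "ennreal (f t B) = sg k t (\<lambda>B. ennreal (f 0 B)) B
     + (\<integral>\<^sup>+s. sg k (t - s) (\<lambda>B. ennreal (r s B)) B * indicator {0..t} s \<partial>lborel)"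
    by (simp add: ennreal_mult_cancel_left)
  show "(\<lambda>s. sg k (t - s) (\<lambda>B. ennreal (r s B)) B * indicator {0..t} s) \<in> borel_measurable lborel"
    by (rule meas_sg)
qed

section \<open>Symmetry of the semigroup for counting measure\<close>

lemma countable_ksets [simp]: "countable (ksets k :: (int ^ 'd::finite) set set)"
  by (rule countable_subset[OF _ countable_Collect_finite]) (auto simp: ksets_def)

lemma nn_sum_finite:
  fixes f :: "'a \<Rightarrow> ennreal"
  assumes "finite B" "B \<subseteq> X"
  shows "(\<Sum>x\<in>B. f x) = (\<integral>\<^sup>+x. of_bool (x \<in> B) * f x \<partial>count_space X)"
  using assms by (subst nn_integral_count_space'[of B]) auto

lemma nn_swap:
  fixes f :: "'a::countable \<Rightarrow> 'b \<Rightarrow> ennreal"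
  shows "(\<integral>\<^sup>+x. \<integral>\<^sup>+B. f x B \<partial>count_space Y \<partial>count_space X)
      = (\<integral>\<^sup>+B. \<integral>\<^sup>+x. f x B \<partial>count_space X \<partial>count_space Y)"
  by (rule nn_integral_count_space_nn_integral[symmetric]) auto

lemma transpose_involution_image [simp]:
  "Transposition.transpose x y ` Transposition.transpose x y ` B = B"
  by (simp add: image_comp)

lemma bij_transpose_ksets: "bij_betw (\<lambda>B. Transposition.transpose x y ` B) (ksets k) (ksets k)"
  by (rule bij_betwI[where g = "\<lambda>B. Transposition.transpose x y ` B"]) auto

lemma mem_transpose_image: "x \<in> Transposition.transpose x y ` B \<longleftrightarrow> y \<in> B"
  by (metis image_eqI transpose_apply_first transpose_apply_second transpose_involutory imageE)

definition edges :: "((int ^ 'd::finite) \<times> (int ^ 'd)) set" where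
  "edges = Sigma UNIV neighbours"

lemma hopsum_eq_edges:
  fixes f :: "(int ^ 'd::finite) set \<Rightarrow> ennreal"
  assumes "B \<in> ksets k"
  shows "hopsum f B = (\<integral>\<^sup>+p. of_bool (fst p \<in> B) * f (Transposition.transpose (fst p) (snd p) ` B) \<partial>count_space edges)"
proof -
  have "hopsum f B = (\<Sum>p\<in>Sigma B neighbours. f (Transposition.transpose (fst p) (snd p) ` B))"
    using assms by (simp add: hopsum_def sum.Sigma ksets_def case_prod_beta)
  also have "\<dots> = (\<integral>\<^sup>+p. of_bool (p \<in> Sigma B neighbours) * f (Transposition.transpose (fst p) (snd p) ` B) \<partial>count_space edges)"
    using assms by (intro nn_sum_finite) (auto simp: edges_def ksets_def)
  also have "\<dots> = (\<integral>\<^sup>+p. of_bool (fst p \<in> B) * f (Transposition.transpose (fst p) (snd p) ` B) \<partial>count_space edges)"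
    by (intro nn_integral_cong) (auto simp: edges_def)
  finally show ?thesis .
qed

lemma bij_swap_edges: "bij_betw prod.swap edges edges"
  by (rule bij_betwI[where g = prod.swap]) (auto simp: edges_def neighbours_sym)

text \<open>The transposition along an edge is an involution of \<open>ksets k\<close>. Substituting
  it in the sum over \<open>B\<close> exchanges \<open>f\<close> and \<open>g\<close> and turns the
  condition that the first endpoint lies in \<open>B\<close> into the same condition on the second;
  reversing the edge restores it.\<close>

lemma hopsum_sym:
  fixes f g :: "(int ^ 'd::finite) set \<Rightarrow> ennreal"
  shows "(\<integral>\<^sup>+B. g B * hopsum f B \<partial>count_space (ksets k)) = (\<integral>\<^sup>+B. f B * hopsum g B \<partial>count_space (ksets k))"
proof -
  let ?t = "\<lambda>p B. Transposition.transpose (fst p) (snd p) ` B"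
  have e: "(\<integral>\<^sup>+B. g B * hopsum f B \<partial>count_space (ksets k))
      = (\<integral>\<^sup>+p. \<integral>\<^sup>+B. of_bool (fst p \<in> B) * (g B * f (?t p B)) \<partial>count_space (ksets k) \<partial>count_space edges)" for f g
  proof -
    have "(\<integral>\<^sup>+B. g B * hopsum f B \<partial>count_space (ksets k))
        = (\<integral>\<^sup>+B. \<integral>\<^sup>+p. of_bool (fst p \<in> B) * (g B * f (?t p B)) \<partial>count_space edges \<partial>count_space (ksets k))"
      by (intro nn_integral_cong)
         (simp add: hopsum_eq_edges mult.left_commute flip: nn_integral_cmult)
    then show ?thesis by (simp add: nn_swap)
  qed
  have "(\<integral>\<^sup>+B. g B * hopsum f B \<partial>count_space (ksets k))
      = (\<integral>\<^sup>+p. \<integral>\<^sup>+B. of_bool (fst p \<in> ?t p B) * (g (?t p B) * f (?t p (?t p B))) \<partial>count_space (ksets k) \<partial>count_space edges)"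
    unfolding e
  proof (rule nn_integral_cong)
    fix p :: "(int ^ 'd) \<times> (int ^ 'd)"
    show "(\<integral>\<^sup>+B. of_bool (fst p \<in> B) * (g B * f (?t p B)) \<partial>count_space (ksets k))
       = (\<integral>\<^sup>+B. of_bool (fst p \<in> ?t p B) * (g (?t p B) * f (?t p (?t p B))) \<partial>count_space (ksets k))"
      using nn_integral_bij_count_space[OF bij_transpose_ksets[of "fst p" "snd p" k],
          of "\<lambda>B. of_bool (fst p \<in> B) * (g B * f (?t p B))"] by simp
  qed
  also have "\<dots> = (\<integral>\<^sup>+p. \<integral>\<^sup>+B. of_bool (snd p \<in> B) * (f B * g (?t p B)) \<partial>count_space (ksets k) \<partial>count_space edges)"
    by (simp add: mem_transpose_image mult.commute[of "g _"])
  also have "\<dots> = (\<integral>\<^sup>+p. \<integral>\<^sup>+B. of_bool (snd (prod.swap p) \<in> B) * (f B * g (?t (prod.swap p) B)) \<partial>count_space (ksets k) \<partial>count_space edges)"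
    by (rule nn_integral_bij_count_space[OF bij_swap_edges, symmetric])
  also have "\<dots> = (\<integral>\<^sup>+B. f B * hopsum g B \<partial>count_space (ksets k))"
    unfolding e by (simp add: transpose_commute)
  finally show ?thesis .
qed

lemma hopsum_pow_sym:
  fixes f g :: "(int ^ 'd::finite) set \<Rightarrow> ennreal"
  shows "(\<integral>\<^sup>+B. g B * (hopsum ^^ n) f B \<partial>count_space (ksets k))
      = (\<integral>\<^sup>+B. f B * (hopsum ^^ n) g B \<partial>count_space (ksets k))"
proof (induction n arbitrary: f)
  case 0
  show ?case by (simp add: mult.commute)
next
  case (Suc n)
  have "(\<integral>\<^sup>+B. g B * (hopsum ^^ Suc n) f B \<partial>count_space (ksets k))
      = (\<integral>\<^sup>+B. hopsum f B * (hopsum ^^ n) g B \<partial>count_space (ksets k))"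
    using Suc[of "hopsum f"] by (simp del: funpow.simps add: funpow_Suc_right)
  also have "\<dots> = (\<integral>\<^sup>+B. f B * (hopsum ^^ Suc n) g B \<partial>count_space (ksets k))"
    using hopsum_sym[where f = f and g = "(hopsum ^^ n) g" and k = k] by (simp add: mult.commute)
  finally show ?case .
qed

lemma sg_sym:
  fixes f g :: "(int ^ 'd::finite) set \<Rightarrow> ennreal"
  shows "(\<integral>\<^sup>+B. g B * sg k t f B \<partial>count_space (ksets k)) = (\<integral>\<^sup>+B. f B * sg k t g B \<partial>count_space (ksets k))"
proof -
  let ?w = "\<lambda>n. ennreal (exp (- (real k * t)) * ((t / (2 * real CARD('d))) ^ n / fact n))"
  have e: "(\<integral>\<^sup>+B. g B * sg k t f B \<partial>count_space (ksets k))
      = (\<Sum>n. ?w n * (\<integral>\<^sup>+B. g B * (hopsum ^^ n) f B \<partial>count_space (ksets k)))"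
    for f g :: "(int ^ 'd) set \<Rightarrow> ennreal"
  proof -
    have "(\<integral>\<^sup>+B. g B * sg k t f B \<partial>count_space (ksets k))
        = (\<integral>\<^sup>+B. (\<Sum>n. ?w n * (g B * (hopsum ^^ n) f B)) \<partial>count_space (ksets k))"
      unfolding sg_def ennreal_suminf_cmult[symmetric] mult.left_commute[of "g _"] ..
    also have "\<dots> = (\<Sum>n. \<integral>\<^sup>+B. ?w n * (g B * (hopsum ^^ n) f B) \<partial>count_space (ksets k))"
      by (rule nn_integral_suminf) simp
    also have "\<dots> = (\<Sum>n. ?w n * (\<integral>\<^sup>+B. g B * (hopsum ^^ n) f B \<partial>count_space (ksets k)))"
      by (subst nn_integral_cmult) auto
    finally show ?thesis .
  qed
  show ?thesis unfolding e hopsum_pow_sym[where f = f and g = g] ..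
qed

lemma sg_cong:
  "B \<in> ksets k \<Longrightarrow> (\<And>B. B \<in> ksets k \<Longrightarrow> f B = g B) \<Longrightarrow> sg k t f B = sg k t g B"
  unfolding sg_def by (subst hopsum_pow_cong[of B k f g]) auto

section \<open>Products of solutions of the heat equation\<close>

definition heat :: "(real \<Rightarrow> int ^ 'd::finite \<Rightarrow> real) \<Rightarrow> bool" where
  "heat q \<longleftrightarrow> (\<forall>s\<ge>0. \<forall>x. 0 \<le> q s x \<and> q s x \<le> 1 \<and>
     ((\<lambda>s. q s x) has_real_derivative (\<Sum>y\<in>neighbours x. q s y) / (2 * real CARD('d)) - q s x) (at s within {0..}))"

text \<open>The amount by which a product of solutions of the heat equation fails to solve the exclusion equation.\<close>

definition pair_energy :: "(int ^ 'd::finite \<Rightarrow> real) \<Rightarrow> (int ^ 'd) set \<Rightarrow> real" where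
  "pair_energy q B = (\<Sum>x\<in>B. \<Sum>y\<in>neighbours x \<inter> B. (q x - q y)\<^sup>2 * (\<Prod>z\<in>B - {x, y}. q z)) / (4 * real CARD('d))"

text \<open>The left side is the generator of independent walks applied to the product. A jump from
  \<open>x\<close> to a site outside \<open>B\<close> agrees with the exclusion move. A jump onto
  \<open>y \<in> B\<close> is a null move for exclusion, while the product changes by
  \<open>(q y - q x) * q y\<close> times the remaining factors; adding the orientations
  \<open>xy\<close> and \<open>yx\<close> gives \<open>(q x - q y)\<^sup>2\<close>. Halving it and
  dividing by \<open>2d\<close> explains the \<open>4d\<close> in
  \<open>pair_energy\<close>.\<close>

lemma hopsum_prod:
  fixes q :: "int ^ 'd::finite \<Rightarrow> real"
  assumes B: "finite B"
  shows "(\<Sum>x\<in>B. ((\<Sum>y\<in>neighbours x. q y) / (2 * real CARD('d)) - q x) * prod q (B - {x}))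
     = hopsum (prod q) B / (2 * real CARD('d)) - real (card B) * prod q B + pair_energy q B"
proof -
  define m where "m = 2 * real CARD('d)"
  have m: "m > 0" by (simp add: m_def)
  have mc: "(\<Sum>y\<in>neighbours x. c) = m * c" for c and x :: "int ^ 'd" by (simp add: m_def)
  have rem: "prod q B = q x * prod q (B - {x})" if "x \<in> B" for x
    using that B by (simp add: prod.remove)
  have step: "(\<Sum>y\<in>neighbours x. q y - q x) * prod q (B - {x})
     = (\<Sum>y\<in>neighbours x. prod q (Transposition.transpose x y ` B) - prod q B)
       + (\<Sum>y\<in>neighbours x \<inter> B. (q y - q x) * (q y * prod q (B - {x, y})))" if x: "x \<in> B" for x
  proof -
    have "(q y - q x) * prod q (B - {x}) = prod q (Transposition.transpose x y ` B) - prod q B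
       + (if y \<in> B then (q y - q x) * (q y * prod q (B - {x, y})) else 0)" if y: "y \<in> neighbours x" for y
    proof (cases "y \<in> B")
      case True
      have "x \<noteq> y" using y by auto
      then have "prod q (B - {x}) = q y * prod q (B - {x, y})"
        using prod.remove[of "B - {x}" y q] B True by (simp add: Diff_insert2[symmetric] insert_commute)
      moreover have "Transposition.transpose x y ` B = B"
        by (intro transpose_image_eq) (use x True in simp)
      ultimately show ?thesis using True by simp
    next
      case False
      have "Transposition.transpose x y ` B = insert y (B - {x})"
        using x False by (auto simp: Transposition.transpose_def image_iff)
      then show ?thesis
        using False B rem[OF x] by (simp add: algebra_simps)
    qed
    then show ?thesis
      by (simp add: sum_distrib_right sum.distrib sum.inter_restrict cong: sum.cong)
  qed
  have "m * (\<Sum>x\<in>B. ((\<Sum>y\<in>neighbours x. q y) / m - q x) * prod q (B - {x}))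
      = (\<Sum>x\<in>B. (\<Sum>y\<in>neighbours x. q y - q x) * prod q (B - {x}))"
    unfolding sum_distrib_left
  proof (intro sum.cong refl)
    fix x
    have "(\<Sum>y\<in>neighbours x. q y - q x) = m * ((\<Sum>y\<in>neighbours x. q y) / m - q x)"
      unfolding sum_subtractf mc using m by (simp add: field_simps)
    then show "m * (((\<Sum>y\<in>neighbours x. q y) / m - q x) * prod q (B - {x}))
       = (\<Sum>y\<in>neighbours x. q y - q x) * prod q (B - {x})" by simp
  qed
  also have "\<dots> = (hopsum (prod q) B - m * real (card B) * prod q B)
      + (\<Sum>x\<in>B. \<Sum>y\<in>neighbours x \<inter> B. (q y - q x) * (q y * prod q (B - {x, y})))"
    using step by (simp add: sum.distrib hopsum_def sum_subtractf mc[unfolded m_def] m_def)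
  also have "(\<Sum>x\<in>B. \<Sum>y\<in>neighbours x \<inter> B. (q y - q x) * (q y * prod q (B - {x, y})))
     = (\<Sum>x\<in>B. \<Sum>y\<in>neighbours x \<inter> B. (q x - q y)\<^sup>2 * prod q (B - {x, y})) / 2" (is "?S = ?T / 2")
  proof -
    have sw: "(\<Sum>x\<in>B. \<Sum>y\<in>neighbours x \<inter> B. h x y)
        = (\<Sum>x\<in>B. \<Sum>y\<in>neighbours x \<inter> B. h y x)" for h :: "int ^ 'd \<Rightarrow> int ^ 'd \<Rightarrow> real"
    proof -
      have "(\<Sum>x\<in>B. \<Sum>y\<in>neighbours x \<inter> B. h x y) = (\<Sum>x\<in>B. \<Sum>y\<in>B. if y \<in> neighbours x then h x y else 0)"
        by (rule sum.cong[OF refl]) (use B in \<open>simp add: Int_commute[of _ B] sum.inter_restrict\<close>)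
      also have "\<dots> = (\<Sum>x\<in>B. \<Sum>y\<in>B. if x \<in> neighbours y then h y x else 0)"
        by (rule sum.swap)
      also have "\<dots> = (\<Sum>x\<in>B. \<Sum>y\<in>neighbours x \<inter> B. h y x)"
        by (rule sum.cong[OF refl]) (use B in \<open>simp add: Int_commute[of _ B] sum.inter_restrict neighbours_sym\<close>)
      finally show ?thesis .
    qed
    have "?S + ?S = ?T"
      by (subst (2) sw, unfold sum.distrib[symmetric], intro sum.cong refl)
         (simp add: insert_commute power2_eq_square algebra_simps)
    then show ?thesis by simp
  qed
  also have "(\<Sum>x\<in>B. \<Sum>y\<in>neighbours x \<inter> B. (q x - q y)\<^sup>2 * prod q (B - {x, y})) / 2 = m * pair_energy q B"
    by (simp add: pair_energy_def m_def)
  finally have "m * (\<Sum>x\<in>B. ((\<Sum>y\<in>neighbours x. q y) / m - q x) * prod q (B - {x}))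
     = m * (hopsum (prod q) B / m - real (card B) * prod q B + pair_energy q B)"
    using m by (simp only: distrib_left right_diff_distrib mult.assoc[symmetric]) simp
  then show ?thesis using m unfolding m_def[symmetric] by simp
qed

lemma DERIV_prod_within:
  fixes f :: "'a \<Rightarrow> real \<Rightarrow> real"
  assumes "finite A" "\<And>x. x \<in> A \<Longrightarrow> (f x has_real_derivative f' x) (at s within X)"
  shows "((\<lambda>s. \<Prod>x\<in>A. f x s) has_real_derivative (\<Sum>x\<in>A. f' x * (\<Prod>y\<in>A - {x}. f y s))) (at s within X)"
  using assms
proof (induction rule: finite_induct)
  case (insert a A)
  have "((\<lambda>s. f a s * (\<Prod>x\<in>A. f x s)) has_real_derivative
     f' a * (\<Prod>x\<in>A. f x s) + (\<Sum>x\<in>A. f' x * (\<Prod>y\<in>A - {x}. f y s)) * f a s) (at s within X)"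
    using insert by (intro DERIV_mult) auto
  moreover have "(\<Sum>x\<in>A. f' x * (\<Prod>y\<in>A - {x}. f y s)) * f a s = (\<Sum>x\<in>A. f' x * (\<Prod>y\<in>insert a A - {x}. f y s))"
    unfolding sum_distrib_right
  proof (intro sum.cong refl)
    fix x assume "x \<in> A"
    then have "insert a A - {x} = insert a (A - {x})" using insert.hyps by auto
    then show "f' x * (\<Prod>y\<in>A - {x}. f y s) * f a s = f' x * (\<Prod>y\<in>insert a A - {x}. f y s)"
      using insert.hyps by simp
  qed
  ultimately show ?case using insert.hyps by simp
qed simp

lemma pair_energy_nonneg: "(\<And>x. 0 \<le> q x) \<Longrightarrow> 0 \<le> pair_energy q B"
  unfolding pair_energy_def by (intro divide_nonneg_nonneg sum_nonneg mult_nonneg_nonneg prod_nonneg) auto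

text \<open>The bounds built into \<open>heat\<close> keep products in \<open>[0, 1]\<close>, as
  \<open>duhamel\<close> demands. Leibniz's rule yields the generator of independent walks, and
  \<open>hopsum_prod\<close> rewrites it as the exclusion generator plus a nonnegative
  source.\<close>

lemma
  fixes q :: "real \<Rightarrow> int ^ 'd::finite \<Rightarrow> real"
  assumes "heat q" and t: "0 \<le> t" and B: "B \<in> ksets k"
  shows heat_prod_duhamel: "ennreal (prod (q t) B) = sg k t (\<lambda>B. ennreal (prod (q 0) B)) B
     + (\<integral>\<^sup>+s. sg k (t - s) (\<lambda>B. ennreal (pair_energy (q s) B)) B * indicator {0..t} s \<partial>lborel)" (is ?A)
    and heat_prod_measurable:
      "(\<lambda>s. sg k (t - s) (\<lambda>B. ennreal (pair_energy (q s) B)) B * indicator {0..t} s) \<in> borel_measurable lborel" (is ?B)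
proof -
  have q: "0 \<le> q s x" "q s x \<le> 1"
    "((\<lambda>s. q s x) has_real_derivative (\<Sum>y\<in>neighbours x. q s y) / (2 * real CARD('d)) - q s x) (at s within {0..})"
    if "0 \<le> s" for s x using assms(1) that by (auto simp: heat_def)
  have qc: "continuous_on {0..} (\<lambda>s. q s x)" for x
    by (rule DERIV_continuous_on) (use q(3) in auto)
  have 1: "((\<lambda>s. prod (q s) B) has_real_derivative
        hopsum (prod (q s)) B / (2 * real CARD('d)) - real k * prod (q s) B + pair_energy (q s) B) (at s within {0..})"
    if s: "0 \<le> s" and B: "B \<in> ksets k" for s B
  proof (rule DERIV_cong)
    show "((\<lambda>s. prod (q s) B) has_real_derivative
      (\<Sum>x\<in>B. ((\<Sum>y\<in>neighbours x. q s y) / (2 * real CARD('d)) - q s x) * prod (q s) (B - {x}))) (at s within {0..})"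
      using B q(3)[OF s] by (intro DERIV_prod_within) (auto simp: ksets_def)
    show "(\<Sum>x\<in>B. ((\<Sum>y\<in>neighbours x. q s y) / (2 * real CARD('d)) - q s x) * prod (q s) (B - {x}))
      = hopsum (prod (q s)) B / (2 * real CARD('d)) - real k * prod (q s) B + pair_energy (q s) B"
      using B hopsum_prod[of B "q s"] by (simp add: ksets_def)
  qed
  have 2: "continuous_on {0..} (\<lambda>s. pair_energy (q s) B)" for B
    unfolding pair_energy_def by (intro continuous_intros qc) auto
  have 3: "0 \<le> pair_energy (q s) B" if "0 \<le> s" for s B
    using q that by (intro pair_energy_nonneg)
  have 4: "0 \<le> prod (q s) B" "prod (q s) B \<le> 1" if "0 \<le> s" for s B
    using q that by (auto intro!: prod_nonneg prod_le_1)
  show ?A ?B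
    by (rule duhamel[where f = "\<lambda>s. prod (q s)" and r = "\<lambda>s. pair_energy (q s)", OF 1 2 3 4 t B]
        duhamel_measurable[where f = "\<lambda>s. prod (q s)" and r
            = "\<lambda>s. pair_energy (q s)", OF 1 2 3 4 t B]; assumption)+
qed

definition occ :: "'a set \<Rightarrow> 'a set \<Rightarrow> ennreal" where
  "occ A B = of_bool (B \<subseteq> A)"

lemma prod_of_bool_occ: "finite B \<Longrightarrow> ennreal (\<Prod>x\<in>B. of_bool (x \<in> A)) = occ A B"
  by (induction rule: finite_induct) (auto simp: occ_def)

text \<open>Liggett's inequality for product functions.\<close>

lemma sg_occ_le:
  assumes "heat q" "\<And>x. q 0 x = of_bool (x \<in> A)" "0 \<le> t" "B \<in> ksets k"
  shows "sg k t (occ A) B \<le> ennreal (prod (q t) B)"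
proof -
  have "sg k t (occ A) B = sg k t (\<lambda>B. ennreal (prod (q 0) B)) B"
    using assms by (intro sg_cong[OF assms(4)]) (simp add: prod_of_bool_occ ksets_def)
  then show ?thesis using heat_prod_duhamel[OF assms(1,3,4)] by simp
qed

text \<open>A one-point set contains no adjacent pair, so the source vanishes: a lone particle under
  exclusion is a random walk. In particular a solution of the heat equation is determined by its
  initial values.\<close>

lemma heat_eq_sg:
  fixes q :: "real \<Rightarrow> int ^ 'd::finite \<Rightarrow> real"
  assumes "heat q" "0 \<le> t"
  shows "ennreal (q t x) = sg 1 t (\<lambda>B. ennreal (prod (q 0) B)) {x}"
proof -
  have B: "{x} \<in> ksets 1" by (simp add: ksets_def)
  have z: "pair_energy (q s) B = 0" if "B \<in> ksets 1" for s B
    using that by (auto simp: ksets_def pair_energy_def card_1_singleton_iff sum.neutral)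
  have "sg 1 u (\<lambda>B. ennreal (pair_energy (q s) B)) {x} = 0" for u s
  proof -
    have "sg 1 u (\<lambda>B. ennreal (pair_energy (q s) B)) {x} = sg 1 u (\<lambda>B. 0 * 0) {x}"
      by (rule sg_cong[OF B]) (simp add: z)
    then show ?thesis unfolding sg_def hopsum_pow_cmult by simp
  qed
  then show ?thesis using heat_prod_duhamel[OF assms B] by simp
qed

section \<open>Binomial moments\<close>

text \<open>The elementary symmetric function of degree \<open>k\<close> in infinitely many
  variables. For \<open>v x \<le> 1\<close> it is the \<open>k\<close>-th binomial moment of a sum
  of independent indicators with probabilities \<open>v x\<close>.\<close>

definition esym :: "('a \<Rightarrow> ennreal) \<Rightarrow> nat \<Rightarrow> ennreal" where
  "esym v k = (\<integral>\<^sup>+B. prod v B \<partial>count_space (ksets k))"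

lemma nn_restrict:
  fixes f :: "'a \<Rightarrow> ennreal"
  shows "(\<integral>\<^sup>+x. of_bool (P x) * f x \<partial>count_space A) = (\<integral>\<^sup>+x. f x \<partial>count_space {x\<in>A. P x})"
proof -
  have "(\<integral>\<^sup>+x. f x \<partial>count_space {x\<in>A. P x}) = (\<integral>\<^sup>+x. f x * indicator {x\<in>A. P x} x \<partial>count_space UNIV)"
    by (rule nn_integral_count_space_indicator) simp
  also have "\<dots> = (\<integral>\<^sup>+x. of_bool (P x) * f x * indicator A x \<partial>count_space UNIV)"
    by (intro nn_integral_cong) (auto split: split_indicator)
  also have "\<dots> = (\<integral>\<^sup>+x. of_bool (P x) * f x \<partial>count_space A)"
    by (rule nn_integral_count_space_indicator[symmetric]) simp
  finally show ?thesis ..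
qed

lemma nn_subset_mono:
  fixes f :: "'a \<Rightarrow> ennreal"
  assumes "A \<subseteq> B"
  shows "(\<integral>\<^sup>+x. f x \<partial>count_space A) \<le> (\<integral>\<^sup>+x. f x \<partial>count_space B)"
proof -
  have *: "(\<integral>\<^sup>+x. f x \<partial>count_space X) = (\<integral>\<^sup>+x. f x * indicator X x \<partial>count_space UNIV)" for X
    by (rule nn_integral_count_space_indicator) simp
  show ?thesis
    unfolding * using assms by (intro nn_integral_mono) (auto split: split_indicator)
qed

lemma bij_remove_point: "bij_betw (\<lambda>C. insert x C) {C\<in>ksets k. x \<notin> C} {B\<in>ksets (Suc k). x \<in> B}"
  by (rule bij_betwI[where g = "\<lambda>B. B - {x}"]) (auto simp: ksets_def)

text \<open>Double counting of the pairs of a \<open>(k+1)\<close>-set and a marked point of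
  it.\<close>

lemma esym_Suc:
  fixes v :: "int ^ 'd::finite \<Rightarrow> ennreal"
  shows "of_nat (Suc k) * esym v (Suc k)
      = (\<integral>\<^sup>+x. \<integral>\<^sup>+C. of_bool (x \<notin> C) * (v x * prod v C) \<partial>count_space (ksets k) \<partial>count_space UNIV)"
proof -
  have "of_nat (Suc k) * esym v (Suc k) = (\<integral>\<^sup>+B. of_nat (Suc k) * prod v B \<partial>count_space (ksets (Suc k)))"
    unfolding esym_def by (rule nn_integral_cmult[symmetric]) simp
  also have "\<dots> = (\<integral>\<^sup>+B. \<integral>\<^sup>+x. of_bool (x \<in> B) * prod v B \<partial>count_space UNIV \<partial>count_space (ksets (Suc k)))"
  proof (rule nn_integral_cong)
    fix B :: "(int ^ 'd) set" assume "B \<in> space (count_space (ksets (Suc k)))"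
    then have B: "finite B" "card B = Suc k" by (auto simp: ksets_def)
    have "of_nat (Suc k) * prod v B = (\<Sum>x\<in>B. prod v B)" using B by simp
    also have "\<dots> = (\<integral>\<^sup>+x. of_bool (x \<in> B) * prod v B \<partial>count_space UNIV)"
      by (rule nn_sum_finite) (use B in auto)
    finally show "of_nat (Suc k) * prod v B = (\<integral>\<^sup>+x. of_bool (x \<in> B) * prod v B \<partial>count_space UNIV)" .
  qed
  also have "\<dots> = (\<integral>\<^sup>+x. \<integral>\<^sup>+B. of_bool (x \<in> B) * prod v B \<partial>count_space (ksets (Suc k)) \<partial>count_space UNIV)"
    by (rule nn_swap[symmetric])
  also have "\<dots> = (\<integral>\<^sup>+x. \<integral>\<^sup>+C. of_bool (x \<notin> C) * (v x * prod v C) \<partial>count_space (ksets k) \<partial>count_space UNIV)"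
  proof (rule nn_integral_cong)
    fix x :: "int ^ 'd"
    have "(\<integral>\<^sup>+B. prod v B \<partial>count_space {B\<in>ksets (Suc k). x \<in> B})
        = (\<integral>\<^sup>+C. prod v (insert x C) \<partial>count_space {C\<in>ksets k. x \<notin> C})"
      by (rule nn_integral_bij_count_space[OF bij_remove_point, symmetric])
    also have "\<dots> = (\<integral>\<^sup>+C. v x * prod v C \<partial>count_space {C\<in>ksets k. x \<notin> C})"
      by (intro nn_integral_cong) (auto simp: ksets_def)
    finally show "(\<integral>\<^sup>+B. of_bool (x \<in> B) * prod v B \<partial>count_space (ksets (Suc k)))
        = (\<integral>\<^sup>+C. of_bool (x \<notin> C) * (v x * prod v C) \<partial>count_space (ksets k))"
      unfolding nn_restrict .
  qed
  finally show ?thesis .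
qed

lemma sum_times_esym:
  fixes v :: "int ^ 'd::finite \<Rightarrow> ennreal"
  shows "(\<integral>\<^sup>+x. v x \<partial>count_space UNIV) * esym v k
     = (\<integral>\<^sup>+x. \<integral>\<^sup>+C. v x * prod v C \<partial>count_space (ksets k) \<partial>count_space UNIV)"
  by (simp add: esym_def nn_integral_cmult nn_integral_multc)

lemma esym_Suc_le:
  fixes v :: "int ^ 'd::finite \<Rightarrow> ennreal"
  shows "of_nat (Suc k) * esym v (Suc k) \<le> (\<integral>\<^sup>+x. v x \<partial>count_space UNIV) * esym v k"
  unfolding esym_Suc sum_times_esym by (intro nn_integral_mono) auto

text \<open>The terms with \<open>x \<in> C\<close>, which \<open>esym_Suc\<close> leaves out, are
  \<open>k\<close> in number for each \<open>C\<close> and carry a factor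
  \<open>v x \<le> \<delta>\<close>. When the largest weight tends to 0, both inequalities merge
  into the recursion satisfied by \<open>m ^ k / fact k\<close>.\<close>

lemma esym_Suc_ge:
  fixes v :: "int ^ 'd::finite \<Rightarrow> ennreal"
  assumes "\<And>x. v x \<le> \<delta>"
  shows "(\<integral>\<^sup>+x. v x \<partial>count_space UNIV) * esym v k \<le> of_nat (Suc k) * esym v (Suc k) + of_nat k * \<delta> * esym v k"
proof -
  have "(\<integral>\<^sup>+x. v x \<partial>count_space UNIV) * esym v k
     = (\<integral>\<^sup>+x. \<integral>\<^sup>+C. of_bool (x \<notin> C) * (v x * prod v C) + of_bool (x \<in> C) * (v x * prod v C) \<partial>count_space (ksets k) \<partial>count_space UNIV)"
    unfolding sum_times_esym by (intro nn_integral_cong) auto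
  also have "\<dots> = of_nat (Suc k) * esym v (Suc k)
     + (\<integral>\<^sup>+x. \<integral>\<^sup>+C. of_bool (x \<in> C) * (v x * prod v C) \<partial>count_space (ksets k) \<partial>count_space UNIV)"
    unfolding esym_Suc by (simp add: nn_integral_add)
  also have "(\<integral>\<^sup>+x. \<integral>\<^sup>+C. of_bool (x \<in> C) * (v x * prod v C) \<partial>count_space (ksets k) \<partial>count_space UNIV)
     = (\<integral>\<^sup>+C. \<integral>\<^sup>+x. of_bool (x \<in> C) * (v x * prod v C) \<partial>count_space UNIV \<partial>count_space (ksets k))"
    by (rule nn_swap)
  also have "\<dots> \<le> (\<integral>\<^sup>+C. of_nat k * \<delta> * prod v C \<partial>count_space (ksets k))"
  proof (rule nn_integral_mono)
    fix C :: "(int ^ 'd) set" assume "C \<in> space (count_space (ksets k))"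
    then have C: "finite C" "card C = k" by (auto simp: ksets_def)
    have "(\<integral>\<^sup>+x. of_bool (x \<in> C) * (v x * prod v C) \<partial>count_space UNIV) = (\<Sum>x\<in>C. v x * prod v C)"
      by (rule nn_sum_finite[symmetric]) (use C in auto)
    also have "\<dots> \<le> (\<Sum>x\<in>C. \<delta> * prod v C)"
      using assms by (intro sum_mono mult_right_mono) auto
    finally show "(\<integral>\<^sup>+x. of_bool (x \<in> C) * (v x * prod v C) \<partial>count_space UNIV) \<le> of_nat k * \<delta> * prod v C"
      using C by (simp add: mult.assoc)
  qed
  also have "\<dots> = of_nat k * \<delta> * esym v k" by (simp add: esym_def nn_integral_cmult)
  finally show ?thesis by (simp add: add_left_mono)
qed

lemma ksets_0 [simp]: "ksets 0 = {{}}"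
  by (auto simp: ksets_def)

lemma esym_0 [simp]: "esym v 0 = 1"
  by (simp add: esym_def nn_integral_count_space_finite)

lemma fact_esym_le:
  fixes v :: "int ^ 'd::finite \<Rightarrow> ennreal"
  shows "fact k * esym v k \<le> (\<integral>\<^sup>+x. v x \<partial>count_space UNIV) ^ k"
proof (induction k)
  case (Suc k)
  have "fact (Suc k) * esym v (Suc k) = fact k * (of_nat (Suc k) * esym v (Suc k))"
    by (simp add: mult_ac)
  also have "\<dots> \<le> fact k * ((\<integral>\<^sup>+x. v x \<partial>count_space UNIV) * esym v k)"
    by (intro mult_left_mono esym_Suc_le) auto
  also have "\<dots> = (\<integral>\<^sup>+x. v x \<partial>count_space UNIV) * (fact k * esym v k)" by (simp add: mult_ac)
  also have "\<dots> \<le> (\<integral>\<^sup>+x. v x \<partial>count_space UNIV) * (\<integral>\<^sup>+x. v x \<partial>count_space UNIV) ^ k"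
    by (intro mult_left_mono Suc) auto
  finally show ?case by simp
qed simp

lemma esym_le_power:
  fixes v :: "int ^ 'd::finite \<Rightarrow> ennreal"
  shows "esym v k \<le> (\<integral>\<^sup>+x. v x \<partial>count_space UNIV) ^ k"
proof -
  have "1 * esym v k \<le> fact k * esym v k"
    by (intro mult_right_mono) (metis fact_ge_1 of_nat_1 of_nat_fact of_nat_mono, simp)
  then show ?thesis using fact_esym_le[of k v] by simp
qed

lemma edges_neq: "p \<in> edges \<Longrightarrow> fst p \<noteq> snd p"
  by (auto simp: edges_def)

text \<open>For a fixed edge, deleting its endpoints maps the \<open>k\<close>-sets that contain
  both injectively into the \<open>(k-2)\<close>-sets. For \<open>k < 2\<close> no set contains two
  adjacent points and the left side is 0, so the truncated subtraction does no harm.\<close>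

lemma pair_sum_le:
  fixes v :: "int ^ 'd::finite \<Rightarrow> ennreal"
  shows "(\<integral>\<^sup>+B. (\<Sum>x\<in>B. \<Sum>y\<in>neighbours x \<inter> B. a x y * prod v (B - {x, y})) \<partial>count_space (ksets k))
     \<le> (\<integral>\<^sup>+p. a (fst p) (snd p) \<partial>count_space edges) * esym v (k - 2)"
proof -
  have "(\<integral>\<^sup>+B. (\<Sum>x\<in>B. \<Sum>y\<in>neighbours x \<inter> B. a x y * prod v (B - {x, y})) \<partial>count_space (ksets k))
     = (\<integral>\<^sup>+B. \<integral>\<^sup>+p. of_bool (fst p \<in> B \<and> snd p \<in> B) * (a (fst p) (snd p) * prod v (B - {fst p, snd p})) \<partial>count_space edges \<partial>count_space (ksets k))"
  proof (rule nn_integral_cong)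
    fix B :: "(int ^ 'd) set" assume "B \<in> space (count_space (ksets k))"
    then have B: "finite B" by (auto simp: ksets_def)
    have "(\<Sum>x\<in>B. \<Sum>y\<in>neighbours x \<inter> B. a x y * prod v (B - {x, y}))
       = (\<Sum>p\<in>(SIGMA x:B. neighbours x \<inter> B). a (fst p) (snd p) * prod v (B - {fst p, snd p}))"
      using B by (simp add: sum.Sigma case_prod_beta)
    also have "\<dots> = (\<integral>\<^sup>+p. of_bool (p \<in> (SIGMA x:B. neighbours x \<inter> B)) * (a (fst p) (snd p) * prod v (B - {fst p, snd p})) \<partial>count_space edges)"
      by (rule nn_sum_finite) (use B in \<open>auto simp: edges_def\<close>)
    also have "\<dots> = (\<integral>\<^sup>+p. of_bool (fst p \<in> B
        \<and> snd p \<in> B) * (a (fst p) (snd p) * prod v (B - {fst p, snd p})) \<partial>count_space edges)"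
      by (intro nn_integral_cong) (auto simp: edges_def)
    finally show "(\<Sum>x\<in>B. \<Sum>y\<in>neighbours x \<inter> B. a x y * prod v (B - {x, y}))
      = (\<integral>\<^sup>+p. of_bool (fst p \<in> B \<and> snd p \<in> B) * (a (fst p) (snd p) * prod v (B - {fst p, snd p})) \<partial>count_space edges)" .
  qed
  also have "\<dots> = (\<integral>\<^sup>+p. \<integral>\<^sup>+B. of_bool (fst p \<in> B
      \<and> snd p \<in> B) * (a (fst p) (snd p) * prod v (B - {fst p, snd p})) \<partial>count_space (ksets k) \<partial>count_space edges)"
    by (rule nn_swap[symmetric])
  also have "\<dots> \<le> (\<integral>\<^sup>+p. a (fst p) (snd p) * esym v (k - 2) \<partial>count_space edges)"
  proof (rule nn_integral_mono)
    fix p :: "(int ^ 'd) \<times> (int ^ 'd)" assume "p \<in> space (count_space edges)"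
    then have ne: "fst p \<noteq> snd p" by (simp add: edges_neq)
    let ?X = "{B \<in> ksets k. fst p \<in> B \<and> snd p \<in> B}"
    have inj: "inj_on (\<lambda>B. B - {fst p, snd p}) ?X"
      by (auto simp: inj_on_def)
    have img: "(\<lambda>B. B - {fst p, snd p}) ` ?X \<subseteq> ksets (k - 2)"
    proof (rule image_subsetI)
      fix B assume "B \<in> ?X"
      then show "B - {fst p, snd p} \<in> ksets (k - 2)"
        using ne card_Diff_subset[of "{fst p, snd p}" B] by (simp add: ksets_def)
    qed
    have "(\<integral>\<^sup>+B. of_bool (fst p \<in> B \<and> snd p \<in> B) * (a (fst p) (snd p) * prod v (B - {fst p, snd p})) \<partial>count_space (ksets k))
      = a (fst p) (snd p) * (\<integral>\<^sup>+B. prod v (B - {fst p, snd p}) \<partial>count_space ?X)"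
      unfolding nn_restrict by (simp add: nn_integral_cmult)
    also have "(\<integral>\<^sup>+B. prod v (B - {fst p, snd p}) \<partial>count_space ?X)
       = (\<integral>\<^sup>+C. prod v C \<partial>count_space ((\<lambda>B. B - {fst p, snd p}) ` ?X))"
      by (rule nn_integral_bij_count_space) (use inj in \<open>simp add: bij_betw_def\<close>)
    also have "\<dots> \<le> esym v (k - 2)"
      unfolding esym_def by (rule nn_subset_mono[OF img])
    finally show "(\<integral>\<^sup>+B. of_bool (fst p \<in> B
        \<and> snd p \<in> B) * (a (fst p) (snd p) * prod v (B - {fst p, snd p})) \<partial>count_space (ksets k))
       \<le> a (fst p) (snd p) * esym v (k - 2)" by (simp add: mult_left_mono)
  qed
  also have "\<dots> = (\<integral>\<^sup>+p. a (fst p) (snd p) \<partial>count_space edges) * esym v (k - 2)"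
    by (rule nn_integral_multc) simp
  finally show ?thesis .
qed

section \<open>Comparison of the exclusion moments with symmetric functions\<close>

lemma nn_ksets_1:
  fixes h :: "'a set \<Rightarrow> ennreal"
  shows "(\<integral>\<^sup>+B. h B \<partial>count_space (ksets 1)) = (\<integral>\<^sup>+x. h {x} \<partial>count_space UNIV)"
  by (rule nn_integral_bij_count_space[symmetric])
     (auto simp: bij_betw_def ksets_def card_1_singleton_iff)

lemma heat_shift:
  assumes "heat q" "0 \<le> s"
  shows "heat (\<lambda>r. q (s + r))"
  unfolding heat_def
proof (intro allI impI conjI)
  fix r x assume r: "(0::real) \<le> r"
  show "0 \<le> q (s + r) x" "q (s + r) x \<le> 1" using assms r by (auto simp: heat_def)
  have "((\<lambda>s. q s x) has_real_derivative (\<Sum>y\<in>neighbours x. q (s + r) y) / (2 * real CARD('a)) - q (s + r) x) (at (s + r) within (+) s ` {0..})"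
  proof (rule has_field_derivative_subset)
    show "((\<lambda>s. q s x) has_real_derivative (\<Sum>y\<in>neighbours x. q (s + r) y) / (2 * real CARD('a)) - q (s + r) x) (at (s + r) within {0..})"
      using assms r unfolding heat_def by (meson add_nonneg_nonneg)
    show "(+) s ` {0..} \<subseteq> {0..}" using assms(2) by auto
  qed
  moreover have "((+) s has_real_derivative 1) (at r within {0..})"
    by (auto intro!: derivative_eq_intros)
  ultimately have "((\<lambda>s. q s x) \<circ> (+) s has_real_derivative ((\<Sum>y\<in>neighbours x. q (s + r) y) / (2 * real CARD('a)) - q (s + r) x) * 1) (at r within {0..})"
    by (rule DERIV_image_chain)
  then show "((\<lambda>r. q (s + r) x) has_real_derivative (\<Sum>y\<in>neighbours x. q (s + r) y) / (2 * real CARD('a)) - q (s + r) x) (at r within {0..})"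
    by (simp add: o_def)
qed

text \<open>The symmetry of the one-particle semigroup moves the time \<open>r\<close> from
  \<open>u\<close> to \<open>q\<close>, so the sum depends on \<open>s + r\<close> only. With
  \<open>s + r = t\<close> it is the expected count at time \<open>t\<close>, whatever
  \<open>s\<close>.\<close>

lemma sum_heat_product:
  fixes q u :: "real \<Rightarrow> int ^ 'd::finite \<Rightarrow> real"
  assumes "heat q" "heat u" and u0: "\<And>x. u 0 x = of_bool (x \<in> R)" and s: "0 \<le> s" "0 \<le> r"
  shows "(\<integral>\<^sup>+x. ennreal (q s x * u r x) \<partial>count_space UNIV)
      = (\<integral>\<^sup>+x. of_bool (x \<in> R) * ennreal (q (s + r) x) \<partial>count_space UNIV)"
proof -
  have q0: "0 \<le> q s x" for x using assms by (simp add: heat_def)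
  have ur: "ennreal (u r x) = sg 1 r (occ R) {x}" for x
    unfolding heat_eq_sg[OF assms(2) s(2)] using u0
    by (intro sg_cong) (auto simp: ksets_def prod_of_bool_occ)
  have "(\<integral>\<^sup>+x. ennreal (q s x * u r x) \<partial>count_space UNIV)
      = (\<integral>\<^sup>+x. ennreal (prod (q s) {x}) * sg 1 r (occ R) {x} \<partial>count_space UNIV)"
    using q0 by (intro nn_integral_cong) (simp add: ennreal_mult' ur)
  also have "\<dots> = (\<integral>\<^sup>+B. ennreal (prod (q s) B) * sg 1 r (occ R) B \<partial>count_space (ksets 1))"
    by (rule nn_ksets_1[symmetric])
  also have "\<dots> = (\<integral>\<^sup>+B. occ R B * sg 1 r (\<lambda>B. ennreal (prod (q s) B)) B \<partial>count_space (ksets 1))"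
    by (rule sg_sym)
  also have "\<dots> = (\<integral>\<^sup>+x. occ R {x} * sg 1 r (\<lambda>B. ennreal (prod (q s) B)) {x} \<partial>count_space UNIV)"
    by (rule nn_ksets_1)
  also have "\<dots> = (\<integral>\<^sup>+x. of_bool (x \<in> R) * ennreal (q (s + r) x) \<partial>count_space UNIV)"
    unfolding heat_eq_sg[OF heat_shift[OF assms(1) s(1)] s(2)] by (simp add: occ_def)
  finally show ?thesis .
qed

definition bond_energy :: "(int ^ 'd::finite \<Rightarrow> real) \<Rightarrow> (int ^ 'd \<Rightarrow> real) \<Rightarrow> ennreal" where
  "bond_energy q u = (\<integral>\<^sup>+p. ennreal ((q (fst p) - q (snd p))\<^sup>2 * (u (fst p) * u (snd p))) \<partial>count_space edges)"

text \<open>\<open>sep_moment k t R A\<close> is the \<open>k\<close>-th binomial moment of the number of particles in \<open>A\<close> at time \<open>t\<close>, from \<open>R\<close>.\<close>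

definition sep_moment :: "nat \<Rightarrow> real \<Rightarrow> (int ^ 'd::finite) set \<Rightarrow> (int ^ 'd) set \<Rightarrow> ennreal" where
  "sep_moment k t R A = (\<integral>\<^sup>+B. occ A B * sg k t (occ R) B \<partial>count_space (ksets k))"

text \<open>Duhamel's formula is summed over the \<open>k\<close>-subsets of \<open>R\<close>; the
  sign of the source gives the upper bound. In the error, \<open>sg_sym\<close> lets the semigroup
  over the time \<open>t - s\<close> act on \<open>occ R\<close> instead of on the source, and
  \<open>sg_occ_le\<close> replaces the result by the product of \<open>u\<close>. Each term is then
  an adjacent pair times a product of weights \<open>q * u\<close> over the other points, so
  \<open>pair_sum_le\<close> separates the two, and \<open>sum_heat_product\<close> gives the total
  weight.\<close>

lemma
  fixes q u :: "real \<Rightarrow> int ^ 'd::finite \<Rightarrow> real"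
  assumes q: "heat q" and u: "heat u"
    and q0: "\<And>x. q 0 x = of_bool (x \<in> A)" and u0: "\<And>x. u 0 x = of_bool (x \<in> R)"
    and t: "0 \<le> t"
  defines "v \<equiv> \<lambda>x. of_bool (x \<in> R) * ennreal (q t x)"
  shows binomial_moment_le: "sep_moment k t R A \<le> esym v k" (is "?EC \<le> _")
    and binomial_moment_ge: "esym v k \<le> sep_moment k t R A +
      (\<integral>\<^sup>+s. bond_energy (q s) (u (t - s))
         * indicator {0..t} s * (\<integral>\<^sup>+x. v x \<partial>count_space UNIV) ^ (k - 2) \<partial>lborel)" (is "_ \<le> _ + ?J")
proof -
  let ?m = "\<integral>\<^sup>+x. v x \<partial>count_space UNIV"
  let ?pe = "\<lambda>s B. ennreal (pair_energy (q s) B)"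
  have vB: "prod v B = occ R B * ennreal (prod (q t) B)" if "B \<in> ksets k" for B
  proof -
    have "finite B" using that by (simp add: ksets_def)
    then have "(\<Prod>x\<in>B. of_bool (x \<in> R)) = occ R B"
      by (induction rule: finite_induct) (auto simp: occ_def)
    then show ?thesis
      using q t by (simp add: v_def prod.distrib heat_def prod_ennreal)
  qed
  have q_nn: "0 \<le> q s x" if "0 \<le> s" for s x using q that by (simp add: heat_def)
  have u_nn: "0 \<le> u s x" if "0 \<le> s" for s x using u that by (simp add: heat_def)
  have occA: "sg k t (\<lambda>B. ennreal (prod (q 0) B)) B = sg k t (occ A) B" if "B \<in> ksets k" for B
    using q0 by (intro sg_cong[OF that]) (simp add: prod_of_bool_occ ksets_def)
  have "esym v k = (\<integral>\<^sup>+B. occ R B * sg k t (occ A) B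
      + (\<integral>\<^sup>+s. occ R B * (sg k (t - s) (?pe s) B * indicator {0..t} s) \<partial>lborel) \<partial>count_space (ksets k))"
    unfolding esym_def
  proof (rule nn_integral_cong)
    fix B assume "B \<in> space (count_space (ksets k :: (int ^ 'd) set set))"
    then have B: "B \<in> ksets k" by simp
    show "prod v B = occ R B * sg k t (occ A) B
      + (\<integral>\<^sup>+s. occ R B * (sg k (t - s) (?pe s) B * indicator {0..t} s) \<partial>lborel)"
      unfolding vB[OF B] heat_prod_duhamel[OF q t B] occA[OF B] distrib_left
        nn_integral_cmult[OF heat_prod_measurable[OF q t B]] ..
  qed
  also have "\<dots> = (\<integral>\<^sup>+B. occ R B * sg k t (occ A) B \<partial>count_space (ksets k))
      + (\<integral>\<^sup>+B. \<integral>\<^sup>+s. occ R B * (sg k (t - s) (?pe s) B * indicator {0..t} s) \<partial>lborel \<partial>count_space (ksets k))"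
    by (rule nn_integral_add) auto
  also have "(\<integral>\<^sup>+B. occ R B * sg k t (occ A) B \<partial>count_space (ksets k)) = ?EC"
    unfolding sep_moment_def by (rule sg_sym)
  finally have eq: "esym v k = ?EC + (\<integral>\<^sup>+B. \<integral>\<^sup>+s. occ R B * (sg k (t - s) (?pe s) B * indicator {0..t} s) \<partial>lborel \<partial>count_space (ksets k))" .
  then show "?EC \<le> esym v k" by simp
  have "(\<integral>\<^sup>+B. \<integral>\<^sup>+s. occ R B * (sg k (t - s) (?pe s) B * indicator {0..t} s) \<partial>lborel \<partial>count_space (ksets k))
     = (\<integral>\<^sup>+s. \<integral>\<^sup>+B. occ R B * (sg k (t - s) (?pe s) B * indicator {0..t} s) \<partial>count_space (ksets k) \<partial>lborel)"
    by (rule nn_integral_count_space_nn_integral[symmetric])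
       (use heat_prod_measurable[OF q t] in \<open>auto intro!: borel_measurable_times\<close>)
  also have "\<dots> \<le> (\<integral>\<^sup>+s. bond_energy (q s) (u (t - s)) * indicator {0..t} s * ?m ^ (k - 2) \<partial>lborel)"
  proof (rule nn_integral_mono)
    fix s :: real
    show "(\<integral>\<^sup>+B. occ R B * (sg k (t - s) (?pe s) B * indicator {0..t} s) \<partial>count_space (ksets k))
      \<le> bond_energy (q s) (u (t - s)) * indicator {0..t} s * ?m ^ (k - 2)"
    proof (cases "s \<in> {0..t}")
      case True
      let ?w = "\<lambda>x. ennreal (q s x * u (t - s) x)"
      let ?a = "\<lambda>x y. ennreal ((q s x - q s y)\<^sup>2 * (u (t - s) x * u (t - s) y))"
      have nn: "0 \<le> q s x" "0 \<le> u (t - s) x" for x using True q_nn u_nn by auto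
      have "(\<integral>\<^sup>+B. occ R B * (sg k (t - s) (?pe s) B * indicator {0..t} s) \<partial>count_space (ksets k))
         = (\<integral>\<^sup>+B. occ R B * sg k (t - s) (?pe s) B \<partial>count_space (ksets k))"
        using True by simp
      also have "\<dots> = (\<integral>\<^sup>+B. ?pe s B * sg k (t - s) (occ R) B \<partial>count_space (ksets k))"
        by (rule sg_sym)
      also have "\<dots> \<le> (\<integral>\<^sup>+B. (\<Sum>x\<in>B. \<Sum>y\<in>neighbours x \<inter> B. ?a x y * prod ?w (B - {x, y})) \<partial>count_space (ksets k))"
      proof (rule nn_integral_mono)
        fix B assume "B \<in> space (count_space (ksets k :: (int ^ 'd) set set))"
        then have B: "B \<in> ksets k" and fin: "finite B" by (auto simp: ksets_def)
        have "?pe s B * sg k (t - s) (occ R) B \<le> ?pe s B * ennreal (prod (u (t - s)) B)"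
          using True by (intro mult_left_mono sg_occ_le[OF u u0 _ B]) auto
        also have "\<dots> = ennreal (pair_energy (q s) B * prod (u (t - s)) B)"
          using nn by (intro ennreal_mult[symmetric] pair_energy_nonneg prod_nonneg) auto
        also have "\<dots> \<le> ennreal (\<Sum>x\<in>B. \<Sum>y\<in>neighbours x \<inter> B. (q s x - q s y)\<^sup>2 * (u (t - s) x * u (t - s) y) * (\<Prod>z\<in>B - {x, y}. q s z * u (t - s) z))"
        proof (rule ennreal_leI)
          have "(\<Sum>x\<in>B. \<Sum>y\<in>neighbours x \<inter> B. (q s x - q s y)\<^sup>2 * (u (t - s) x * u (t - s) y) * (\<Prod>z\<in>B - {x, y}. q s z * u (t - s) z))
            = (\<Sum>x\<in>B. \<Sum>y\<in>neighbours x \<inter> B. (q s x - q s y)\<^sup>2 * (\<Prod>z\<in>B - {x, y}. q s z)) * prod (u (t - s)) B"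
            unfolding sum_distrib_right
          proof (intro sum.cong refl)
            fix x y assume xy: "x \<in> B" "y \<in> neighbours x \<inter> B"
            then have "x \<noteq> y" by auto
            then have "prod (u (t - s)) B = u (t - s) x * (u (t - s) y * prod (u (t - s)) (B - {x, y}))"
              using fin xy prod.remove[of B x "u (t - s)"] prod.remove[of "B - {x}" y "u (t - s)"]
              by (simp add: Diff_insert2[symmetric] insert_commute)
            then show "(q s x - q s y)\<^sup>2 * (u (t - s) x * u (t - s) y) * (\<Prod>z\<in>B - {x, y}. q s z * u (t - s) z)
              = (q s x - q s y)\<^sup>2 * (\<Prod>z\<in>B - {x, y}. q s z) * prod (u (t - s)) B"
              by (simp add: prod.distrib)
          qed
          \<comment> \<open>The normalisation of \<open>pair_energy\<close> is dropped here: the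
            error needs the right order only.\<close>
          moreover have d1: "1 \<le> 4 * real CARD('d)"
            using zero_less_card_finite[where 'a = 'd] by linarith
          moreover have "0 \<le> (\<Sum>x\<in>B. \<Sum>y\<in>neighbours x \<inter> B. (q s x - q s y)\<^sup>2 * (\<Prod>z\<in>B - {x, y}. q s z))"
            using nn by (intro sum_nonneg mult_nonneg_nonneg prod_nonneg) auto
          then have "pair_energy (q s) B
              \<le> (\<Sum>x\<in>B. \<Sum>y\<in>neighbours x \<inter> B. (q s x - q s y)\<^sup>2 * (\<Prod>z\<in>B - {x, y}. q s z))"
            unfolding pair_energy_def using d1
                by (subst pos_divide_le_eq) (auto intro!: mult_left_le_one_le[THEN order_trans] simp: mult_le_cancel_left1)
          then have "pair_energy (q s) B * prod (u (t - s)) B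
              \<le> (\<Sum>x\<in>B. \<Sum>y\<in>neighbours x \<inter> B. (q s x - q s y)\<^sup>2 * (\<Prod>z\<in>B - {x, y}. q s z)) * prod (u (t - s)) B"
            using nn by (intro mult_right_mono prod_nonneg) auto
          ultimately show "pair_energy (q s) B * prod (u (t - s)) B
            \<le> (\<Sum>x\<in>B. \<Sum>y\<in>neighbours x \<inter> B. (q s x - q s y)\<^sup>2 * (u (t - s) x * u (t - s) y) * (\<Prod>z\<in>B - {x, y}. q s z * u (t - s) z))"
            by simp
        qed
        also have "\<dots> = (\<Sum>x\<in>B. \<Sum>y\<in>neighbours x \<inter> B. ?a x y * prod ?w (B - {x, y}))"
        proof -
          have T: "ennreal ((q s x - q s y)\<^sup>2 * (u (t - s) x * u (t - s) y) * (\<Prod>z\<in>B - {x, y}. q s z * u (t - s) z))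
            = ?a x y * prod ?w (B - {x, y})" for x y
            using nn by (subst prod_ennreal) (auto intro!: ennreal_mult prod_nonneg)
          have N: "0 \<le> (q s x - q s y)\<^sup>2 * (u (t - s) x * u (t - s) y) * (\<Prod>z\<in>B - {x, y}. q s z * u (t - s) z)" for x y
            using nn by (intro mult_nonneg_nonneg prod_nonneg) auto
          show ?thesis
            unfolding T[symmetric] using N by (simp only: sum_ennreal sum_nonneg)
        qed
        finally show "?pe s B * sg k (t - s) (occ R) B
            \<le> (\<Sum>x\<in>B. \<Sum>y\<in>neighbours x \<inter> B. ?a x y * prod ?w (B - {x, y}))" .
      qed
      also have "\<dots> \<le> bond_energy (q s) (u (t - s)) * esym ?w (k - 2)"
        unfolding bond_energy_def by (rule pair_sum_le)
      also have "\<dots> \<le> bond_energy (q s) (u (t - s)) * (\<integral>\<^sup>+x. ?w x \<partial>count_space UNIV) ^ (k - 2)"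
        by (intro mult_left_mono esym_le_power) auto
      also have "(\<integral>\<^sup>+x. ?w x \<partial>count_space UNIV) = ?m"
        using True sum_heat_product[OF q u u0, of s "t - s"] by (simp add: v_def)
      finally show ?thesis using True by simp
    qed simp
  qed
  finally show "esym v k \<le> ?EC + ?J"
    unfolding eq by (intro add_left_mono)
qed

section \<open>Finite-dimensional marginals of the exclusion process\<close>

text \<open>The duality function. It is local and continuous for finite \<open>B\<close>, so it may
  enter both the generator and the conditional expectations of the process.\<close>

definition occf :: "(int ^ 'd::finite) set \<Rightarrow> 'd config \<Rightarrow> real" where
  "occf B \<eta> = of_bool (\<forall>x\<in>B. \<eta> x)"

lemma occf_bounds [simp]: "0 \<le> occf B \<eta>" "occf B \<eta> \<le> 1" "\<bar>occf B \<eta>\<bar> \<le> 1"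
  by (auto simp: occf_def)

lemma occf_local: "finite B \<Longrightarrow> local_fun (occf B)"
  unfolding local_fun_def occf_def by (intro exI[of _ B]) auto

lemma occf_prod: "finite B \<Longrightarrow> occf B \<eta> = (\<Prod>x\<in>B. of_bool (\<eta> x))"
  unfolding occf_def by (induction rule: finite_induct) auto

lemma occf_continuous: "finite B \<Longrightarrow> continuous_on UNIV (occf B)"
proof -
  assume B: "finite B"
  have "continuous_on UNIV (\<lambda>\<eta> :: 'a config. of_bool (\<eta> x) :: real)" for x
    using continuous_on_compose2[OF Topological_Spaces.continuous_on_discrete[of UNIV "of_bool :: bool \<Rightarrow> real"] continuous_on_product_coordinates[of x]] by simp
  then have "continuous_on UNIV (\<lambda>\<eta> :: 'a config. \<Prod>x\<in>B. of_bool (\<eta> x) :: real)"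
    by (intro continuous_on_prod)
  then show ?thesis using occf_prod[OF B] by (simp add: occf_prod[OF B, abs_def])
qed

lemma occf_measurable: "finite B \<Longrightarrow> occf B \<in> borel_measurable borel"
  by (intro borel_measurable_continuous_onI occf_continuous)

lemma exchange_eq: "exchange \<eta> x y = \<eta> \<circ> Transposition.transpose x y"
  by (auto simp: exchange_def fun_eq_iff Transposition.transpose_def)

lemma occf_exchange: "occf B (exchange \<eta> x y) = occf (Transposition.transpose x y ` B) \<eta>"
  by (auto simp: exchange_eq occf_def)

text \<open>Duality at the level of generators. The rates see only jumps from occupied to empty
  sites, but adding both orientations of a bond gives the full exchange difference
  \<open>D x y\<close>, since exchanging equal values changes nothing. Bonds with both or neither
  endpoint in \<open>B\<close> contribute 0; every other bond is counted once, from its endpoint in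
  \<open>B\<close>.\<close>

lemma generator_occf:
  fixes B :: "(int ^ 'd::finite) set"
  assumes B: "finite B"
  shows "sep_generator (occf B) \<eta> = hopsum (\<lambda>B. occf B \<eta>) B / (2 * real CARD('d)) - real (card B) * occf B \<eta>"
proof -
  define D where "D x y = occf B (exchange \<eta> x y) - occf B \<eta>" for x y
  define a where "a x y = of_bool (\<eta> x) * (1 - of_bool (\<eta> y)) * D x y" for x y
  \<comment> \<open>A site outside \<open>S\<close> has only bonds disjoint from \<open>B\<close>,
    so the infinite sum reduces to a finite one.\<close>
  define S where "S = B \<union> (\<Union>x\<in>B. neighbours x)"
  have finS: "finite S" using B by (simp add: S_def)
  have D_in: "D x y = 0" if "x \<in> B" "y \<in> B" for x y
    using that unfolding D_def occf_exchange by (subst transpose_image_eq) auto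
  have D_out: "D x y = 0" if "x \<notin> B" "y \<notin> B" for x y
    using that unfolding D_def occf_exchange by (subst transpose_image_eq) auto
  have D_eq: "D x y = 0" if "\<eta> x = \<eta> y" for x y
  proof -
    have "exchange \<eta> x y = \<eta>" using that by (auto simp: exchange_def fun_eq_iff)
    then show ?thesis by (simp add: D_def)
  qed
  have D_sym: "D x y = D y x" for x y
    by (simp add: D_def exchange_eq transpose_commute)
  have a_add: "a x y + a y x = D x y" for x y
    using D_eq[of x y] D_sym[of x y] by (cases "\<eta> x"; cases "\<eta> y") (auto simp: a_def)
  have a_in: "a x y = 0" if "x \<in> B" "y \<in> B" for x y
    using D_in[OF that] by (simp add: a_def)
  have a_out: "a x y = 0" if "x \<notin> B" "y \<notin> B" for x y
    using D_out[OF that] by (simp add: a_def)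
  have "(\<Sum>\<^sub>\<infinity>x. \<Sum>y\<in>neighbours x. a x y) = (\<Sum>\<^sub>\<infinity>x\<in>S. \<Sum>y\<in>neighbours x. a x y)"
  proof (rule infsum_cong_neutral)
    fix x assume x: "x \<in> UNIV - S"
    have "y \<notin> B" if "y \<in> neighbours x" for y
      using x that neighbours_sym[of x y] by (auto simp: S_def)
    then show "(\<Sum>y\<in>neighbours x. a x y) = 0"
      using x by (intro sum.neutral ballI a_out) (auto simp: S_def)
  qed auto
  also have "\<dots> = (\<Sum>x\<in>S. \<Sum>y\<in>neighbours x. a x y)"
    using finS by simp
  also have "\<dots> = (\<Sum>x\<in>B. \<Sum>y\<in>neighbours x. a x y) + (\<Sum>x\<in>S - B. \<Sum>y\<in>neighbours x. a x y)"
    using sum.subset_diff[of B S "\<lambda>x. \<Sum>y\<in>neighbours x. a x y"] finS by (simp add: S_def add.commute)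
  \<comment> \<open>Bonds that start outside \<open>B\<close> are reindexed by their endpoint in
    \<open>B\<close>, ready to be paired with the opposite orientation.\<close>
  also have "(\<Sum>x\<in>S - B. \<Sum>y\<in>neighbours x. a x y) = (\<Sum>x\<in>S - B. \<Sum>y\<in>{y\<in>B. y \<in> neighbours x}. a x y)"
    by (rule sum.cong[OF refl], rule sum.mono_neutral_right) (auto intro!: a_out)
  also have "\<dots> = (\<Sum>y\<in>B. \<Sum>x\<in>{x\<in>S - B. y \<in> neighbours x}. a x y)"
    by (rule sum.swap_restrict) (use B finS in auto)
  also have "\<dots> = (\<Sum>y\<in>B. \<Sum>x\<in>neighbours y. if x \<in> B then 0 else a x y)"
  proof (rule sum.cong[OF refl])
    fix y assume "y \<in> B"
    then have "{x\<in>S - B. y \<in> neighbours x} = {x\<in>neighbours y. x \<notin> B}"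
      using neighbours_sym by (auto simp: S_def)
    then show "(\<Sum>x\<in>{x\<in>S - B. y \<in> neighbours x}. a x y) = (\<Sum>x\<in>neighbours y. if x \<in> B then 0 else a x y)"
      by (simp only: sum.inter_filter[OF finite_neighbours]) (intro sum.cong refl, simp)
  qed
  also have "(\<Sum>x\<in>B. \<Sum>y\<in>neighbours x. a x y) + (\<Sum>y\<in>B. \<Sum>x\<in>neighbours y. if x \<in> B then 0 else a x y)
     = (\<Sum>x\<in>B. \<Sum>y\<in>neighbours x. D x y)"
    unfolding sum.distrib[symmetric] using a_in a_add D_in by (intro sum.cong refl) auto
  also have "\<dots> = hopsum (\<lambda>B. occf B \<eta>) B - 2 * real CARD('d) * (real (card B) * occf B \<eta>)"
    unfolding D_def occf_exchange by (simp add: sum_subtractf hopsum_def)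
  finally have *: "(\<Sum>\<^sub>\<infinity>x. \<Sum>y\<in>neighbours x. a x y)
      = hopsum (\<lambda>B. occf B \<eta>) B - 2 * real CARD('d) * (real (card B) * occf B \<eta>)" .
  show ?thesis
    unfolding sep_generator_def D_def[symmetric] a_def[symmetric] * by (simp add: diff_divide_distrib)
qed

section \<open>From the generator to a differential equation for the marginals\<close>

lemma uniform_right_deriv_continuous:
  fixes \<rho> g :: "real \<Rightarrow> real"
  assumes "\<And>e. 0 < e \<Longrightarrow> \<exists>d>0. \<forall>t\<ge>0. \<forall>h. 0 < h \<and> h < d \<longrightarrow> \<bar>\<rho> (t + h) - \<rho> t - h * g t\<bar> \<le> e * h"
    and C: "\<And>t. 0 \<le> t \<Longrightarrow> \<bar>g t\<bar> \<le> C"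
  shows "continuous_on {0..} \<rho>"
proof -
  obtain d where d: "d > 0" and D: "\<And>t h. 0 \<le> t \<Longrightarrow> 0 < h \<Longrightarrow> h < d \<Longrightarrow> \<bar>\<rho> (t + h) - \<rho> t - h * g t\<bar> \<le> 1 * h"
    using assms(1)[of 1] by auto
  have C0: "0 \<le> C" using C[of 0] by simp
  \<comment> \<open>Accuracy 1 in the hypothesis already gives a local Lipschitz bound: the
    increment is at most \<open>h + C * h\<close>.\<close>
  have L: "\<bar>\<rho> (t + h) - \<rho> t\<bar> \<le> (1 + C) * h" if "0 \<le> t" "0 < h" "h < d" for t h
  proof -
    have "\<bar>h * g t\<bar> \<le> h * C" using C[OF that(1)] that(2) by (simp add: abs_mult)
    then show ?thesis using D[OF that] by (simp add: algebra_simps)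
  qed
  have L': "\<bar>\<rho> s - \<rho> t\<bar> \<le> (1 + C) * \<bar>s - t\<bar>" if "0 \<le> t" "0 \<le> s" "\<bar>s - t\<bar> < d" for s t
    using L[of t "s - t"] L[of s "t - s"] that by (cases s t rule: linorder_cases) auto
  show ?thesis
    unfolding continuous_on_iff dist_real_def
  proof (intro ballI allI impI)
    fix t e :: real assume t: "t \<in> {0..}" and e: "0 < e"
    show "\<exists>d>0. \<forall>s\<in>{0..}. \<bar>s - t\<bar> < d \<longrightarrow> \<bar>\<rho> s - \<rho> t\<bar> < e"
    proof (intro exI[of _ "min d (e / (2 * (1 + C)))"] conjI ballI impI)
      show "0 < min d (e / (2 * (1 + C)))" using d e C0 by simp
      fix s :: real assume s: "s \<in> {0..}" "\<bar>s - t\<bar> < min d (e / (2 * (1 + C)))"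
      have "\<bar>\<rho> s - \<rho> t\<bar> \<le> (1 + C) * \<bar>s - t\<bar>" using s t by (intro L') auto
      also have "\<dots> \<le> (1 + C) * (e / (2 * (1 + C)))" using s C0 by (intro mult_left_mono) auto
      also have "\<dots> < e" using C0 e by (simp add: field_simps add_pos_nonneg)
      finally show "\<bar>\<rho> s - \<rho> t\<bar> < e" .
    qed
  qed
qed

text \<open>A left difference quotient at \<open>t\<close> is a right difference quotient at the
  earlier time \<open>s\<close>. Uniformity in the base point makes it close to \<open>g s\<close>,
  and continuity of \<open>g\<close> replaces \<open>g s\<close> by \<open>g t\<close>.\<close>

lemma uniform_right_deriv:
  fixes \<rho> g :: "real \<Rightarrow> real"
  assumes "\<And>e. 0 < e \<Longrightarrow> \<exists>d>0. \<forall>t\<ge>0. \<forall>h. 0 < h \<and> h < d \<longrightarrow> \<bar>\<rho> (t + h) - \<rho> t - h * g t\<bar> \<le> e * h"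
    and g: "continuous_on {0..} g" and t: "0 \<le> t"
  shows "(\<rho> has_real_derivative g t) (at t within {0..})"
  unfolding has_field_derivative_iff Lim_within dist_real_def
proof (intro allI impI)
  fix e :: real assume e: "0 < e"
  obtain d1 where d1: "d1 > 0" and D1: "\<And>t h. 0 \<le> t \<Longrightarrow> 0 < h \<Longrightarrow> h < d1 \<Longrightarrow> \<bar>\<rho> (t + h) - \<rho> t - h * g t\<bar>
      \<le> e / 3 * h"
    using assms(1)[of "e / 3"] e by auto
  obtain d2 where d2: "d2 > 0" and D2: "\<And>s. 0 \<le> s \<Longrightarrow> \<bar>s - t\<bar> < d2 \<Longrightarrow> \<bar>g s - g t\<bar> < e / 3"
    using g t e unfolding continuous_on_iff dist_real_def
        by (metis atLeast_iff divide_pos_pos zero_less_numeral)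
  show "\<exists>d>0. \<forall>s\<in>{0..}. 0 < \<bar>s - t\<bar> \<and> \<bar>s - t\<bar> < d \<longrightarrow> \<bar>(\<rho> s - \<rho> t) / (s - t) - g t\<bar> < e"
  proof (intro exI[of _ "min d1 d2"] conjI ballI impI)
    fix s :: real assume s: "s \<in> {0..}" "0 < \<bar>s - t\<bar> \<and> \<bar>s - t\<bar> < min d1 d2"
    have "\<bar>\<rho> s - \<rho> t - (s - t) * g t\<bar> \<le> 2 * e / 3 * \<bar>s - t\<bar>"
    proof (cases "s > t")
      case True
      then have "\<bar>\<rho> s - \<rho> t - (s - t) * g t\<bar> \<le> e / 3 * \<bar>s - t\<bar>"
        using D1[of t "s - t"] s t by simp
      also have "\<dots> \<le> 2 * e / 3 * \<bar>s - t\<bar>"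
        using e by (intro mult_right_mono) auto
      finally show ?thesis .
    next
      case False
      then have lt: "s < t" using s by auto
      have "\<bar>\<rho> t - \<rho> s - (t - s) * g s\<bar> \<le> e / 3 * (t - s)"
        using D1[of s "t - s"] s lt by simp
      moreover have "\<bar>(t - s) * (g s - g t)\<bar> \<le> (t - s) * (e / 3)"
        unfolding abs_mult using D2[of s] s lt by (intro mult_mono) auto
      moreover have "\<rho> s - \<rho> t - (s - t) * g t = - (\<rho> t - \<rho> s - (t - s) * g s) - (t - s) * (g s - g t)"
        by (simp add: algebra_simps)
      moreover have "\<bar>- a - b\<bar> \<le> \<bar>a\<bar> + \<bar>b\<bar>" for a b :: real by simp
      ultimately have "\<bar>\<rho> s - \<rho> t - (s - t) * g t\<bar> \<le> e / 3 * (t - s) + (t - s) * (e / 3)"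
        by (smt (verit))
      then show ?thesis using lt by (simp add: algebra_simps)
    qed
    also have "\<dots> < e * \<bar>s - t\<bar>" using e s by (intro mult_strict_right_mono) auto
    finally have "\<bar>\<rho> s - \<rho> t - (s - t) * g t\<bar> / \<bar>s - t\<bar> < e"
      using s by (simp add: pos_divide_less_eq)
    moreover have "(\<rho> s - \<rho> t - (s - t) * g t) / (s - t) = (\<rho> s - \<rho> t) / (s - t) - g t"
      using s by (simp add: diff_divide_distrib)
    ultimately show "\<bar>(\<rho> s - \<rho> t) / (s - t) - g t\<bar> < e"
      by (metis abs_divide)
  qed (use d1 d2 in auto)
qed

text \<open>The generator limit is uniform over configurations. Integrating it against
  \<open>P t \<eta>\<close> with the semigroup property gives a right derivative uniform in
  \<open>t\<close>. By \<open>generator_occf\<close> the resulting equations close on sets of a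
  fixed cardinality.\<close>

lemma sep_transition_deriv:
  fixes P :: "real \<Rightarrow> 'd::finite config \<Rightarrow> 'd config measure" and \<eta> :: "'d config"
  assumes P: "sep_transition P"
  defines "\<rho> \<equiv> \<lambda>t B. \<integral>\<xi>. occf B \<xi> \<partial>P t \<eta>"
  assumes t: "0 \<le> t" and B: "B \<in> ksets k"
  shows "((\<lambda>t. \<rho> t B) has_real_derivative hopsum (\<rho> t) B / (2 * real CARD('d)) - real k * \<rho> t B) (at t within {0..})"
    and "0 \<le> \<rho> t B" "\<rho> t B \<le> 1"
proof -
  have kernel: "P t \<in> borel \<rightarrow>\<^sub>M prob_algebra borel" if "0 \<le> t" for t
    using P that by (simp add: sep_transition_def)
  have prob: "prob_space (P t \<xi>)" and sets [measurable_cong, simp]: "sets (P t \<xi>) = sets borel" if "0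
      \<le> t" for t \<xi>
    using measurable_space[OF kernel[OF that], of \<xi>] by (auto simp: space_prob_algebra)
  have intg: "integrable (P t \<xi>) f" if "0 \<le> t" "f \<in> borel_measurable borel" "\<And>x. \<bar>f x\<bar>
      \<le> C" for t \<xi> f and C :: real
  proof -
    interpret prob_space "P t \<xi>" using prob that by simp
    show ?thesis
      by (rule integrable_const_bound[where B
          = C]) (use that sets in \<open>auto simp: measurable_cong_sets[OF sets[OF that(1)] refl]\<close>)
  qed
  have occf_int: "integrable (P t \<xi>) (occf B)" if "0 \<le> t" "finite B" for t \<xi> B
    using occf_measurable[OF that(2)] by (intro intg[OF that(1), where C = 1]) auto
  have bnd: "0 \<le> \<rho> t B" "\<rho> t B \<le> 1" if "0 \<le> t" "finite B" for t B
  proof -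
    interpret prob_space "P t \<eta>" using prob that by simp
    show "0 \<le> \<rho> t B" unfolding \<rho>_def by (intro Bochner_Integration.integral_nonneg) auto
    have "\<rho> t B \<le> (\<integral>\<xi>. 1 \<partial>P t \<eta>)"
      unfolding \<rho>_def using occf_int[OF that] by (intro integral_mono) auto
    then show "\<rho> t B \<le> 1" by (simp add: prob_space)
  qed
  define g where "g t B = hopsum (\<rho> t) B / (2 * real CARD('d)) - real k * \<rho> t B" for t B
  have key: "\<exists>d>0. \<forall>t\<ge>0. \<forall>h. 0 < h \<and> h < d \<longrightarrow> \<bar>\<rho> (t + h) B - \<rho> t B - h * g t B\<bar> \<le> e * h"
    if B: "B \<in> ksets k" and e: "0 < e" for B and e :: real
  proof -
    have fin: "finite B" and card: "card B = k" using B by (auto simp: ksets_def)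
    define L where "L = sep_generator (occf B)"
    have L: "L \<xi> = hopsum (\<lambda>B. occf B \<xi>) B / (2 * real CARD('d)) - real k * occf B \<xi>" for \<xi>
      unfolding L_def generator_occf[OF fin] card ..
    have "uniform_limit UNIV (\<lambda>t \<eta>. ((\<integral>\<xi>. occf B \<xi> \<partial>P t \<eta>) - occf B \<eta>) / t) L (at_right 0)"
      using P occf_local[OF fin] by (simp add: sep_transition_def L_def)
    then have "\<forall>\<^sub>F h in at_right 0. \<forall>\<xi>. dist (((\<integral>\<zeta>. occf B \<zeta> \<partial>P h \<xi>) - occf B \<xi>) / h) (L \<xi>) < e"
      using e by (auto dest: uniform_limitD)
    then obtain d where d: "0 < d" and D: "\<And>h \<xi>. 0 < h \<Longrightarrow> h < d
        \<Longrightarrow> dist (((\<integral>\<zeta>. occf B \<zeta> \<partial>P h \<xi>) - occf B \<xi>) / h) (L \<xi>) < e"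
      unfolding eventually_at_right_field by auto
    have D': "\<bar>(\<integral>\<zeta>. occf B \<zeta> \<partial>P h \<xi>) - occf B \<xi> - h * L \<xi>\<bar> \<le> e * h" if "0 < h" "h < d" for h \<xi>
    proof -
      have "((\<integral>\<zeta>. occf B \<zeta> \<partial>P h \<xi>) - occf B \<xi> - h * L \<xi>) = h * (((\<integral>\<zeta>. occf B \<zeta> \<partial>P h \<xi>) - occf B \<xi>) / h - L \<xi>)"
        using that by (simp add: field_simps)
      then show ?thesis
        using D[OF that, of \<xi>] that by (simp add: abs_mult dist_real_def mult.commute mult_left_mono)
    qed
    have Lint: "integrable (P t \<eta>) L" "(\<integral>\<xi>. L \<xi> \<partial>P t \<eta>) = g t B" if "0 \<le> t" for t
    proof -
      have h: "integrable (P t \<eta>) (\<lambda>\<xi>. hopsum (\<lambda>B. occf B \<xi>) B)" "(\<integral>\<xi>. hopsum (\<lambda>B. occf B \<xi>) B \<partial>P t \<eta>)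
          = hopsum (\<rho> t) B"
        unfolding hopsum_def \<rho>_def using fin occf_int[OF that]
            by (simp_all add: Bochner_Integration.integral_sum)
      show "integrable (P t \<eta>) L" "(\<integral>\<xi>. L \<xi> \<partial>P t \<eta>) = g t B"
        unfolding L g_def using h occf_int[OF that fin] by (simp_all add: L[abs_def] \<rho>_def)
    qed
    have "\<bar>\<rho> (t + h) B - \<rho> t B - h * g t B\<bar> \<le> e * h" if t: "0 \<le> t" and h: "0 < h" "h < d" for t h
    proof -
      interpret prob_space "P t \<eta>" using prob t by simp
      have meas: "(\<lambda>\<xi>. \<integral>\<zeta>. occf B \<zeta> \<partial>P h \<xi>) \<in> borel_measurable borel"
        by (rule borel_measurable_continuous_onI) (use P occf_continuous[OF fin] h in \<open>simp add: sep_transition_def\<close>)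
      have bd: "\<bar>\<integral>\<zeta>. occf B \<zeta> \<partial>P h \<xi>\<bar> \<le> 1" for \<xi>
      proof -
        interpret h: prob_space "P h \<xi>" using prob h by simp
        have "0 \<le> (\<integral>\<zeta>. occf B \<zeta> \<partial>P h \<xi>)" by (intro Bochner_Integration.integral_nonneg) auto
        moreover have "(\<integral>\<zeta>. occf B \<zeta> \<partial>P h \<xi>) \<le> (\<integral>\<zeta>. 1 \<partial>P h \<xi>)"
          using occf_int[of h B \<xi>] h fin by (intro integral_mono) auto
        ultimately show ?thesis by (simp add: h.prob_space)
      qed
      have int: "integrable (P t \<eta>) (\<lambda>\<xi>. \<integral>\<zeta>. occf B \<zeta> \<partial>P h \<xi>)"
        using intg[OF t meas bd] .
      have ck: "P (t + h) \<eta> = P t \<eta> \<bind> P h"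
        using P t h by (simp add: sep_transition_def)
      have "\<rho> (t + h) B = (\<integral>\<xi>. (\<integral>\<zeta>. occf B \<zeta> \<partial>P h \<xi>) \<partial>P t \<eta>)"
        unfolding \<rho>_def ck
      proof (rule integral_bind[where K = borel and B = 1 and B' = 1])
        show "P h \<in> P t \<eta> \<rightarrow>\<^sub>M subprob_algebra borel"
          using measurable_prob_algebraD[OF kernel[of h]] h t
              by (simp add: measurable_cong_sets[OF sets[OF t] refl])

        show "AE x in P t \<eta>. emeasure (P h x) (space (P h x)) \<le> ennreal 1"
          using prob[of h] h by (auto simp: prob_space.emeasure_space_1)
      qed (use occf_measurable[OF fin] in \<open>auto intro: finite_measure_axioms\<close>)
      then have "\<rho> (t + h) B - \<rho> t B - h * g t B = (\<integral>\<xi>. (\<integral>\<zeta>. occf B \<zeta> \<partial>P h \<xi>) - occf B \<xi> - h * L \<xi> \<partial>P t \<eta>)"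
        using int Lint[OF t] occf_int[OF t fin] by (simp add: \<rho>_def)
      also have "\<bar>\<dots>\<bar> \<le> (\<integral>\<xi>. \<bar>(\<integral>\<zeta>. occf B \<zeta> \<partial>P h \<xi>) - occf B \<xi> - h * L \<xi>\<bar> \<partial>P t \<eta>)"
        by (rule integral_abs_bound)
      also have "\<dots> \<le> (\<integral>\<xi>. e * h \<partial>P t \<eta>)"
        using int Lint[OF t] occf_int[OF t fin] D'[OF h] by (intro integral_mono) auto
      finally show ?thesis by (simp add: prob_space)
    qed
    then show ?thesis using d by blast
  qed
  have g_bound: "\<bar>g t B\<bar> \<le> 2 * real k" if t: "0 \<le> t" and B: "B \<in> ksets k" for t B
  proof -
    have b: "0 \<le> \<rho> t B" "\<rho> t B \<le> 1" if "B \<in> ksets k" for B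
      using bnd[OF t] that by (auto simp: ksets_def)
    have "hopsum (\<rho> t) B \<le> real k * (2 * real CARD('d))"
      using hopsum_pow_le[OF B, where f = "\<rho> t" and C = 1 and n = 1] b by simp
    then have "hopsum (\<rho> t) B / (2 * real CARD('d)) \<le> real k"
      by (simp add: divide_le_eq)
    moreover have "0 \<le> hopsum (\<rho> t) B / (2 * real CARD('d))"
      using hopsum_nonneg[OF B, of "\<rho> t"] b by simp
    moreover have "0 \<le> real k * \<rho> t B" "real k * \<rho> t B \<le> real k"
      using b[OF B] by (auto intro: mult_left_le)
    ultimately show ?thesis unfolding g_def by linarith
  qed
  have \<rho>_cont: "continuous_on {0..} (\<lambda>t. \<rho> t B)" if "B \<in> ksets k" for B
    by (rule uniform_right_deriv_continuous[OF key[OF that] g_bound[OF _ that]])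
  have g_cont: "continuous_on {0..} (\<lambda>t. g t B)" if "B \<in> ksets k" for B
    unfolding g_def using hopsum_pow_continuous[OF that \<rho>_cont, where n = 1] \<rho>_cont[OF that]
    by (intro continuous_intros) auto
  show "((\<lambda>t. \<rho> t B) has_real_derivative hopsum (\<rho> t) B / (2 * real CARD('d)) - real k * \<rho> t B) (at t within {0..})"
    using uniform_right_deriv[OF key[OF B] g_cont[OF B] t] by (simp add: g_def)
  show "0 \<le> \<rho> t B" "\<rho> t B \<le> 1"
    using bnd[OF t] B by (auto simp: ksets_def)
qed

text \<open>Self-duality: the closed system has zero source, so \<open>duhamel\<close> identifies
  the marginals with the series. They are therefore the same for every \<open>P\<close> that meets
  \<open>sep_transition\<close>.\<close>

lemma sep_transition_occf:
  assumes P: "sep_transition P" and t: "0 \<le> t" and B: "B \<in> ksets k"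
  shows "ennreal (\<integral>\<xi>. occf B \<xi> \<partial>P t \<eta>) = sg k t (occ {x. \<eta> x}) B"
proof -
  have 0: "(\<integral>\<xi>. occf B \<xi> \<partial>P 0 \<eta>) = occf B \<eta>" if "B \<in> ksets k" for B
    using P occf_measurable[of B] that by (simp add: sep_transition_def ksets_def integral_return)
  have z: "sg k s (\<lambda>B. 0) B = 0" for s and B :: "(int ^ 'a) set"
  proof -
    have "(hopsum ^^ n) (\<lambda>B :: (int ^ 'a) set. 0 :: ennreal) B = 0" for n
      using hopsum_pow_cmult[where c = "0::ennreal" and f = "\<lambda>_. 0"] by simp
    then show ?thesis by (simp add: sg_def)
  qed
  have "ennreal (\<integral>\<xi>. occf B \<xi> \<partial>P t \<eta>) = sg k t (\<lambda>B. ennreal (\<integral>\<xi>. occf B \<xi> \<partial>P 0 \<eta>)) B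
     + (\<integral>\<^sup>+s. sg k (t - s) (\<lambda>B. ennreal 0) B * indicator {0..t} s \<partial>lborel)"
    by (rule duhamel[where r = "\<lambda>_ _. 0"])
       (use sep_transition_deriv[OF P] t B in auto)

  also have "sg k t (\<lambda>B. ennreal (\<integral>\<xi>. occf B \<xi> \<partial>P 0 \<eta>)) B = sg k t (occ {x. \<eta> x}) B"
    by (rule sg_cong[OF B], subst 0, assumption) (auto simp: occ_def occf_def)
  finally show ?thesis by (simp add: z)
qed

text \<open>The Markov property at time 0: given \<open>history M \<eta> 0\<close> the conditional
  expectation is the kernel at the initial state, which is almost surely constant, and taking the
  mean gives the marginal at time \<open>t\<close>.\<close>

lemma ssep_emeasure:
  fixes M :: "'w measure" and \<eta> :: "real \<Rightarrow> 'w \<Rightarrow> 'd::finite config"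
  assumes S: "ssep M \<eta> \<eta>0" and t: "0 \<le> t" and B: "B \<in> ksets k"
  shows "emeasure M {\<omega> \<in> space M. B \<subseteq> {x. \<eta> t \<omega> x}} = sg k t (occ {x. \<eta>0 x}) B"
proof -
  have fin: "finite B" using B by (simp add: ksets_def)
  interpret prob_space M using S by (simp add: ssep_def)
  obtain P where P: "sep_transition P"
    and ce: "\<And>s t f. 0 \<le> s \<Longrightarrow> 0 \<le> t \<Longrightarrow> continuous_on UNIV (f :: 'd config \<Rightarrow> real) \<Longrightarrow>
      AE \<omega> in M. real_cond_exp M (history M \<eta> s) (\<lambda>\<omega>. f (\<eta> (s + t) \<omega>)) \<omega> = (\<integral>\<xi>. f \<xi> \<partial>P t (\<eta> s \<omega>))"
    using S unfolding ssep_def by blast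
  have m: "\<eta> t \<in> M \<rightarrow>\<^sub>M borel" if "0 \<le> t" for t using S that by (simp add: ssep_def)
  have init: "AE \<omega> in M. \<eta> 0 \<omega> = \<eta>0" using S by (simp add: ssep_def)
  have sub: "subalgebra M (history M \<eta> 0)"
    unfolding subalgebra_def history_def
  proof
    let ?A = "{\<eta> r -` B \<inter> space M |r B. 0 \<le> r \<and> r \<le> 0 \<and> B \<in> sets borel}"
    have "?A \<subseteq> sets M" by (auto intro: measurable_sets[OF m])
    moreover have "?A \<subseteq> Pow (space M)" by auto
    ultimately show "sets (sigma (space M) ?A) \<subseteq> sets M"
      by (simp add: sets_measure_of sets.sigma_sets_subset)
  qed (simp add: space_measure_of_conv)
  interpret finite_measure_subalgebra M "history M \<eta> 0"
    using sub by unfold_locales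
  have om: "(\<lambda>\<omega>. occf B (\<eta> t \<omega>)) \<in> borel_measurable M"
    using measurable_compose[OF m[OF t] occf_measurable[OF fin]] .
  have int: "integrable M (\<lambda>\<omega>. occf B (\<eta> t \<omega>))"
    by (rule integrable_const_bound[where B = 1]) (use om in auto)
  have eq: "emeasure M {\<omega> \<in> space M. B \<subseteq> {x. \<eta> t \<omega> x}} = ennreal (\<integral>\<omega>. occf B (\<eta> t \<omega>) \<partial>M)"
  proof -
    have "{\<omega> \<in> space M. B \<subseteq> {x. \<eta> t \<omega> x}} = {\<omega> \<in> space M. occf B (\<eta> t \<omega>) = 1}"
      by (auto simp: occf_def)
    moreover have "{\<omega> \<in> space M. occf B (\<eta> t \<omega>) = 1} \<in> sets M" using om by measurable
    moreover have "(\<integral>\<omega>. occf B (\<eta> t \<omega>) \<partial>M) = (\<integral>\<omega>. indicator {\<omega> \<in> space M. occf B (\<eta> t \<omega>) = 1} \<omega> \<partial>M)"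
      by (intro Bochner_Integration.integral_cong refl) (auto simp: occf_def)
    ultimately show ?thesis by (simp add: emeasure_eq_measure)
  qed
  have "(\<integral>\<omega>. occf B (\<eta> t \<omega>) \<partial>M) = (\<integral>\<omega>. real_cond_exp M (history M \<eta> 0) (\<lambda>\<omega>. occf B (\<eta> t \<omega>)) \<omega> \<partial>M)"
    using real_cond_exp_int(2)[OF int] by simp
  also have "\<dots> = (\<integral>\<omega>. (\<integral>\<xi>. occf B \<xi> \<partial>P t \<eta>0) \<partial>M)"
  proof (rule integral_cong_AE)
    show "AE \<omega> in M. real_cond_exp M (history M \<eta> 0) (\<lambda>\<omega>. occf B (\<eta> t \<omega>)) \<omega> = (\<integral>\<xi>. occf B \<xi> \<partial>P t \<eta>0)"
      using ce[OF order_refl t occf_continuous[OF fin]] init by (auto elim!: AE_mp)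
  qed auto
  also have "\<dots> = (\<integral>\<xi>. occf B \<xi> \<partial>P t \<eta>0)" by (simp add: prob_space)
  finally show ?thesis unfolding eq sep_transition_occf[OF P t B, symmetric] by simp
qed

section \<open>The one-dimensional walk\<close>

definition srwp :: "nat \<Rightarrow> int \<Rightarrow> int set \<Rightarrow> real" where
  "srwp n x A = measure_pmf.prob (srw_pmf x n) A"

definition ctp :: "real \<Rightarrow> int \<Rightarrow> int set \<Rightarrow> real" where
  "ctp s x A = measure_pmf.prob (ctrw_pmf x s) A"

lemma srwp_bounds [simp]: "0 \<le> srwp n x A" "srwp n x A \<le> 1" "\<bar>srwp n x A\<bar> \<le> 1"
  by (auto simp: srwp_def)

lemma ctp_bounds [simp]: "0 \<le> ctp s x A" "ctp s x A \<le> 1"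
  by (auto simp: ctp_def)

lemma srw_pmf_Suc_start:
  "srw_pmf x (Suc n) = pmf_of_set {x - 1, x + 1} \<bind> (\<lambda>y. srw_pmf y n)"
proof (induction n)
  case 0
  show ?case by (simp add: bind_return_pmf bind_return_pmf')
next
  case (Suc n)
  have "srw_pmf x (Suc (Suc n)) = (pmf_of_set {x - 1, x + 1} \<bind> (\<lambda>y. srw_pmf y n)) \<bind> (\<lambda>x. pmf_of_set {x - 1, x + 1})"
    using Suc by simp
  then show ?case by (simp add: bind_assoc_pmf)
qed

lemma measure_bind_pmf: "measure_pmf.prob (bind_pmf p f) A = (\<integral>x. measure_pmf.prob (f x) A \<partial>measure_pmf p)"
proof -
  have "ennreal (measure_pmf.prob (bind_pmf p f) A)
      = (\<integral>\<^sup>+x. ennreal (measure_pmf.prob (f x) A) \<partial>measure_pmf p)"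
    using emeasure_bind_pmf[of p f A] by (simp add: measure_pmf.emeasure_eq_measure del: emeasure_bind_pmf)
  also have "\<dots> = ennreal (\<integral>x. measure_pmf.prob (f x) A \<partial>measure_pmf p)"
    by (intro nn_integral_eq_integral measure_pmf.integrable_const_bound[where B = 1]) auto
  finally show ?thesis by (subst (asm) ennreal_inj) (auto intro: integral_nonneg_AE)
qed

lemma srwp_0: "srwp 0 x A = of_bool (x \<in> A)"
  by (simp add: srwp_def indicator_def)

lemma srwp_Suc: "srwp (Suc n) x A = (srwp n (x - 1) A + srwp n (x + 1) A) / 2"
proof -
  have "(\<Sum>y\<in>{x - 1, x + 1}. srwp n y A) = srwp n (x - 1) A + srwp n (x + 1) A" by simp
  then show ?thesis
    unfolding srwp_def srw_pmf_Suc_start measure_bind_pmf by (subst integral_pmf_of_set) auto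
qed

lemma srwp_Suc_end: "srwp (Suc n) x {w} = (srwp n x {w - 1} + srwp n x {w + 1}) / 2"
proof (induction n arbitrary: x)
  case 0
  show ?case unfolding srwp_Suc[where n = 0] srwp_0 by auto
next
  case (Suc n)
  show ?case unfolding srwp_Suc[where n = "Suc n"] Suc srwp_Suc[where n = n and x = x]
      by (simp add: field_simps)
qed

lemma srwp_shift: "srwp n (x + c) A = srwp n x {k. k + c \<in> A}"
proof (induction n arbitrary: x)
  case (Suc n)
  show ?case
    unfolding srwp_Suc using Suc[of "x - 1"] Suc[of "x + 1"] by (simp add: algebra_simps)
qed (simp add: srwp_0)

text \<open>One term of the Chapman-Kolmogorov sum over the intermediate position; the inequality is
  all that the kernel estimates use.\<close>

lemma srwp_mult_le: "srwp i x {y} * srwp j y {w} \<le> srwp (i + j) x {w}"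
proof (induction i arbitrary: x)
  case 0
  show ?case by (cases "x = y") (simp_all add: srwp_0)
next
  case (Suc i)
  have "srwp (Suc i) x {y} * srwp j y {w}
      = (srwp i (x - 1) {y} * srwp j y {w} + srwp i (x + 1) {y} * srwp j y {w}) / 2"
    unfolding srwp_Suc by (simp add: algebra_simps)
  also have "\<dots> \<le> (srwp (i + j) (x - 1) {w} + srwp (i + j) (x + 1) {w}) / 2"
    using Suc[of "x - 1"] Suc[of "x + 1"] by (intro divide_right_mono add_mono) auto
  finally show ?case unfolding add_Suc srwp_Suc .
qed

text \<open>A Wallis type bound, squared so that no root enters the induction. Consecutive central
  coefficients have the ratio \<open>2 * (2 * m + 1) / (m + 1)\<close>, and the step closes by
  \<open>(2 * m + 1) * (2 * m + 3) \<le> 4 * (m + 1)\<^sup>2\<close>.\<close>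

lemma central_binomial_even: "real ((2 * m) choose m) ^ 2 * real (2 * m + 1) \<le> 16 ^ m"
proof (induction m)
  case (Suc m)
  have r: "(m + 1) * ((2 * Suc m) choose (Suc m)) = 2 * (2 * m + 1) * ((2 * m) choose m)"
  proof -
    have "Suc m * (Suc (Suc (2 * m)) choose Suc m) = Suc (Suc (2 * m)) * (Suc (2 * m) choose m)"
      using Suc_times_binomial_eq[of "Suc (2 * m)" m] by (simp only: mult.commute)
    moreover have "Suc (2 * m) choose m = Suc (2 * m) choose Suc m"
      by (subst binomial_symmetric) auto
    moreover have "Suc m * (Suc (2 * m) choose Suc m) = Suc (2 * m) * ((2 * m) choose m)"
      using Suc_times_binomial_eq[of "2 * m" m] by (simp only: mult.commute)
    moreover have "Suc (Suc (2 * m)) = Suc m * 2" by simp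
    ultimately have "Suc m * (Suc (Suc (2 * m)) choose Suc m) = Suc (2 * m) * ((2 * m) choose m) * 2"
      by (metis mult.assoc mult.commute)
    then show ?thesis by (simp del: binomial_Suc_Suc)
  qed
  define c where "c = real ((2 * m) choose m)"
  define c' where "c' = real ((2 * Suc m) choose (Suc m))"
  have r': "(real m + 1) * c' = 2 * (2 * real m + 1) * c"
    using arg_cong[OF r, of real] unfolding of_nat_mult c_def[symmetric] c'_def[symmetric]
        by (simp add: add.commute)
  have "(real m + 1)\<^sup>2 * (c'\<^sup>2 * (2 * real m + 3)) = ((real m + 1) * c')\<^sup>2 * (2 * real m + 3)"
    by (simp add: power_mult_distrib)
  also have "\<dots> = 4 * (c\<^sup>2 * (2 * real m + 1)) * ((2 * real m + 1) * (2 * real m + 3))"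
    unfolding r' by (simp add: power2_eq_square algebra_simps)
  also have "\<dots> \<le> 4 * 16 ^ m * (4 * (real m + 1)\<^sup>2)"
  proof (rule mult_mono)
    show "4 * (c\<^sup>2 * (2 * real m + 1)) \<le> 4 * 16 ^ m" using Suc by (simp add: c_def algebra_simps)
    show "(2 * real m + 1) * (2 * real m + 3) \<le> 4 * (real m + 1)\<^sup>2"
        by (simp add: power2_eq_square algebra_simps)
  qed auto
  also have "\<dots> = (real m + 1)\<^sup>2 * 16 ^ Suc m" by simp
  finally have "c'\<^sup>2 * (2 * real m + 3) \<le> 16 ^ Suc m"
    by (subst (asm) mult_le_cancel_left_pos) (auto simp: add_pos_nonneg)
  then show ?case by (simp add: c'_def algebra_simps)
qed simp

text \<open>The middle coefficient is the largest. In an odd row it is half the central coefficient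
  of the next row, so the even bound covers that case too.\<close>

lemma binomial_sq_le: "real (n choose k) ^ 2 * real (n + 1) \<le> 4 ^ n"
proof -
  have "real (n choose (n div 2)) ^ 2 * real (n + 1) \<le> 4 ^ n"
  proof (cases "even n")
    case True
    then obtain m where "n = 2 * m" by blast
    then show ?thesis using central_binomial_even[of m] by (simp add: power_mult)
  next
    case False
    then obtain m where n: "n = 2 * m + 1" using oddE by blast
    have "2 * ((2 * m + 1) choose m) = (2 * Suc m) choose (Suc m)"
    proof -
      have "(Suc (2 * m) choose m) = (Suc (2 * m) choose Suc m)"
        by (subst binomial_symmetric) auto
      then show ?thesis by simp
    qed
    then have "2 * real ((2 * m + 1) choose m) = real ((2 * Suc m) choose (Suc m))"
      by (metis of_nat_mult of_nat_numeral)
    then have "(2 * real ((2 * m + 1) choose m))\<^sup>2 * real (2 * Suc m + 1) \<le> 16 ^ Suc m"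
      using central_binomial_even[of "Suc m"] by simp
    then have "4 * (real ((2 * m + 1) choose m) ^ 2 * real (2 * m + 3)) \<le> 16 * 16 ^ m"
      by (simp add: power_mult_distrib algebra_simps)
    moreover have "real ((2 * m + 1) choose m) ^ 2 * real (2 * m + 2)
        \<le> real ((2 * m + 1) choose m) ^ 2 * real (2 * m + 3)"
      by (intro mult_left_mono) auto
    moreover have "(4::real) ^ n = 4 * 16 ^ m" by (simp add: n power_mult)
    ultimately have "real ((2 * m + 1) choose m) ^ 2 * real (2 * m + 2) \<le> 4 ^ n" by linarith
    moreover have "n div 2 = m" "n + 1 = 2 * m + 2" using n by auto
    ultimately show ?thesis by (simp only: n)
  qed
  moreover have "real (n choose k) ^ 2 * real (n + 1) \<le> real (n choose (n div 2)) ^ 2 * real (n + 1)"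
    by (intro mult_right_mono power_mono of_nat_mono binomial_maximum) auto
  ultimately show ?thesis by linarith
qed

text \<open>A walk at \<open>w\<close> after \<open>n\<close> steps has made
  \<open>(w + n) / 2\<close> steps to the right. Positions above \<open>n\<close> are taken care of
  by the vanishing of the binomial coefficient.\<close>

lemma srwp_binomial:
  "srwp n 0 {w} = (if even (w + int n) \<and> 0
      \<le> w + int n then real (n choose nat ((w + int n) div 2)) / 2 ^ n else 0)"
proof (induction n arbitrary: w)
  case 0
  show ?case by (auto simp: srwp_0 elim!: evenE)
next
  case (Suc n)
  show ?case
  proof (cases "even (w + int (Suc n))")
    case False
    then have "odd (w - 1 + int n)" "odd (w + 1 + int n)" by auto
    then show ?thesis unfolding srwp_Suc_end Suc using False by simp
  next
    case True
    then obtain j where j: "w + int (Suc n) = 2 * j" by (elim evenE)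
    have e: "w - 1 + int n = 2 * (j - 1)" "w + 1 + int n = 2 * j" using j by auto
    show ?thesis
    proof (cases "j \<le> 0")
      case True
      then show ?thesis unfolding srwp_Suc_end Suc e j by (cases "j = 0") auto
    next
      case False
      then obtain i where i: "j = int (Suc i)" by (metis not_le zero_less_imp_eq_int gr0_implies_Suc)
      have "nat (j - 1) = i" "nat j = Suc i" using i by auto
      then show ?thesis unfolding srwp_Suc_end Suc e j using i by (simp add: add_divide_distrib)
    qed
  qed
qed

lemma srwp_le: "srwp n x {w} \<le> 1 / sqrt (real n + 1)"
proof -
  have "srwp n x {w} = srwp n 0 {w - x}"
  proof -
    have "{k. k + x \<in> {w}} = {w - x}" by auto
    then show ?thesis using srwp_shift[of n 0 x "{w}"] by simp
  qed
  also have "\<dots> \<le> 1 / sqrt (real n + 1)"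
  proof -
    have "real (n choose k) / 2 ^ n \<le> 1 / sqrt (real n + 1)" for k
    proof -
      have "(real (n choose k) * sqrt (real n + 1))\<^sup>2 \<le> (2 ^ n)\<^sup>2"
      proof -
        have "(real (n choose k) * sqrt (real n + 1))\<^sup>2 = (real (n choose k))\<^sup>2 * real (n + 1)"
          by (simp add: power_mult_distrib)
        moreover have "((2::real) ^ n)\<^sup>2 = 4 ^ n"
          by (simp add: power2_eq_square flip: power_mult_distrib)
        ultimately show ?thesis using binomial_sq_le[of n k] by simp
      qed
      then have "real (n choose k) * sqrt (real n + 1) \<le> 2 ^ n"
        by (rule power2_le_imp_le) simp
      then show ?thesis by (simp add: field_simps)
    qed
    then show ?thesis unfolding srwp_binomial by simp
  qed
  finally show ?thesis .
qed

lemma summable_exp_weight: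
  fixes a :: "nat \<Rightarrow> real"
  assumes "\<And>n. \<bar>a n\<bar> \<le> 1"
  shows "summable (\<lambda>n. a n / fact n * y ^ n)"
proof (rule summable_comparison_test')
  show "summable (\<lambda>n. \<bar>y\<bar> ^ n / fact n)" using summable_exp[of "\<bar>y\<bar>"] by (simp add: field_simps)
  show "norm (a n / fact n * y ^ n) \<le> \<bar>y\<bar> ^ n / fact n" if "n \<ge> 0" for n
    using assms[of n] by (auto simp: abs_mult power_abs intro!: divide_right_mono mult_left_le_one_le)
qed

lemma pmf_poisson0: "0 \<le> s \<Longrightarrow> pmf (poisson0_pmf s) n = exp (- s) * (s ^ n / fact n)"
  by (cases n) (auto simp: poisson0_pmf_def)

lemma ctp_eq:
  assumes "0 \<le> s"
  shows "ctp s x A = exp (- s) * (\<Sum>n. srwp n x A / fact n * s ^ n)"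
proof -
  let ?t = "\<lambda>n. exp (- s) * (srwp n x A / fact n * s ^ n)"
  have sm: "summable (\<lambda>n. srwp n x A / fact n * s ^ n)"
    by (rule summable_exp_weight) simp
  have "ennreal (ctp s x A) = (\<integral>\<^sup>+n. emeasure (srw_pmf x n) A \<partial>poisson0_pmf s)"
    unfolding ctp_def ctrw_pmf_def by (simp flip: measure_pmf.emeasure_eq_measure)
  also have "\<dots> = (\<integral>\<^sup>+n. ennreal (?t n) \<partial>count_space UNIV)"
    unfolding nn_integral_measure_pmf
    by (intro nn_integral_cong) (simp add: pmf_poisson0 assms measure_pmf.emeasure_eq_measure mult_ac srwp_def flip: ennreal_mult)
  also have "\<dots> = (\<Sum>n. ennreal (?t n))"
    by (rule nn_integral_count_space_nat)
  also have "\<dots> = ennreal (\<Sum>n. ?t n)"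
    using assms sm by (intro suminf_ennreal2 summable_mult) auto
  also have "(\<Sum>n. ?t n) = exp (- s) * (\<Sum>n. srwp n x A / fact n * s ^ n)"
    by (rule suminf_mult[OF sm])
  finally show ?thesis
    using assms sm by (subst (asm) ennreal_inj) (auto intro!: mult_nonneg_nonneg suminf_nonneg)
qed

lemma ctp_0 [simp]: "ctp 0 x A = of_bool (x \<in> A)"
  by (simp add: ctp_def ctrw_pmf_def poisson0_pmf_def bind_return_pmf indicator_def)

text \<open>Term by term differentiation shifts the index of the exponential series by one, and the
  first-step recursion \<open>srwp_Suc\<close> turns the shifted series into the mean of the two
  neighbouring ones. The factor \<open>exp (- s)\<close> supplies the term
  \<open>- ctp s x A\<close>.\<close>

lemma ctp_deriv:
  assumes s: "0 \<le> s"
  shows "((\<lambda>s. ctp s x A) has_real_derivative (ctp s (x - 1) A + ctp s (x + 1) A) / 2 - ctp s x A) (at s within {0..})"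
proof -
  have sm: "summable (\<lambda>n. srwp n y A / fact n * r ^ n)" for y r
    by (rule summable_exp_weight) simp
  have dS: "((\<lambda>s. \<Sum>n. srwp n x A / fact n * s ^ n)
      has_real_derivative (\<Sum>n. diffs (\<lambda>n. srwp n x A / fact n) n * s ^ n)) (at s)"
    by (rule termdiffs_strong_converges_everywhere) (rule sm)
  have eq: "diffs (\<lambda>n. srwp n x A / fact n) n * s ^ n
      = (srwp n (x - 1) A / fact n * s ^ n + srwp n (x + 1) A / fact n * s ^ n) / 2" for n
  proof -
    have "diffs (\<lambda>n. srwp n x A / fact n) n = srwp (Suc n) x A / fact n"
      unfolding diffs_def by (simp del: of_nat_Suc srw_pmf.simps)
    then show ?thesis unfolding srwp_Suc by (simp add: field_simps)
  qed
  have d: "(\<Sum>n. diffs (\<lambda>n. srwp n x A / fact n) n * s ^ n)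
      = ((\<Sum>n. srwp n (x - 1) A / fact n * s ^ n) + (\<Sum>n. srwp n (x + 1) A / fact n * s ^ n)) / 2"
    unfolding eq suminf_divide[OF summable_add[OF sm sm]] suminf_add[OF sm sm, symmetric] ..
  have "((\<lambda>s. exp (- s) * (\<Sum>n. srwp n x A / fact n * s ^ n)) has_real_derivative
     exp (- s) * (- 1) * (\<Sum>n. srwp n x A / fact n * s ^ n) + (\<Sum>n. diffs (\<lambda>n. srwp n x A / fact n) n * s ^ n) * exp (- s)) (at s within {0..})"
    by (intro DERIV_mult has_field_derivative_at_within[OF dS]) (auto intro!: derivative_eq_intros)
  then have "((\<lambda>s. ctp s x A) has_real_derivative
     exp (- s) * (- 1) * (\<Sum>n. srwp n x A / fact n * s ^ n) + (\<Sum>n. diffs (\<lambda>n. srwp n x A / fact n) n * s ^ n) * exp (- s)) (at s within {0..})"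
    by (rule has_field_derivative_transform_within[where d = 1]) (use s in \<open>auto simp: ctp_eq\<close>)
  then show ?thesis
    unfolding d by (rule DERIV_cong) (simp add: ctp_eq[OF s] algebra_simps add_divide_distrib)
qed

lemma ctp_shift: "0 \<le> s \<Longrightarrow> ctp s (x + c) A = ctp s x {k. k + c \<in> A}"
  by (simp add: ctp_eq srwp_shift)

text \<open>In the Cauchy product of the two series, \<open>srwp_mult_le\<close> bounds every term
  of total degree \<open>k\<close> by the same probability, and the remaining weights add up to
  \<open>(s + r) ^ k / fact k\<close> by the binomial theorem.\<close>

lemma ctp_mult_le:
  assumes s: "0 \<le> s" and r: "0 \<le> r"
  shows "ctp s x {y} * ctp r y {w} \<le> ctp (s + r) x {w}"
proof -
  let ?a = "\<lambda>n. srwp n x {y} / fact n * s ^ n"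
  let ?b = "\<lambda>n. srwp n y {w} / fact n * r ^ n"
  let ?c = "\<lambda>n. srwp n x {w} / fact n * (s + r) ^ n"
  have sa: "summable ?a" and sb: "summable ?b" and sc: "summable ?c"
    by (rule summable_exp_weight; simp)+
  have cp: "(\<lambda>k. \<Sum>i\<le>k. ?a i * ?b (k - i)) sums ((\<Sum>n. ?a n) * (\<Sum>n. ?b n))"
    using sa sb s r by (intro Cauchy_product_sums) simp_all
  have "(\<Sum>i\<le>k. ?a i * ?b (k - i)) \<le> ?c k" for k
  proof -
    have "(\<Sum>i\<le>k. ?a i * ?b (k - i)) \<le> (\<Sum>i\<le>k. srwp k x {w} / fact k * (real (k choose i) * s ^ i * r ^ (k - i)))"
    proof (rule sum_mono)
      fix i assume "i \<in> {..k}"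
      then have i: "i \<le> k" by simp
      have "?a i * ?b (k - i) = (srwp i x {y} * srwp (k - i) y {w}) * (s ^ i * r ^ (k - i) / (fact i * fact (k - i)))"
        by simp
      also have "\<dots> \<le> srwp k x {w} * (s ^ i * r ^ (k - i) / (fact i * fact (k - i)))"
        using srwp_mult_le[of i x y "k - i" w] i s r by (intro mult_right_mono) auto
      also have "\<dots> = srwp k x {w} / fact k * (real (k choose i) * s ^ i * r ^ (k - i))"
        using i by (simp add: binomial_fact)
      finally show "?a i * ?b (k - i) \<le> srwp k x {w} / fact k * (real (k choose i) * s ^ i * r ^ (k - i))" .
    qed
    also have "\<dots> = ?c k" by (simp only: sum_distrib_left[symmetric] binomial_ring)
    finally show ?thesis .
  qed
  then have "(\<Sum>n. ?a n) * (\<Sum>n. ?b n) \<le> (\<Sum>n. ?c n)"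
    using sums_le[OF _ cp summable_sums[OF sc]] by simp
  then have "exp (- (s + r)) * ((\<Sum>n. ?a n) * (\<Sum>n. ?b n)) \<le> exp (- (s + r)) * (\<Sum>n. ?c n)"
    by (intro mult_left_mono) auto
  then show ?thesis
    unfolding ctp_eq[OF s] ctp_eq[OF r] ctp_eq[OF add_nonneg_nonneg[OF s r]]
    by (simp add: exp_diff exp_minus field_simps exp_add)
qed

text \<open>The mean of \<open>1 / sqrt (n + 1)\<close> for Poisson distributed \<open>n\<close> has
  to be bounded. AM-GM reduces it to the mean of \<open>1 / (n + 1)\<close>, which is at most
  \<open>1 / s\<close> by a shift of the exponential series.\<close>

lemma ctp_le:
  assumes s: "0 < s"
  shows "ctp s x {w} \<le> 1 / sqrt s"
proof -
  have amgm: "1 / sqrt (real n + 1) \<le> (sqrt s / (real n + 1) + 1 / sqrt s) / 2" for n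
  proof -
    define a b where "a = sqrt (sqrt s)" and "b = sqrt (real n + 1)"
    have ab: "a > 0" "b > 0" "a\<^sup>2 = sqrt s" "b\<^sup>2 = real n + 1" using s by (auto simp: a_def b_def)
    have "0 \<le> (a / b - 1 / a)\<^sup>2" by simp
    also have "\<dots> = a\<^sup>2 / b\<^sup>2 + 1 / a\<^sup>2 - 2 / b"
      using ab(1,2) by (simp add: power2_eq_square field_simps)
    finally show ?thesis unfolding ab(3,4) b_def by simp
  qed
  have sm1: "summable (\<lambda>n. s ^ Suc n / fact (Suc n))"
    using summable_exp[of s] by (subst summable_Suc_iff) (simp add: field_simps)
  have sm0: "summable (\<lambda>n. s ^ n / fact n)"
    using summable_exp[of s] by (simp add: field_simps)
  have sum0: "(\<Sum>n. s ^ n / fact n) = exp s"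
    by (simp add: exp_def field_simps scaleR_conv_of_real)
  have sum1: "(\<Sum>n. s ^ Suc n / fact (Suc n)) \<le> exp s"
    using suminf_split_head[OF sm0] sum0 by simp
  have "(\<Sum>n. srwp n x {w} / fact n * s ^ n)
      \<le> (\<Sum>n. (1 / sqrt s) / 2 * (s ^ Suc n / fact (Suc n)) + (1 / sqrt s) / 2 * (s ^ n / fact n))"
  proof (rule suminf_le)
    fix n
    have "srwp n x {w} * (s ^ n / fact n) \<le> (sqrt s / (real n + 1) + 1 / sqrt s) / 2 * (s ^ n / fact n)"
      using order_trans[OF srwp_le amgm] s by (intro mult_right_mono) auto
    then have "srwp n x {w} / fact n * s ^ n \<le> (sqrt s / (real n + 1) + 1 / sqrt s) / 2 * (s ^ n / fact n)"
      by simp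
    also have "\<dots> = (1 / sqrt s) / 2 * (s ^ Suc n / fact (Suc n)) + (1 / sqrt s) / 2 * (s ^ n / fact n)"
    proof -
      define X where "X = s ^ n / fact n"
      have r: "sqrt s = s / sqrt s" using s by (simp add: real_div_sqrt)
      have "s ^ Suc n / fact (Suc n) = s * X / (real n + 1)" by (simp add: X_def add.commute)
      then show ?thesis
        unfolding X_def[symmetric] by (subst r) (simp add: add_divide_distrib distrib_right distrib_left mult_ac)
    qed
    finally show "srwp n x {w} / fact n * s ^ n
        \<le> (1 / sqrt s) / 2 * (s ^ Suc n / fact (Suc n)) + (1 / sqrt s) / 2 * (s ^ n / fact n)" .
  next
    show "summable (\<lambda>n. srwp n x {w} / fact n * s ^ n)" by (rule summable_exp_weight) simp
    show "summable (\<lambda>n. (1 / sqrt s) / 2 * (s ^ Suc n / fact (Suc n)) + (1 / sqrt s) / 2 * (s ^ n / fact n))"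
      by (intro summable_add summable_mult sm0 sm1)
  qed
  also have "\<dots> = (1 / sqrt s) / 2 * (\<Sum>n. s ^ Suc n / fact (Suc n)) + (1 / sqrt s) / 2 * (\<Sum>n. s ^ n / fact n)"
    by (simp only: suminf_add[OF summable_mult[OF sm1] summable_mult[OF sm0], symmetric] suminf_mult[OF sm1] suminf_mult[OF sm0])
  also have "\<dots> \<le> (1 / sqrt s) / 2 * exp s + (1 / sqrt s) / 2 * exp s"
    using sum1 sum0 s by (intro add_mono mult_left_mono) auto
  finally have "exp (- s) * (\<Sum>n. srwp n x {w} / fact n * s ^ n) \<le> exp (- s) * ((1 / sqrt s) * exp s)"
    by (intro mult_left_mono) auto
  then show ?thesis using s by (simp add: ctp_eq exp_minus)
qed

lemma ctp_UNIV [simp]: "ctp s x UNIV = 1"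
  by (simp add: ctp_def)

section \<open>Heat flow on the lattice\<close>

lemma ctp_deriv_scaled:
  assumes s: "0 \<le> s" and d: "0 < d"
  shows "((\<lambda>s. ctp (s / d) x A) has_real_derivative
     ((ctp (s / d) (x - 1) A + ctp (s / d) (x + 1) A) / 2 - ctp (s / d) x A) * (1 / d)) (at s within {0..})"
proof -
  have "((\<lambda>s. ctp s x A) has_real_derivative (ctp (s / d) (x - 1) A + ctp (s / d) (x + 1) A) / 2 - ctp (s / d) x A)
    (at (s / d) within (\<lambda>s. s / d) ` {0..})"
  proof (rule has_field_derivative_subset)
    show "((\<lambda>s. ctp s x A) has_real_derivative (ctp (s / d) (x - 1) A + ctp (s / d) (x + 1) A) / 2 - ctp (s / d) x A)
      (at (s / d) within {0..})" using s d by (intro ctp_deriv) auto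
    show "(\<lambda>s. s / d) ` {0..} \<subseteq> {0..}" using d by auto
  qed
  moreover have "((\<lambda>s. s / d) has_real_derivative 1 / d) (at s within {0..})"
    using d by (auto intro!: derivative_eq_intros)
  ultimately have "((\<lambda>s. ctp s x A) \<circ> (\<lambda>s. s / d) has_real_derivative
     ((ctp (s / d) (x - 1) A + ctp (s / d) (x + 1) A) / 2 - ctp (s / d) x A) * (1 / d)) (at s within {0..})"
    by (rule DERIV_image_chain)
  then show ?thesis by (simp add: o_def)
qed

text \<open>The coordinates of the walk with rate 1 on the lattice are independent one-dimensional
  walks of rate \<open>1 / d\<close>; hence the time \<open>s / d\<close> in each factor.\<close>

lemma heat_ctp:
  "heat (\<lambda>s (x :: int ^ 'd::finite). \<Prod>i\<in>UNIV. ctp (s / real CARD('d)) (x $ i) (A i))"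
  unfolding heat_def
proof (intro allI impI conjI)
  fix s :: real and x :: "int ^ 'd" assume s: "0 \<le> s"
  let ?d = "real CARD('d)"
  let ?p = "\<lambda>i y. ctp (s / ?d) y (A i)"
  show "0 \<le> (\<Prod>i\<in>UNIV. ?p i (x $ i))" by (intro prod_nonneg) auto
  show "(\<Prod>i\<in>UNIV. ?p i (x $ i)) \<le> 1" by (intro prod_le_1) auto
  have d: "0 < ?d" by simp
  let ?R = "\<lambda>i. \<Prod>j\<in>UNIV - {i}. ?p j (x $ j)"
  have "((\<lambda>s. \<Prod>i\<in>UNIV. ctp (s / ?d) (x $ i) (A i)) has_real_derivative
      (\<Sum>i\<in>UNIV. ((?p i (x $ i - 1) + ?p i (x $ i + 1)) / 2 - ?p i (x $ i)) * (1 / ?d) * ?R i)) (at s within {0..})"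
    by (rule DERIV_prod_within[OF finite ctp_deriv_scaled[OF s d]])
  moreover have "(\<Sum>i\<in>UNIV. ((?p i (x $ i - 1) + ?p i (x $ i + 1)) / 2 - ?p i (x $ i)) * (1 / ?d) * ?R i)
     = (\<Sum>y\<in>neighbours x. \<Prod>i\<in>UNIV. ?p i (y $ i)) / (2 * ?d) - (\<Prod>i\<in>UNIV. ?p i (x $ i))"
  proof -
    have pl: "(\<Prod>j\<in>UNIV. ?p j ((x + axis i c) $ j)) = ?p i (x $ i + c) * ?R i" for i c
      by (subst prod.remove[of _ i]) (auto simp: axis_def intro!: prod.cong)
    have mi: "x - axis i 1 = x + axis i (-1)" for i by (simp add: vec_eq_iff axis_def)
    have "(\<Sum>i\<in>UNIV. ((?p i (x $ i - 1) + ?p i (x $ i + 1)) / 2 - ?p i (x $ i)) * (1 / ?d) * ?R i)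
       = (\<Sum>i\<in>UNIV. (?p i (x $ i + 1) * ?R i + ?p i (x $ i - 1) * ?R i) / (2 * ?d) - ?p i (x $ i) * ?R i / ?d)"
      by (intro sum.cong refl) (simp add: field_simps)
    also have "\<dots> = (\<Sum>i\<in>UNIV. ?p i (x $ i + 1) * ?R i + ?p i (x $ i - 1) * ?R i) / (2 * ?d) - (\<Sum>i\<in>UNIV. ?p i (x $ i) * ?R i / ?d)"
      by (simp add: sum_subtractf sum_divide_distrib)
    also have "(\<Sum>i\<in>UNIV. ?p i (x $ i) * ?R i / ?d) = (\<Prod>i\<in>UNIV. ?p i (x $ i))"
    proof -
      have "?p i (x $ i) * ?R i = (\<Prod>i\<in>UNIV. ?p i (x $ i))" for i
        by (rule prod.remove[symmetric]) auto
      then show ?thesis by simp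
    qed
    also have "(\<Sum>i\<in>UNIV. ?p i (x $ i + 1) * ?R i + ?p i (x $ i - 1) * ?R i)
        = (\<Sum>y\<in>neighbours x. \<Prod>i\<in>UNIV. ?p i (y $ i))"
      unfolding sum_neighbours mi pl by simp
    finally show ?thesis .
  qed
  ultimately show "((\<lambda>s. \<Prod>i\<in>UNIV. ctp (s / ?d) (x $ i) (A i)) has_real_derivative
     (\<Sum>y\<in>neighbours x. \<Prod>i\<in>UNIV. ?p i (y $ i)) / (2 * ?d) - (\<Prod>i\<in>UNIV. ?p i (x $ i))) (at s within {0..})"
    by simp
qed

lemma heat_coordinate:
  "heat (\<lambda>s (x :: int ^ 'd::finite). ctp (s / real CARD('d)) (x $ e) A)"
proof -
  have "(\<Prod>i\<in>UNIV. ctp s (x $ i) (if i = e then A else UNIV)) = ctp s (x $ e) A" for s and x :: "int ^ 'd"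
    by (subst prod.remove[of _ e]) auto
  then show ?thesis using heat_ctp[where 'd = 'd and A = "\<lambda>i. if i = e then A else UNIV"] by simp
qed

text \<open>\<open>sum_heat_product\<close> at \<open>s = 0\<close>, for the explicit product
  solution that starts from the indicator of \<open>{x}\<close>: its initial values pick out the
  single term \<open>u r x\<close>.\<close>

lemma heat_convolution:
  fixes u :: "real \<Rightarrow> int ^ 'd::finite \<Rightarrow> real"
  assumes u: "heat u" and u0: "\<And>x. u 0 x = of_bool (x \<in> R)" and r: "0 \<le> r"
  shows "ennreal (u r x) = (\<integral>\<^sup>+w. of_bool (w \<in> R) * ennreal (\<Prod>i\<in>UNIV. ctp (r / real CARD('d)) (w $ i) {x $ i}) \<partial>count_space UNIV)"
proof -
  let ?q = "\<lambda>s w. \<Prod>i\<in>UNIV. ctp (s / real CARD('d)) (w $ i) {x $ i}"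
  have q0: "?q 0 w = of_bool (w = x)" for w
    by (auto simp: vec_eq_iff)
  have "(\<integral>\<^sup>+w. of_bool (w \<in> R) * ennreal (?q (0 + r) w) \<partial>count_space UNIV)
      = (\<integral>\<^sup>+w. ennreal (?q 0 w * u r w) \<partial>count_space UNIV)"
    by (rule sum_heat_product[symmetric, OF heat_ctp u u0 order_refl r])
  also have "\<dots> = (\<integral>\<^sup>+w. of_bool (w \<in> {x}) * ennreal (u r w) \<partial>count_space UNIV)"
    unfolding q0 by (intro nn_integral_cong) auto
  also have "\<dots> = ennreal (u r x)"
    by (subst nn_sum_finite[symmetric]) auto
  finally show ?thesis by simp
qed

text \<open>Bounds the heat kernel of the \<open>d - 1\<close> coordinates other than \<open>e\<close>; the trivial bound 1 takes over at small times.\<close>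

definition transverse_bound :: "nat \<Rightarrow> real \<Rightarrow> real" where
  "transverse_bound d r = (if 0 < r then min 1 (sqrt (real d / r)) else 1) ^ (d - 1)"

lemma transverse_kernel_le:
  fixes x w :: "int ^ 'd::finite"
  assumes "0 \<le> r"
  shows "(\<Prod>i\<in>UNIV. ctp (r / real CARD('d)) (w $ i) {x $ i})
     \<le> transverse_bound CARD('d) r * ctp (r / real CARD('d)) (w $ e) {x $ e}"
proof -
  let ?m = "if 0 < r then min 1 (sqrt (real CARD('d) / r)) else 1"
  have "ctp (r / real CARD('d)) a {b} \<le> ?m" for a b
    using ctp_le[of "r / real CARD('d)" a b] by (auto simp: real_sqrt_divide)
  then have "(\<Prod>i\<in>UNIV - {e}. ctp (r / real CARD('d)) (w $ i) {x $ i}) \<le> (\<Prod>i\<in>UNIV - {e}. ?m)"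
    by (intro prod_mono) auto
  also have "\<dots> = transverse_bound CARD('d) r"
    by (simp add: transverse_bound_def card_Diff_subset)
  finally show ?thesis
    by (subst prod.remove[of _ e]) (auto intro: mult_left_mono simp: mult.commute[of "transverse_bound _ _"])
qed

lemma nn_translate:
  fixes f :: "int ^ 'd::finite \<Rightarrow> ennreal"
  shows "(\<integral>\<^sup>+x. f (x + a) \<partial>count_space UNIV) = (\<integral>\<^sup>+x. f x \<partial>count_space UNIV)"
  by (rule nn_integral_bij_count_space) (auto intro!: bij_betwI[where g = "\<lambda>x. x - a"])

lemma nn_edges:
  fixes F :: "int ^ 'd::finite \<Rightarrow> int ^ 'd \<Rightarrow> ennreal"
  assumes sym: "\<And>x y. F x y = F y x"
    and zero: "\<And>x i. i \<noteq> e \<Longrightarrow> F x (x + axis i 1) = 0"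
  shows "(\<integral>\<^sup>+p. F (fst p) (snd p) \<partial>count_space edges) = 2 * (\<integral>\<^sup>+x. F x (x + axis e 1) \<partial>count_space UNIV)"
proof -
  have "(\<integral>\<^sup>+p. F (fst p) (snd p) \<partial>count_space edges)
      = (\<integral>\<^sup>+p. of_bool (snd p \<in> neighbours (fst p)) * F (fst p) (snd p) \<partial>count_space UNIV)"
    unfolding nn_restrict by (simp add: edges_def Sigma_def case_prod_beta) (rule arg_cong2[where f
        = nn_integral]; auto intro!: arg_cong[where f = count_space])
  also have "\<dots> = (\<integral>\<^sup>+x. \<integral>\<^sup>+y. of_bool (y \<in> neighbours x) * F x y \<partial>count_space UNIV \<partial>count_space UNIV)"
    by (subst nn_integral_fst_count_space[symmetric]) simp
  also have "\<dots> = (\<integral>\<^sup>+x. (\<Sum>y\<in>neighbours x. F x y) \<partial>count_space UNIV)"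
    by (intro nn_integral_cong nn_sum_finite[symmetric]) auto
  also have "\<dots> = (\<integral>\<^sup>+x. F x (x + axis e 1) + F x (x - axis e 1) \<partial>count_space UNIV)"
  proof (rule nn_integral_cong)
    fix x :: "int ^ 'd"
    have "F x (x - axis i 1) = 0" if "i \<noteq> e" for i
      using zero[OF that, of "x - axis i 1"] sym by simp
    then have "(\<Sum>y\<in>neighbours x. F x y) = (\<Sum>i\<in>UNIV. if i
        = e then F x (x + axis e 1) + F x (x - axis e 1) else 0)"
      unfolding sum_neighbours using zero by (intro sum.cong) auto
    then show "(\<Sum>y\<in>neighbours x. F x y) = F x (x + axis e 1) + F x (x - axis e 1)" by simp
  qed
  also have "\<dots> = (\<integral>\<^sup>+x. F x (x + axis e 1) \<partial>count_space UNIV) + (\<integral>\<^sup>+x. F x (x - axis e 1) \<partial>count_space UNIV)"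
    by (rule nn_integral_add) auto
  also have "(\<integral>\<^sup>+x. F x (x - axis e 1) \<partial>count_space UNIV) = (\<integral>\<^sup>+x. F x (x + axis e 1) \<partial>count_space UNIV)"
    using nn_translate[of "\<lambda>x. F x (x - axis e 1)" "axis e 1"] sym by simp
  finally show ?thesis by (simp add: mult_2)
qed

text \<open>
  The derivative of the expected count with respect to the threshold: \<open>layer R e t (\<lfloor>z\<rfloor> + 1)\<close> is the
  expected count beyond \<open>z\<close> minus the one beyond \<open>z + 1\<close>.
\<close>

definition layer :: "(int ^ 'd::finite) set \<Rightarrow> 'd \<Rightarrow> real \<Rightarrow> int \<Rightarrow> ennreal" where
  "layer R e t Z = (\<integral>\<^sup>+w. of_bool (w \<in> R) * ennreal (ctp (t / real CARD('d)) (w $ e) {Z}) \<partial>count_space UNIV)"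

text \<open>Starting one site further to the right gains exactly the endpoint
  \<open>\<lfloor>z\<rfloor>\<close>. Thus the discrete gradient of \<open>q\<close> in direction
  \<open>e\<close> is a point probability, in particular nonnegative.\<close>

lemma ctp_tail_diff:
  assumes "0 \<le> s"
  shows "ctp s (c + 1) {k. z < real_of_int k} - ctp s c {k. z < real_of_int k} = ctp s c {\<lfloor>z\<rfloor>}"
proof -
  have "{k. k + 1 \<in> {k. z < real_of_int k}} = {k. z < real_of_int k} \<union> {\<lfloor>z\<rfloor>}"
  proof -
    have "z < real_of_int (k + 1) \<longleftrightarrow> z < real_of_int k \<or> k = \<lfloor>z\<rfloor>" for k
      using floor_less_iff[of z k] floor_less_iff[of z "k + 1"] by linarith
    then show ?thesis by auto
  qed
  then have "ctp s (c + 1) {k. z < real_of_int k} = ctp s c ({k. z < real_of_int k} \<union> {\<lfloor>z\<rfloor>})"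
    using ctp_shift[OF assms, of c 1] by simp
  also have "\<dots> = ctp s c {k. z < real_of_int k} + ctp s c {\<lfloor>z\<rfloor>}"
    unfolding ctp_def by (rule measure_pmf.finite_measure_Union) (auto simp: not_less)
  finally show ?thesis by simp
qed

text \<open>With \<open>p x\<close> the gradient of \<open>q\<close>, the summand is
  \<open>p x * u x\<close> times \<open>p x * u (x + a)\<close>. The first factor is bounded
  uniformly in \<open>x\<close>: writing \<open>u\<close> as a convolution, the transverse kernel
  gives \<open>transverse_bound\<close> and the two kernels along \<open>e\<close> combine by
  \<open>ctp_mult_le\<close> into a layer. The second is summed over \<open>x\<close> and is a layer
  by \<open>sum_heat_product\<close>. The factor 2 counts both orientations of a bond.\<close>

lemma energy_integrand_le:
  fixes u :: "real \<Rightarrow> int ^ 'd::finite \<Rightarrow> real" and z :: real and e :: 'd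
  assumes u: "heat u" and u0: "\<And>x. u 0 x = of_bool (x \<in> R)" and s: "0 \<le> s" and r: "0 \<le> r"
  defines "q \<equiv> \<lambda>s x. ctp (s / real CARD('d)) (x $ e) {k. z < real_of_int k}"
  shows "bond_energy (q s) (u r)
    \<le> 2 * (ennreal (transverse_bound CARD('d) r) * layer R e (s + r) \<lfloor>z\<rfloor> * layer R e (s + r) (\<lfloor>z\<rfloor> + 1))"
proof -
  let ?d = "real CARD('d)" and ?Z = "\<lfloor>z\<rfloor>" and ?a = "axis e 1 :: int ^ 'd"
  let ?p = "\<lambda>x. ctp (s / ?d) (x $ e) {?Z}"
  have u_nn: "0 \<le> u r x" for x using u r by (simp add: heat_def)
  have sd: "0 \<le> s / ?d" "0 \<le> r / ?d" using s r by auto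
  have dq: "q s (x + ?a) - q s x = ?p x" for x
    unfolding q_def using ctp_tail_diff[OF sd(1), of "x $ e" z] by simp
  define K where "K = ennreal (transverse_bound CARD('d) r) * layer R e (s + r) ?Z"
  have pu: "ennreal (?p x * u r x) \<le> ennreal (transverse_bound CARD('d) r) * layer R e (s + r) ?Z" for x
  proof -
    have "ennreal (?p x * u r x) = ennreal (?p x) * (\<integral>\<^sup>+w. of_bool (w \<in> R) * ennreal (\<Prod>i\<in>UNIV. ctp (r / ?d) (w $ i) {x $ i}) \<partial>count_space UNIV)"
      unfolding heat_convolution[OF u u0 r, symmetric] using u_nn by (simp add: ennreal_mult)
    also have "\<dots> = (\<integral>\<^sup>+w. of_bool (w \<in> R) * ennreal (?p x * (\<Prod>i\<in>UNIV. ctp (r / ?d) (w $ i) {x $ i})) \<partial>count_space UNIV)"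
      by (subst nn_integral_cmult[symmetric]) (auto simp: ennreal_mult prod_nonneg mult.left_commute intro!: nn_integral_cong)
    also have "\<dots> \<le> (\<integral>\<^sup>+w. of_bool (w \<in> R) * ennreal (transverse_bound CARD('d) r * ctp ((s + r) / ?d) (w $ e) {?Z}) \<partial>count_space UNIV)"
    proof (intro nn_integral_mono mult_left_mono ennreal_leI)
      fix w :: "int ^ 'd"
      have "?p x * (\<Prod>i\<in>UNIV. ctp (r / ?d) (w $ i) {x $ i})
          \<le> ?p x * (transverse_bound CARD('d) r * ctp (r / ?d) (w $ e) {x $ e})"
        by (intro mult_left_mono transverse_kernel_le r) auto
      also have "\<dots> = transverse_bound CARD('d) r * (ctp (r / ?d) (w $ e) {x $ e} * ?p x)" by simp
      also have "\<dots> \<le> transverse_bound CARD('d) r * ctp (r / ?d + s / ?d) (w $ e) {?Z}"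
        by (intro mult_left_mono ctp_mult_le sd) (auto simp: transverse_bound_def)
      finally show "?p x * (\<Prod>i\<in>UNIV. ctp (r / ?d) (w $ i) {x $ i})
          \<le> transverse_bound CARD('d) r * ctp ((s + r) / ?d) (w $ e) {?Z}"
        by (simp add: add_divide_distrib add.commute)
    qed auto
    also have "\<dots> = ennreal (transverse_bound CARD('d) r) * layer R e (s + r) ?Z"
      unfolding layer_def by (subst nn_integral_cmult[symmetric]) (auto simp: ennreal_mult transverse_bound_def mult.left_commute intro!: nn_integral_cong)
    finally show ?thesis .
  qed
  have "(\<integral>\<^sup>+p. ennreal ((q s (fst p) - q s (snd p))\<^sup>2 * (u r (fst p) * u r (snd p))) \<partial>count_space edges)
    = 2 * (\<integral>\<^sup>+x. ennreal ((q s x - q s (x + ?a))\<^sup>2 * (u r x * u r (x + ?a))) \<partial>count_space UNIV)"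
  proof (rule nn_edges[where F = "\<lambda>x y. ennreal ((q s x - q s y)\<^sup>2 * (u r x * u r y))"])
    show "ennreal ((q s x - q s y)\<^sup>2 * (u r x * u r y))
        = ennreal ((q s y - q s x)\<^sup>2 * (u r y * u r x))" for x y
      by (simp add: power2_commute mult.commute)
    show "ennreal ((q s x - q s (x + axis i 1))\<^sup>2 * (u r x * u r (x + axis i 1))) = 0" if "i \<noteq> e" for x i
      using that by (simp add: q_def axis_def)
  qed
  also have "(\<integral>\<^sup>+x. ennreal ((q s x - q s (x + ?a))\<^sup>2 * (u r x * u r (x + ?a))) \<partial>count_space UNIV)
     = (\<integral>\<^sup>+x. ennreal (?p x * u r x) * ennreal (?p x * u r (x + ?a)) \<partial>count_space UNIV)"
  proof (rule nn_integral_cong)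
    fix x
    have "(q s x - q s (x + ?a))\<^sup>2 = (q s (x + ?a) - q s x)\<^sup>2" by (rule power2_commute)
    then have "(q s x - q s (x + ?a))\<^sup>2 = ?p x * ?p x" unfolding dq by (simp add: power2_eq_square)
    then show "ennreal ((q s x - q s (x + ?a))\<^sup>2 * (u r x * u r (x + ?a)))
        = ennreal (?p x * u r x) * ennreal (?p x * u r (x + ?a))"
      using u_nn by (simp add: mult_ac flip: ennreal_mult)
  qed
  also have "\<dots> \<le> (\<integral>\<^sup>+x. K * ennreal (?p x * u r (x + ?a)) \<partial>count_space UNIV)"
    unfolding K_def by (intro nn_integral_mono mult_right_mono pu) auto
  also have "\<dots> = K * (\<integral>\<^sup>+x. ennreal (?p x * u r (x + ?a)) \<partial>count_space UNIV)"
    by (intro nn_integral_cmult) simp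
  \<comment> \<open>Here \<open>u\<close> sits at \<open>x + a\<close> but the kernel at
    \<open>x\<close>. Translating the kernel along with \<open>u\<close> moves its target from
    \<open>\<lfloor>z\<rfloor>\<close> to \<open>\<lfloor>z\<rfloor> + 1\<close>, whence the two
    different layers.\<close>
  also have "(\<integral>\<^sup>+x. ennreal (?p x * u r (x + ?a)) \<partial>count_space UNIV)
      = (\<integral>\<^sup>+x. ennreal (ctp (s / ?d) (x $ e) {?Z + 1} * u r x) \<partial>count_space UNIV)"
  proof -
    have "?p x = ctp (s / ?d) ((x + ?a) $ e) {?Z + 1}" for x
    proof -
      have "{k. k + 1 \<in> {?Z + 1}} = {?Z}" by auto
      then show ?thesis using ctp_shift[OF sd(1), of "x $ e" 1 "{?Z + 1}"] by simp
    qed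
    then show ?thesis using nn_translate[of "\<lambda>x. ennreal (ctp (s / ?d) (x $ e) {?Z + 1} * u r x)" ?a] by simp
  qed
  also have "\<dots> = layer R e (s + r) (?Z + 1)"
    unfolding layer_def by (rule sum_heat_product[OF heat_coordinate u u0 s r])
  finally show ?thesis unfolding bond_energy_def K_def by (simp add: mult_left_mono)
qed

section \<open>Time integrals of the transverse factor\<close>

lemma nn_integral_reflect:
  fixes h :: "real \<Rightarrow> real"
  assumes "0 \<le> t" "h \<in> borel_measurable borel"
  shows "(\<integral>\<^sup>+s. ennreal (h (t - s)) * indicator {0..t} s \<partial>lborel)
      = (\<integral>\<^sup>+s. ennreal (h s) * indicator {0..t} s \<partial>lborel)"
proof -
  have "(\<integral>\<^sup>+s. ennreal (h s) * indicator {0..t} s \<partial>lborel)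
    = ennreal \<bar>-1\<bar> * (\<integral>\<^sup>+s. ennreal (h (t + (-1) * s)) * indicator {0..t} (t + (-1) * s) \<partial>lborel)"
    using assms by (intro nn_integral_real_affine) auto
  also have "\<dots> = (\<integral>\<^sup>+s. ennreal (h (t - s)) * indicator {0..t} s \<partial>lborel)"
    by (auto intro!: nn_integral_cong split: split_indicator)
  finally show ?thesis ..
qed

text \<open>One smooth majorant with elementary antiderivatives replaces the two regimes:
  \<open>2d / (1 + r)\<close> exceeds 1 for \<open>r \<le> 1\<close> and exceeds
  \<open>d / r\<close> for \<open>r > 1\<close>.\<close>

lemma transverse_base_le:
  assumes "0 \<le> r" "1 \<le> d"
  shows "(if 0 < r then min 1 (sqrt (real d / r)) else 1) \<le> sqrt (2 * real d / (1 + r))"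
proof (cases "r \<le> 1")
  case True
  then have "1 \<le> 2 * real d / (1 + r)" using assms by (simp add: field_simps)
  then have "1 \<le> sqrt (2 * real d / (1 + r))" by (simp only: real_sqrt_ge_1_iff)
  then show ?thesis by (intro order_trans[OF _ \<open>1 \<le> sqrt (2 * real d / (1 + r))\<close>]) auto
next
  case False
  then have "real d / r \<le> 2 * real d / (1 + r)" using assms by (simp add: field_simps)
  then have "sqrt (real d / r) \<le> sqrt (2 * real d / (1 + r))" by (simp only: real_sqrt_le_iff)
  then show ?thesis by (intro order_trans[OF _ \<open>sqrt (real d / r)
      \<le> sqrt (2 * real d / (1 + r))\<close>]) (use False in auto)
qed

lemma transverse_bound_measurable [measurable]: "transverse_bound d \<in> borel_measurable borel"
  unfolding transverse_bound_def by measurable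

lemma transverse_bound_2: "0 \<le> r \<Longrightarrow> transverse_bound 2 r \<le> 2 / sqrt (1 + r)"
  using transverse_base_le[of r 2] by (simp add: transverse_bound_def real_sqrt_divide)

lemma transverse_bound_3: "0 \<le> r \<Longrightarrow> transverse_bound 3 r \<le> 6 / (1 + r)"
proof -
  assume r: "0 \<le> r"
  have "transverse_bound 3 r \<le> (sqrt (2 * real 3 / (1 + r)))\<^sup>2"
    unfolding transverse_bound_def using transverse_base_le[OF r, of 3] by (simp add: power_mono)
  then show ?thesis using r by simp
qed

text \<open>The base of the power is at most 1 and the exponent at least 3, so the cube dominates in
  every dimension from 4 on and decays integrably.\<close>

lemma transverse_bound_4:
  assumes r: "0 \<le> r" and d: "4 \<le> d"
  shows "transverse_bound d r \<le> (sqrt (2 * real d)) ^ 3 * (1 / ((1 + r) * sqrt (1 + r)))"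
proof -
  let ?b = "if 0 < r then min 1 (sqrt (real d / r)) else 1"
  have "transverse_bound d r \<le> ?b ^ 3"
    unfolding transverse_bound_def using d by (intro power_decreasing) auto
  also have "\<dots> \<le> (sqrt (2 * real d / (1 + r))) ^ 3"
    using transverse_base_le[OF r, of d] d by (intro power_mono) auto
  also have "\<dots> = (sqrt (2 * real d)) ^ 3 * (1 / ((1 + r) * sqrt (1 + r)))"
    using r by (simp add: real_sqrt_divide power_divide power3_eq_cube)
  finally show ?thesis .
qed

lemma nn_integral_bound:
  fixes h f F :: "real \<Rightarrow> real"
  assumes t: "0 \<le> t" and le: "\<And>r. 0 \<le> r \<Longrightarrow> r \<le> t \<Longrightarrow> h r \<le> f r"
    and F: "\<And>r. 0 \<le> r \<Longrightarrow> (F has_real_derivative f r) (at r)" and c: "continuous_on {0..} f" and nn: "\<And>r. 0 \<le> r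
        \<Longrightarrow> 0 \<le> f r"
  shows "(\<integral>\<^sup>+s. ennreal (h s) * indicator {0..t} s \<partial>lborel) \<le> ennreal (F t - F 0)"
proof -
  have "(\<integral>\<^sup>+s. ennreal (h s) * indicator {0..t} s \<partial>lborel)
      \<le> (\<integral>\<^sup>+s. ennreal (f s) * indicator {0..t} s \<partial>lborel)"
    using le by (intro nn_integral_mono) (auto split: split_indicator intro: ennreal_leI)
  also have "\<dots> = ennreal (F t - F 0)"
    using t F nn by (intro nn_integral_FTC_within(1) has_field_derivative_at_within[OF F] continuous_on_subset[OF c]) auto
  finally show ?thesis .
qed

lemma transverse_integral_2:
  "0 \<le> t \<Longrightarrow> (\<integral>\<^sup>+s. ennreal (transverse_bound 2 s) * indicator {0..t} s \<partial>lborel) \<le> ennreal (4 * sqrt (1 + t))"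
proof -
  assume t: "0 \<le> t"
  have "(\<integral>\<^sup>+s. ennreal (transverse_bound 2 s) * indicator {0..t} s \<partial>lborel)
      \<le> ennreal (4 * sqrt (1 + t) - 4 * sqrt (1 + 0))"
  proof (rule nn_integral_bound[OF t, where f = "\<lambda>r. 2 / sqrt (1 + r)"])
    show "((\<lambda>r. 4 * sqrt (1 + r)) has_real_derivative 2 / sqrt (1 + r)) (at r)" if "0 \<le> r" for r :: real
      using that by (auto intro!: derivative_eq_intros simp: field_simps)
  qed (auto intro!: transverse_bound_2 continuous_intros)
  then show ?thesis by (rule order_trans) (auto intro: ennreal_leI)
qed

lemma transverse_integral_3:
  "0 \<le> t \<Longrightarrow> (\<integral>\<^sup>+s. ennreal (transverse_bound 3 s) * indicator {0..t} s \<partial>lborel) \<le> ennreal (6 * ln (1 + t))"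
proof -
  assume t: "0 \<le> t"
  have "(\<integral>\<^sup>+s. ennreal (transverse_bound 3 s) * indicator {0..t} s \<partial>lborel)
      \<le> ennreal (6 * ln (1 + t) - 6 * ln (1 + 0))"
  proof (rule nn_integral_bound[OF t, where f = "\<lambda>r. 6 / (1 + r)"])
    show "((\<lambda>r. 6 * ln (1 + r)) has_real_derivative 6 / (1 + r)) (at r)" if "0 \<le> r" for r :: real
      using that by (auto intro!: derivative_eq_intros simp: field_simps)
  qed (auto intro!: transverse_bound_3 continuous_intros)
  then show ?thesis by simp
qed

lemma transverse_integral_4:
  assumes t: "0 \<le> t" and d: "4 \<le> d"
  shows "(\<integral>\<^sup>+s. ennreal (transverse_bound d s) * indicator {0..t} s \<partial>lborel)
      \<le> ennreal (2 * (sqrt (2 * real d)) ^ 3)"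
proof -
  let ?C = "(sqrt (2 * real d)) ^ 3"
  let ?F = "\<lambda>r. - (2 * ?C) * (1 / sqrt (1 + r))"
  have "(\<integral>\<^sup>+s. ennreal (transverse_bound d s) * indicator {0..t} s \<partial>lborel) \<le> ennreal (?F t - ?F 0)"
  proof (rule nn_integral_bound[OF t, where f = "\<lambda>r. ?C * (1 / ((1 + r) * sqrt (1 + r)))"])
    fix r :: real assume r: "0 \<le> r"
    have "((\<lambda>r. 1 / sqrt (1 + r)) has_real_derivative - (1 / (2 * ((1 + r) * sqrt (1 + r))))) (at r)"
      using r by (auto intro!: derivative_eq_intros simp: field_simps)
    from DERIV_cmult[OF this, of "- (2 * ?C)"]
    show "(?F has_real_derivative ?C * (1 / ((1 + r) * sqrt (1 + r)))) (at r)"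
      by (rule DERIV_cong) simp
    show "transverse_bound d r \<le> ?C * (1 / ((1 + r) * sqrt (1 + r)))" by (rule transverse_bound_4[OF r d])
  qed (auto intro!: continuous_intros)
  also have "\<dots> \<le> ennreal (2 * ?C)"
    using t by (intro ennreal_leI) simp
  finally show ?thesis .
qed

section \<open>Rows of the initial profile\<close>

lemma card_vec_box:
  fixes S :: "'d::finite \<Rightarrow> int set"
  assumes "\<And>i. finite (S i)"
  shows "finite {x :: int ^ 'd. \<forall>i. x $ i \<in> S i}" "card {x :: int ^ 'd. \<forall>i. x $ i \<in> S i}
      = (\<Prod>i\<in>UNIV. card (S i))"
proof -
  have b: "bij_betw vec_nth {x :: int ^ 'd. \<forall>i. x $ i \<in> S i} (PiE UNIV S)"
    by (rule bij_betwI[where g = vec_lambda]) (auto simp: PiE_UNIV_domain)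
  have f: "finite (PiE UNIV S)" using assms by (intro finite_PiE) auto
  show "finite {x :: int ^ 'd. \<forall>i. x $ i \<in> S i}" using bij_betw_finite[OF b] f by simp
  show "card {x :: int ^ 'd. \<forall>i. x $ i \<in> S i} = (\<Prod>i\<in>UNIV. card (S i))"
    using bij_betw_same_card[OF b] by (simp add: card_PiE)
qed

definition row :: "'d::finite \<Rightarrow> ('d \<Rightarrow> real \<Rightarrow> real) \<Rightarrow> nat \<Rightarrow> (int ^ 'd) set" where
  "row e g j = {x. profile e g x \<and> x $ e = - int j}"

definition row_size :: "'d::finite \<Rightarrow> ('d \<Rightarrow> real \<Rightarrow> real) \<Rightarrow> nat \<Rightarrow> real" where
  "row_size e g j = (\<Prod>i\<in>UNIV - {e}. 2 * real_of_int \<lfloor>g i (real j)\<rfloor> + 1)"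

text \<open>The mean value theorem for \<open>ln h\<close> on \<open>[u, u + 1]\<close> bounds the
  logarithm of \<open>h (u + 1) / h u\<close> by a value of \<open>h' / h\<close>, which is small.
  Monotonicity of \<open>h\<close> gives the lower bound 1.\<close>

lemma condC_ratio:
  fixes h :: "real \<Rightarrow> real"
  assumes nn: "\<And>u. 0 \<le> u \<Longrightarrow> 0 \<le> h u" and A: "condA h" and C: "condC h"
  shows "((\<lambda>u. (2 * h (u + 1) + 1) / (2 * h u + 1)) \<longlongrightarrow> 1) at_top"
proof (rule tendstoI)
  fix \<epsilon> :: real assume \<epsilon>: "0 < \<epsilon>"
  \<comment> \<open>Chosen so that \<open>exp \<delta> = 1 + \<epsilon> / 2\<close>, the tolerated
    growth over a unit step.\<close>
  define \<delta> where "\<delta> = ln (1 + \<epsilon> / 2)"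
  have \<delta>: "0 < \<delta>" "exp \<delta> = 1 + \<epsilon> / 2" using \<epsilon> by (auto simp: \<delta>_def)
  have "\<forall>\<^sub>F u in at_top. h u \<noteq> 0 \<and> dist (deriv0 h u / h u) 0 < \<delta>"
  proof (rule eventually_conj)
    show "\<forall>\<^sub>F u in at_top. h u \<noteq> 0" using C by (simp add: condC_def)
    show "\<forall>\<^sub>F u in at_top. dist (deriv0 h u / h u) 0 < \<delta>"
      by (rule tendstoD[OF _ \<delta>(1)]) (use C in \<open>simp add: condC_def\<close>)
  qed
  then obtain u0 where u0: "\<And>u. u0 \<le> u \<Longrightarrow> h u \<noteq> 0 \<and> dist (deriv0 h u / h u) 0 < \<delta>"
    unfolding eventually_at_top_linorder by blast
  \<comment> \<open>The bound 1 keeps \<open>u\<close> in the interior of the half line, where the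
    one-sided derivative \<open>deriv0\<close> is an ordinary one.\<close>
  have "dist ((2 * h (u + 1) + 1) / (2 * h u + 1)) 1 < \<epsilon>" if u: "max 1 u0 \<le> u" for u
  proof -
    have pos: "0 < h v" if "u \<le> v" for v
      using u0[of v] nn[of v] u that by auto
    have der: "(h has_real_derivative deriv0 h v) (at v)" if "u \<le> v" for v
    proof -
      have "h differentiable (at v within {0..})"
        using C that u unfolding condC_def cont_diff_def differentiable_on_def by auto
      then have "(h has_vector_derivative deriv0 h v) (at v within {0..})"
        unfolding deriv0_def by (simp add: vector_derivative_works)
      moreover have "at v within {0..} = at v"
        using that u by (intro at_within_interior) auto
      ultimately show ?thesis by (simp add: has_real_derivative_iff_has_vector_derivative)
    qed
    have "\<exists>\<xi>. u < \<xi> \<and> \<xi> < u + 1 \<and> ln (h (u + 1)) - ln (h u) = (u + 1 - u) * (deriv0 h \<xi> / h \<xi>)"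
    proof (rule MVT2)
      fix v assume v: "u \<le> v" "v \<le> u + 1"
      show "((\<lambda>v. ln (h v)) has_real_derivative deriv0 h v / h v) (at v)"
        using der[OF v(1)] pos[OF v(1)] by (auto intro!: derivative_eq_intros simp: field_simps)
    qed simp
    then obtain \<xi> where \<xi>: "u < \<xi>" "ln (h (u + 1)) - ln (h u) = deriv0 h \<xi> / h \<xi>" by auto
    have "dist (deriv0 h \<xi> / h \<xi>) 0 < \<delta>" using u0[of \<xi>] \<xi>(1) u by simp
    then have "deriv0 h \<xi> / h \<xi> \<le> \<delta>" unfolding dist_real_def diff_0_right by linarith
    then have "ln (h (u + 1)) \<le> ln (exp \<delta> * h u)" using \<xi>(2) pos[of u] by (simp add: ln_mult)
    then have le: "h (u + 1) \<le> exp \<delta> * h u" using pos[of u] pos[of "u + 1"]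
        by (subst (asm) ln_le_cancel_iff) auto
    have ge: "h u \<le> h (u + 1)" using A u unfolding condA_def by (auto intro: mono_onD)
    have "(2 * h (u + 1) + 1) / (2 * h u + 1) \<le> 1 + \<epsilon> / 2"
      using le \<epsilon> pos[of u] \<delta>(2) by (simp add: divide_le_eq algebra_simps)
    moreover have "1 \<le> (2 * h (u + 1) + 1) / (2 * h u + 1)"
      using ge pos[of u] by (simp add: le_divide_eq)
    ultimately show ?thesis using \<epsilon> by (simp add: dist_real_def)
  qed
  then show "\<forall>\<^sub>F u in at_top. dist ((2 * h (u + 1) + 1) / (2 * h u + 1)) 1 < \<epsilon>"
    unfolding eventually_at_top_linorder by blast
qed

text \<open>As the profile lies in \<open>x $ e \<le> 0\<close>, this is an upper bound for the
  weights of all its particles, the \<open>\<delta>\<close> of \<open>esym_Suc_ge\<close>. For an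
  integer \<open>k\<close> the condition \<open>\<lfloor>z\<rfloor> < k\<close> means
  \<open>z < k\<close>.\<close>

definition walk_tail :: "real \<Rightarrow> real \<Rightarrow> real" where
  "walk_tail s z = ctp s 0 {k. \<lfloor>z\<rfloor> < k}"

text \<open>All particles are read off one walk from 0: when it ends at \<open>k\<close>, the
  particles of row \<open>j\<close> count iff \<open>k - j > z\<close>, that is,
  \<open>j < k - \<lfloor>z\<rfloor>\<close>.\<close>

definition expected_count :: "'d::finite \<Rightarrow> ('d \<Rightarrow> real \<Rightarrow> real) \<Rightarrow> real \<Rightarrow> real \<Rightarrow> ennreal" where
  "expected_count e g t z =
     (\<integral>\<^sup>+k. ennreal (\<Sum>j<nat (k - \<lfloor>z\<rfloor>). row_size e g j) \<partial>measure_pmf (ctrw_pmf 0 (t / real CARD('d))))"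

section \<open>Convergence of binomial moments to those of a Poisson law\<close>

text \<open>The binomial expansion of \<open>(1 + w) ^ N\<close> at
  \<open>w = exp (\<i> * \<theta>) - 1\<close>, which expresses a characteristic function through
  binomial moments.\<close>

lemma iexp_binomial:
  "(\<lambda>k. of_nat (N choose k) * (exp (\<i> * complex_of_real \<theta>) - 1) ^ k) sums iexp (\<theta> * real N)"
proof -
  let ?w = "exp (\<i> * complex_of_real \<theta>) - 1"
  have "iexp (\<theta> * real N) = (?w + 1) ^ N"
    by (simp add: exp_of_nat_mult[symmetric] mult_ac)
  also have "\<dots> = (\<Sum>k\<le>N. of_nat (N choose k) * ?w ^ k)"
    by (subst binomial_ring) simp
  finally have eq: "iexp (\<theta> * real N) = (\<Sum>k\<le>N. of_nat (N choose k) * ?w ^ k)" .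
  show ?thesis unfolding eq by (rule sums_finite) auto
qed

lemma norm_iexp_minus_1: "norm (exp (\<i> * complex_of_real \<theta>) - 1) \<le> 2"
  using norm_triangle_ineq4[of "exp (\<i> * complex_of_real \<theta>)" 1] by simp

lemma exp_weight_sums:
  fixes w :: complex
  shows "(\<lambda>k. complex_of_real (l ^ k / fact k) * w ^ k) sums exp (complex_of_real l * w)"
  using exp_converges[of "complex_of_real l * w"]
  by (simp add: scaleR_conv_of_real power_mult_distrib field_simps)

lemma char_poisson_law:
  assumes "0 \<le> l"
  shows "char (poisson_law l) \<theta> = exp (complex_of_real l * (exp (\<i> * complex_of_real \<theta>) - 1))"
proof -
  let ?p = "poisson0_pmf l" and ?z = "exp (\<i> * complex_of_real \<theta>)"
  have "char (poisson_law l) \<theta> = measure_pmf.expectation ?p (\<lambda>k. iexp (\<theta> * real k))"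
    unfolding char_def poisson_law_def by (subst integral_distr) auto
  also have "\<dots> = exp (complex_of_real l * (?z - 1))"
  proof (cases "l = 0")
    case True
    then show ?thesis by (simp add: poisson0_pmf_def)
  next
    case False
    have abs: "Infinite_Set_Sum.abs_summable_on (\<lambda>k. pmf ?p k *\<^sub>R iexp (\<theta> * real k)) UNIV"
    proof -
      have "integrable (measure_pmf ?p) (\<lambda>k. iexp (\<theta> * real k))"
        by (rule measure_pmf.integrable_const_bound[where B = 1]) auto
      then show ?thesis
        unfolding Infinite_Set_Sum.abs_summable_on_def
        by (subst (asm) measure_pmf_eq_density, subst (asm) integrable_density) auto
    qed
    have "measure_pmf.expectation ?p (\<lambda>k. iexp (\<theta> * real k))
        = infsetsum (\<lambda>k. pmf ?p k *\<^sub>R iexp (\<theta> * real k)) UNIV"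
      unfolding infsetsum_def measure_pmf_eq_density by (subst integral_density) simp_all
    also have "\<dots> = (\<Sum>k. pmf ?p k *\<^sub>R iexp (\<theta> * real k))"
      by (rule infsetsum_nat'[OF abs])
    also have "\<dots> = exp (complex_of_real l * (?z - 1))"
    proof -
      have "(\<lambda>k. exp (- complex_of_real l) * (complex_of_real (l ^ k / fact k) * ?z ^ k)) sums (exp (- complex_of_real l) * exp (complex_of_real l * ?z))"
        by (intro sums_mult exp_weight_sums)
      moreover have "exp (- complex_of_real l) * (complex_of_real (l ^ k / fact k) * ?z ^ k)
          = pmf ?p k *\<^sub>R iexp (\<theta> * real k)" for k
        unfolding pmf_poisson0[OF assms] scaleR_conv_of_real
        by (simp add: exp_of_real exp_of_nat_mult[symmetric] mult_ac exp_minus flip: of_real_exp)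
      ultimately have "(\<Sum>k. pmf ?p k *\<^sub>R iexp (\<theta> * real k))
          = exp (- complex_of_real l) * exp (complex_of_real l * ?z)"
        by (simp add: sums_iff)
      then show ?thesis by (simp add: exp_add[symmetric] algebra_simps)
    qed
    finally show ?thesis .
  qed
  finally show ?thesis .
qed

lemma real_distribution_poisson_law: "real_distribution (poisson_law l)"
  unfolding poisson_law_def by (rule prob_space.real_distribution_distr[OF measure_pmf.prob_space_axioms]) simp

text \<open>Since \<open>norm w \<le> 2\<close>, the bound \<open>c ^ k / fact k\<close> makes the
  expansion absolutely summable in mean, which justifies exchanging expectation and series.\<close>

lemma char_binomial_moments:
  assumes "prob_space M" and X [measurable]: "X \<in> measurable M (count_space UNIV)"
    and c: "0 \<le> c" and b: "\<And>k. (\<integral>\<^sup>+\<omega>. of_nat (X \<omega> choose k) \<partial>M) \<le> ennreal (c ^ k / fact k)"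
  shows "char (distr M borel (\<lambda>\<omega>. real (X \<omega>))) \<theta>
    = (\<Sum>k. complex_of_real (enn2real (\<integral>\<^sup>+\<omega>. of_nat (X \<omega> choose k) \<partial>M)) * (exp (\<i> * complex_of_real \<theta>) - 1) ^ k)"
proof -
  interpret prob_space M by fact
  let ?w = "exp (\<i> * complex_of_real \<theta>) - 1"
  let ?b = "\<lambda>k. \<integral>\<^sup>+\<omega>. of_nat (X \<omega> choose k) \<partial>M"
  have nn: "(\<integral>\<^sup>+\<omega>. ennreal (real (X \<omega> choose k)) \<partial>M) = ?b k" for k
    by (simp add: ennreal_of_nat_eq_real_of_nat)
  have int: "integrable M (\<lambda>\<omega>. real (X \<omega> choose k))" for k
    by (rule integrableI_bounded) (use b[of k] in \<open>auto simp: nn intro: le_less_trans\<close>)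
  have Eb: "(\<integral>\<omega>. real (X \<omega> choose k) \<partial>M) = enn2real (?b k)" for k
    unfolding nn[symmetric] by (rule integral_eq_nn_integral) auto
  have bc: "enn2real (?b k) \<le> c ^ k / fact k" for k
    using b[of k] c by (intro enn2real_leI) auto
  have cint: "integrable M (\<lambda>\<omega>. of_nat (X \<omega> choose k) * ?w ^ k)" for k
    using integrable_mult_left[OF integrable_of_real[OF int[of k], where 'a = complex], of "?w ^ k"] by simp
  have wint: "(\<integral>\<omega>. of_nat (X \<omega> choose k) * ?w ^ k \<partial>M) = complex_of_real (enn2real (?b k)) * ?w ^ k" for k
  proof -
    have "(\<integral>\<omega>. of_nat (X \<omega> choose k) * ?w ^ k \<partial>M) = (\<integral>\<omega>. complex_of_real (real (X \<omega> choose k)) \<partial>M) * ?w ^ k"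
      by simp
    then show ?thesis unfolding integral_complex_of_real Eb .
  qed
  have "char (distr M borel (\<lambda>\<omega>. real (X \<omega>))) \<theta> = (\<integral>\<omega>. iexp (\<theta> * real (X \<omega>)) \<partial>M)"
    unfolding char_def by (subst integral_distr) auto
  also have "\<dots> = (\<integral>\<omega>. (\<Sum>k. of_nat (X \<omega> choose k) * ?w ^ k) \<partial>M)"
    by (intro Bochner_Integration.integral_cong refl) (rule sums_unique[OF iexp_binomial])
  also have "\<dots> = (\<Sum>k. \<integral>\<omega>. of_nat (X \<omega> choose k) * ?w ^ k \<partial>M)"
  proof (rule integral_suminf[OF cint])
    show "AE \<omega> in M. summable (\<lambda>k. norm (of_nat (X \<omega> choose k) * ?w ^ k))"
    proof (rule AE_I2)
      fix \<omega>
      show "summable (\<lambda>k. norm (of_nat (X \<omega> choose k) * ?w ^ k))"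
        by (rule summable_finite[of "{..X \<omega>}"]) auto
    qed
    have "(\<integral>\<omega>. norm (of_nat (X \<omega> choose k) * ?w ^ k) \<partial>M) = norm ?w ^ k * enn2real (?b k)" for k
      unfolding Eb[symmetric] by (simp add: norm_mult norm_power mult.commute)
    moreover have "summable (\<lambda>k. norm ?w ^ k * enn2real (?b k))"
    proof (rule summable_comparison_test')
      show "summable (\<lambda>k. (2 * c) ^ k / fact k)" using summable_exp[of "2 * c"] by (simp add: field_simps)
      fix k :: nat
      have "norm ?w ^ k * enn2real (?b k) \<le> 2 ^ k * (c ^ k / fact k)"
        using norm_iexp_minus_1 bc by (intro mult_mono power_mono) auto
      then show "norm (norm ?w ^ k * enn2real (?b k)) \<le> (2 * c) ^ k / fact k"
        by (simp add: power_mult_distrib abs_mult)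
    qed
    ultimately show "summable (\<lambda>k. \<integral>\<omega>. norm (of_nat (X \<omega> choose k) * ?w ^ k) \<partial>M)" by simp
  qed
  finally show ?thesis unfolding wint .
qed

text \<open>Tannery's theorem passes to the limit under the series, dominated by
  \<open>(2 * c) ^ k / fact k\<close> uniformly in \<open>n\<close>, and Levy's continuity theorem
  concludes.\<close>

lemma poisson_convergence:
  fixes X :: "nat \<Rightarrow> 'w \<Rightarrow> nat"
  assumes M: "prob_space M" and X: "\<And>n. X n \<in> measurable M (count_space UNIV)"
    and l: "0 \<le> l" and c: "0 \<le> c"
    and lim: "\<And>k. (\<lambda>n. \<integral>\<^sup>+\<omega>. of_nat (X n \<omega> choose k) \<partial>M) \<longlonglongrightarrow> ennreal (l ^ k / fact k)"
    and bound: "\<forall>\<^sub>F n in sequentially. \<forall>k. (\<integral>\<^sup>+\<omega>. of_nat (X n \<omega> choose k) \<partial>M) \<le> ennreal (c ^ k / fact k)"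
  shows "weak_conv_m (\<lambda>n. distr M borel (\<lambda>\<omega>. real (X n \<omega>))) (poisson_law l)"
proof (rule levy_continuity)
  interpret prob_space M by fact
  show "real_distribution (distr M borel (\<lambda>\<omega>. real (X n \<omega>)))" for n
    using X[of n] by (intro real_distribution_distr measurable_compose[OF X]) auto
  show "real_distribution (poisson_law l)" by (rule real_distribution_poisson_law)
  fix \<theta>
  let ?w = "exp (\<i> * complex_of_real \<theta>) - 1"
  let ?b = "\<lambda>n k. \<integral>\<^sup>+\<omega>. of_nat (X n \<omega> choose k) \<partial>M"
  let ?a = "\<lambda>k n. complex_of_real (enn2real (?b n k)) * ?w ^ k"
  have "(\<lambda>n. \<Sum>k. ?a k n) \<longlonglongrightarrow> (\<Sum>k. complex_of_real (l ^ k / fact k) * ?w ^ k)"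
  proof (rule tannerys_theorem[THEN conjunct2, THEN conjunct2])
    show "(\<lambda>n. ?a k n) \<longlonglongrightarrow> complex_of_real (l ^ k / fact k) * ?w ^ k" for k
    proof (intro tendsto_mult tendsto_const tendsto_of_real)
      show "(\<lambda>n. enn2real (?b n k)) \<longlonglongrightarrow> l ^ k / fact k"
        using tendsto_enn2real[OF lim[of k]] l by simp
    qed
    show "summable (\<lambda>k. (2 * c) ^ k / fact k)" using summable_exp[of "2 * c"] by (simp add: field_simps)
    have "\<forall>\<^sub>F n in sequentially. \<forall>k. norm (?a k n) \<le> (2 * c) ^ k / fact k"
      using bound
    proof eventually_elim
      case (elim n)
      show ?case
      proof
        fix k
        have "enn2real (?b n k) \<le> c ^ k / fact k"
          using elim c by (intro enn2real_leI) auto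
        then have "enn2real (?b n k) * norm ?w ^ k \<le> (c ^ k / fact k) * 2 ^ k"
          using norm_iexp_minus_1 c by (intro mult_mono power_mono) auto
        then show "norm (?a k n) \<le> (2 * c) ^ k / fact k"
          by (simp add: norm_mult norm_power power_mult_distrib mult.commute)
      qed
    qed
    then show "\<forall>\<^sub>F (k, n) in sequentially \<times>\<^sub>F sequentially. norm (?a k n) \<le> (2 * c) ^ k / fact k"
      unfolding eventually_prod_filter
      by (intro exI[of _ "\<lambda>_. True"] exI[of _ "\<lambda>n. \<forall>k. norm (?a k n) \<le> (2 * c) ^ k / fact k"]) auto
  qed simp
  also have "(\<Sum>k. complex_of_real (l ^ k / fact k) * ?w ^ k) = char (poisson_law l) \<theta>"
    unfolding char_poisson_law[OF l] by (rule sums_unique[symmetric, OF exp_weight_sums])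
  finally have *: "(\<lambda>n. \<Sum>k. ?a k n) \<longlonglongrightarrow> char (poisson_law l) \<theta>" .
  show "(\<lambda>n. char (distr M borel (\<lambda>\<omega>. real (X n \<omega>))) \<theta>) \<longlonglongrightarrow> char (poisson_law l) \<theta>"
  proof (rule Lim_transform_eventually[OF *])
    show "\<forall>\<^sub>F n in sequentially. (\<Sum>k. ?a k n) = char (distr M borel (\<lambda>\<omega>. real (X n \<omega>))) \<theta>"
      using bound
    proof eventually_elim
      case (elim n)
      show ?case by (rule char_binomial_moments[symmetric, OF M X c]) (use elim in blast)
    qed
  qed
qed

section \<open>Moments of the particle count\<close>

text \<open>The process itself supplies the solution started from its initial configuration: the
  occupation probabilities satisfy the case \<open>k = 1\<close> of the equations for the
  marginals.\<close>

lemma ssep_heat: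
  fixes \<eta> :: "real \<Rightarrow> 'w \<Rightarrow> 'd::finite config"
  assumes "ssep M \<eta> \<eta>0"
  obtains u where "heat u" "\<And>x. u 0 x = of_bool (\<eta>0 x)"
proof -
  obtain P :: "real \<Rightarrow> 'd config \<Rightarrow> 'd config measure" where P: "sep_transition P"
    using assms unfolding ssep_def by blast
  define u where "u s x = (\<integral>\<xi>. occf {x} \<xi> \<partial>P s \<eta>0)" for s x
  have k: "{x} \<in> ksets 1" for x :: "int ^ 'd" by (simp add: ksets_def)
  have "heat u"
    unfolding heat_def
  proof (intro allI impI conjI)
    fix s :: real and x :: "int ^ 'd" assume s: "0 \<le> s"
    show "0 \<le> u s x" "u s x \<le> 1" unfolding u_def using sep_transition_deriv(2,3)[OF P s k] by auto
    show "((\<lambda>s. u s x) has_real_derivative (\<Sum>y\<in>neighbours x. u s y) / (2 * real CARD('d)) - u s x) (at s within {0..})"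
      using sep_transition_deriv(1)[OF P s k, of \<eta>0 x] by (simp add: u_def hopsum_def)
  qed
  moreover have "u 0 x = of_bool (\<eta>0 x)" for x
    using P occf_measurable[of "{x}"] by (simp add: u_def sep_transition_def integral_return) (simp add: occf_def)
  ultimately show ?thesis using that by blast
qed

lemma ssep_measurable_occ:
  assumes S: "ssep M \<eta> \<eta>0" and t: "0 \<le> t" and B: "finite B"
  shows "{\<omega> \<in> space M. B \<subseteq> {x. \<eta> t \<omega> x}} \<in> sets M"
proof -
  have "\<eta> t \<in> M \<rightarrow>\<^sub>M borel" using S t by (simp add: ssep_def)
  then have "(\<lambda>\<omega>. occf B (\<eta> t \<omega>)) \<in> borel_measurable M"
    using occf_measurable[OF B] by (rule measurable_compose)
  then have "{\<omega> \<in> space M. occf B (\<eta> t \<omega>) = 1} \<in> sets M" by measurable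
  moreover have "{\<omega> \<in> space M. B \<subseteq> {x. \<eta> t \<omega> x}} = {\<omega> \<in> space M. occf B (\<eta> t \<omega>) = 1}"
    by (auto simp: occf_def)
  ultimately show ?thesis by simp
qed

lemma measurable_nn_count_space:
  fixes f :: "'b \<Rightarrow> 'w \<Rightarrow> ennreal"
  assumes "countable A" "\<And>x. x \<in> A \<Longrightarrow> f x \<in> borel_measurable M"
  shows "(\<lambda>\<omega>. \<integral>\<^sup>+x. f x \<omega> \<partial>count_space A) \<in> borel_measurable M"
proof -
  interpret sigma_finite_measure "count_space A"
    using assms(1) by (rule sigma_finite_measure_count_space_countable)
  have "(\<lambda>p. f (snd p) (fst p)) \<in> borel_measurable (M \<Otimes>\<^sub>M count_space A)"
    by (rule measurable_compose_countable'[where f = "\<lambda>x p. f x (fst p)" and g = snd and I = A])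
       (use assms in \<open>auto intro: measurable_compose[OF measurable_fst]\<close>)
  then show ?thesis
    by (intro borel_measurable_nn_integral) (simp add: case_prod_beta)
qed

definition beyond :: "'d::finite \<Rightarrow> real \<Rightarrow> (int ^ 'd) set" where
  "beyond e z = {x. z < real_of_int (x $ e)}"

lemma particles_beyond_eq:
  "particles_beyond e z \<xi> = (\<integral>\<^sup>+B. occ (beyond e z) B * of_bool (B \<subseteq> {x. \<xi> x}) \<partial>count_space (ksets 1))"
  "enn2real (particles_beyond e z \<xi>) = real (card {x \<in> beyond e z. \<xi> x})"
  "particles_beyond e z \<xi> \<noteq> \<infinity> \<Longrightarrow> finite {x \<in> beyond e z. \<xi> x}"
proof -
  let ?S = "{x \<in> beyond e z. \<xi> x}"
  have "particles_beyond e z \<xi> = (\<Sum>\<^sub>\<infinity>x\<in>?S. 1)"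
    unfolding particles_beyond_def beyond_def by (rule infsum_cong_neutral) auto
  moreover have "(\<Sum>\<^sub>\<infinity>x\<in>?S. 1::ennreal) = \<infinity>" if "infinite ?S"
    by (rule infsum_superconst_infinite_ennreal[where b = 1]) (use that in auto)
  ultimately have e: "particles_beyond e z \<xi> = (if finite ?S then of_nat (card ?S) else \<infinity>)"
    by simp
  have "(\<integral>\<^sup>+B. occ (beyond e z) B * of_bool (B \<subseteq> {x. \<xi> x}) \<partial>count_space (ksets 1))
      = (\<integral>\<^sup>+x. of_bool (x \<in> ?S) * 1 \<partial>count_space UNIV)"
    unfolding nn_ksets_1 by (intro nn_integral_cong) (auto simp: occ_def)
  also have "\<dots> = emeasure (count_space UNIV) ?S"
    unfolding nn_restrict by (simp add: nn_integral_const emeasure_count_space)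
  also have "\<dots> = particles_beyond e z \<xi>"
    unfolding e by (simp add: emeasure_count_space)
  finally show "particles_beyond e z \<xi> = (\<integral>\<^sup>+B. occ (beyond e z) B * of_bool (B \<subseteq> {x. \<xi> x}) \<partial>count_space (ksets 1))" ..
  show "enn2real (particles_beyond e z \<xi>) = real (card ?S)" unfolding e
      by (auto simp: ennreal_of_nat_eq_real_of_nat)
  show "particles_beyond e z \<xi> \<noteq> \<infinity> \<Longrightarrow> finite ?S" unfolding e by (auto split: if_splits)
qed

text \<open>Finiteness matters for \<open>k \<ge> 1\<close>: on an infinite set \<open>card\<close>
  is 0, while the number of \<open>k\<close>-subsets is infinite.\<close>

lemma count_subsets:
  assumes "finite {x \<in> A. \<xi> x}"
  shows "(of_nat (card {x \<in> A. \<xi> x} choose k) :: ennreal)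
      = (\<integral>\<^sup>+B. occ A B * of_bool (B \<subseteq> {x. \<xi> x}) \<partial>count_space (ksets k))"
proof -
  let ?S = "{x \<in> A. \<xi> x}"
  have "(\<integral>\<^sup>+B. occ A B * of_bool (B \<subseteq> {x. \<xi> x}) \<partial>count_space (ksets k))
      = (\<integral>\<^sup>+B. of_bool (B \<subseteq> ?S) * 1 \<partial>count_space (ksets k))"
    by (intro nn_integral_cong) (auto simp: occ_def)
  also have "\<dots> = emeasure (count_space {B \<in> ksets k. B \<subseteq> ?S}) {B \<in> ksets k. B \<subseteq> ?S}"
    unfolding nn_restrict by (simp add: nn_integral_const)
  also have "{B \<in> ksets k. B \<subseteq> ?S} = {B. B \<subseteq> ?S \<and> card B = k}"
    using assms by (auto simp: ksets_def intro: finite_subset)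
  also have "emeasure (count_space {B. B \<subseteq> ?S \<and> card B = k}) {B. B \<subseteq> ?S \<and> card B = k}
      = of_nat (card {B. B \<subseteq> ?S \<and> card B = k})"
    using assms by (intro emeasure_count_space_finite) (auto intro: finite_subset[OF _ finite_Pow_iff[THEN iffD2, OF assms]])
  finally show ?thesis using n_subsets[OF assms, of k] by simp
qed

text \<open>Tonelli over the countably many \<open>k\<close>-sets, with \<open>ssep_emeasure\<close>
  for each of them. A finite mean makes the count almost surely finite, so that \<open>card\<close>
  is the true number of particles.\<close>

lemma
  fixes \<eta> :: "real \<Rightarrow> 'w \<Rightarrow> 'd::finite config"
  assumes S: "ssep M \<eta> \<eta>0" and t: "0 \<le> t"
  shows particles_beyond_measurable: "(\<lambda>\<omega>. particles_beyond e z (\<eta> t \<omega>)) \<in> borel_measurable M"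
    and nn_integral_particles_beyond: "(\<integral>\<^sup>+\<omega>. particles_beyond e z (\<eta> t \<omega>) \<partial>M)
      = sep_moment 1 t {x. \<eta>0 x} (beyond e z)"
    and ssep_binomial_moment: "(\<integral>\<^sup>+\<omega>. particles_beyond e z (\<eta> t \<omega>) \<partial>M) \<noteq> \<infinity> \<Longrightarrow>
      (\<integral>\<^sup>+\<omega>. of_nat (card {x \<in> beyond e z. \<eta> t \<omega> x} choose k) \<partial>M)
      = sep_moment k t {x. \<eta>0 x} (beyond e z)"
proof -
  let ?F = "\<lambda>B \<omega>. occ (beyond e z) B * of_bool (B \<subseteq> {x. \<eta> t \<omega> x})"
  have F_meas: "?F B \<in> borel_measurable M" if "B \<in> ksets k" for B k
  proof -
    have *: "{\<omega> \<in> space M. B \<subseteq> {x. \<eta> t \<omega> x}} \<in> sets M"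
      using that by (intro ssep_measurable_occ[OF S t]) (simp add: ksets_def)
    have "(\<lambda>\<omega>. occ (beyond e z) B * indicator {\<omega> \<in> space M. B \<subseteq> {x. \<eta> t \<omega> x}} \<omega>) \<in> borel_measurable M"
      using * by measurable
    then show ?thesis
      by (rule measurable_cong[THEN iffD1, rotated]) (auto split: split_indicator)
  qed
  have F_int: "(\<integral>\<^sup>+\<omega>. ?F B \<omega> \<partial>M) = occ (beyond e z) B * sg k t (occ {x. \<eta>0 x}) B" if "B \<in> ksets k" for B k
  proof -
    have *: "{\<omega> \<in> space M. B \<subseteq> {x. \<eta> t \<omega> x}} \<in> sets M"
      using that by (intro ssep_measurable_occ[OF S t]) (simp add: ksets_def)
    have "(\<integral>\<^sup>+\<omega>. ?F B \<omega> \<partial>M) = (\<integral>\<^sup>+\<omega>. occ (beyond e z) B * indicator {\<omega> \<in> space M. B \<subseteq> {x. \<eta> t \<omega> x}} \<omega> \<partial>M)"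
      by (intro nn_integral_cong) (auto split: split_indicator)
    then show ?thesis using * by (simp add: nn_integral_cmult_indicator ssep_emeasure[OF S t that])
  qed
  have swap: "(\<integral>\<^sup>+\<omega>. \<integral>\<^sup>+B. ?F B \<omega> \<partial>count_space (ksets k) \<partial>M) = sep_moment k t {x. \<eta>0 x} (beyond e z)" for k
  proof -
    have "(\<integral>\<^sup>+\<omega>. \<integral>\<^sup>+B. ?F B \<omega> \<partial>count_space (ksets k) \<partial>M) = (\<integral>\<^sup>+B. \<integral>\<^sup>+\<omega>. ?F B \<omega> \<partial>M \<partial>count_space (ksets k))"
      by (rule nn_integral_count_space_nn_integral) (use F_meas in auto)
    then show ?thesis unfolding sep_moment_def using F_int by (simp cong: nn_integral_cong_simp)
  qed
  show meas: "(\<lambda>\<omega>. particles_beyond e z (\<eta> t \<omega>)) \<in> borel_measurable M"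
    unfolding particles_beyond_eq(1) by (intro measurable_nn_count_space F_meas) auto
  show "(\<integral>\<^sup>+\<omega>. particles_beyond e z (\<eta> t \<omega>) \<partial>M)
      = sep_moment 1 t {x. \<eta>0 x} (beyond e z)"
    unfolding particles_beyond_eq(1) by (rule swap)
  assume "(\<integral>\<^sup>+\<omega>. particles_beyond e z (\<eta> t \<omega>) \<partial>M) \<noteq> \<infinity>"
  then have "AE \<omega> in M. particles_beyond e z (\<eta> t \<omega>) \<noteq> \<infinity>"
    by (rule nn_integral_PInf_AE[OF meas])
  then have "AE \<omega> in M. of_nat (card {x \<in> beyond e z. \<eta> t \<omega> x} choose k)
      = (\<integral>\<^sup>+B. ?F B \<omega> \<partial>count_space (ksets k))"
    by eventually_elim (intro count_subsets particles_beyond_eq(3))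
  then have "(\<integral>\<^sup>+\<omega>. of_nat (card {x \<in> beyond e z. \<eta> t \<omega> x} choose k) \<partial>M)
      = (\<integral>\<^sup>+\<omega>. \<integral>\<^sup>+B. ?F B \<omega> \<partial>count_space (ksets k) \<partial>M)"
    by (rule nn_integral_cong_AE)
  then show "(\<integral>\<^sup>+\<omega>. of_nat (card {x \<in> beyond e z. \<eta> t \<omega> x} choose k) \<partial>M)
      = sep_moment k t {x. \<eta>0 x} (beyond e z)"
    unfolding swap .
qed

lemma tendsto_squeeze_ennreal:
  fixes a b x y :: "'a \<Rightarrow> ennreal"
  assumes "(a \<longlongrightarrow> L) F" "(b \<longlongrightarrow> L) F" "(y \<longlongrightarrow> 0) F" "L \<noteq> top"
    and "\<forall>\<^sub>F t in F. a t \<le> x t + y t" "\<forall>\<^sub>F t in F. x t \<le> b t"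
  shows "(x \<longlongrightarrow> L) F"
proof (rule tendsto_sandwich[of "\<lambda>t. a t - y t" x F b])
  show "((\<lambda>t. a t - y t) \<longlongrightarrow> L) F"
    using tendsto_diff_ennreal[OF assms(1,3,4)] by simp
  show "\<forall>\<^sub>F t in F. a t - y t \<le> x t"
  proof -
    have "\<forall>\<^sub>F t in F. a t < top"
      by (rule order_tendstoD(2)[OF assms(1)]) (use assms(4) in \<open>simp add: less_top\<close>)
    then show ?thesis
      using assms(5) by eventually_elim (auto simp: ennreal_minus_le_iff add.commute)
  qed
qed (use assms in auto)

text \<open>Induction along the recursion squeezed between \<open>esym_Suc_le\<close> and
  \<open>esym_Suc_ge\<close>. It is the Poisson limit theorem for independent indicators with
  vanishing maximal weight, on the level of moments.\<close>

lemma esym_tendsto: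
  fixes v :: "real \<Rightarrow> int ^ 'd::finite \<Rightarrow> ennreal"
  assumes m: "((\<lambda>t. \<integral>\<^sup>+x. v t x \<partial>count_space UNIV) \<longlongrightarrow> ennreal l) F" and l: "0 \<le> l"
    and \<delta>: "(\<delta> \<longlongrightarrow> 0) F" and le: "\<forall>\<^sub>F t in F. \<forall>x. v t x \<le> \<delta> t"
  shows "((\<lambda>t. esym (v t) k) \<longlongrightarrow> ennreal (l ^ k / fact k)) F"
proof (induction k)
  case (Suc k)
  let ?m = "\<lambda>t. \<integral>\<^sup>+x. v t x \<partial>count_space UNIV"
  have me: "((\<lambda>t. ?m t * esym (v t) k) \<longlongrightarrow> ennreal l * ennreal (l ^ k / fact k)) F"
    by (rule tendsto_mult_ennreal[OF m Suc]) auto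
  have "((\<lambda>t. of_nat (Suc k) * esym (v t) (Suc k)) \<longlongrightarrow> ennreal l * ennreal (l ^ k / fact k)) F"
  proof (rule tendsto_squeeze_ennreal[OF me me])
    have "((\<lambda>t. of_nat k * (\<delta> t * esym (v t) k)) \<longlongrightarrow> of_nat k * (0 * ennreal (l ^ k / fact k))) F"
      by (intro ennreal_tendsto_cmult tendsto_mult_ennreal \<delta> Suc) (auto simp: of_nat_less_top)
    then show "((\<lambda>t. of_nat k * \<delta> t * esym (v t) k) \<longlongrightarrow> 0) F" by (simp add: mult.assoc)
    show "\<forall>\<^sub>F t in F. ?m t * esym (v t) k
        \<le> of_nat (Suc k) * esym (v t) (Suc k) + of_nat k * \<delta> t * esym (v t) k"
      using le by eventually_elim (blast intro: esym_Suc_ge)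
    show "ennreal l * ennreal (l ^ k / fact k) \<noteq> top" by (simp add: ennreal_mult_eq_top_iff)
  qed (intro always_eventually allI esym_Suc_le)
  then have "((\<lambda>t. ennreal (1 / real (Suc k)) * (of_nat (Suc k) * esym (v t) (Suc k)))
     \<longlongrightarrow> ennreal (1 / real (Suc k)) * (ennreal l * ennreal (l ^ k / fact k))) F"
    by (intro ennreal_tendsto_cmult) auto
  moreover have "ennreal (1 / real (Suc k)) * (of_nat (Suc k) * x) = x" for x
    unfolding mult.assoc[symmetric] ennreal_of_nat_eq_real_of_nat by (subst ennreal_mult[symmetric]) auto
  moreover have "ennreal (1 / real (Suc k)) * (ennreal l * ennreal (l ^ k / fact k))
      = ennreal (l ^ Suc k / fact (Suc k))"
    using l by (simp add: ennreal_mult[symmetric] del: of_nat_Suc)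
  ultimately show ?case by simp
qed simp

lemma weak_conv_m_eventually_eq:
  assumes "weak_conv_m X \<mu>" "\<forall>\<^sub>F n in sequentially. X n = Y n"
  shows "weak_conv_m Y \<mu>"
  unfolding weak_conv_m_def weak_conv_def
proof (intro allI impI)
  fix x assume "isCont (cdf \<mu>) x"
  then have "(\<lambda>n. cdf (X n) x) \<longlonglongrightarrow> cdf \<mu> x"
    using assms(1) by (simp add: weak_conv_m_def weak_conv_def)
  then show "(\<lambda>n. cdf (Y n) x) \<longlonglongrightarrow> cdf \<mu> x"
    by (rule Lim_transform_eventually) (use assms(2) in eventually_elim, simp)
qed

text \<open>Symmetry for one particle lets the walk start in the profile and end in the half space,
  where the solution of the heat equation is explicit.\<close>

lemma expected_particles_beyond:
  fixes \<eta> :: "real \<Rightarrow> 'w \<Rightarrow> 'd::finite config"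
  assumes S: "ssep M \<eta> (profile e g)" and t: "0 \<le> t"
  shows "(\<integral>\<^sup>+\<omega>. particles_beyond e z (\<eta> t \<omega>) \<partial>M)
    = (\<integral>\<^sup>+x. of_bool (x \<in> {x. profile e g x}) * ennreal (ctp (t / real CARD('d)) (x $ e) {k. z < real_of_int k}) \<partial>count_space UNIV)"
proof -
  let ?q = "\<lambda>t x. ctp (t / real CARD('d)) (x $ e) {k. z < real_of_int k}"
  have q: "ennreal (?q t x) = sg 1 t (occ (beyond e z)) {x}" for x
    unfolding heat_eq_sg[OF heat_coordinate t]
    by (intro sg_cong) (auto simp: ksets_def beyond_def prod_of_bool_occ[of _ "beyond e z", unfolded beyond_def, simplified])
  have "(\<integral>\<^sup>+\<omega>. particles_beyond e z (\<eta> t \<omega>) \<partial>M)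
    = sep_moment 1 t {x. profile e g x} (beyond e z)"
    by (rule nn_integral_particles_beyond[OF S t])
  also have "\<dots> = (\<integral>\<^sup>+B. occ {x. profile e g x} B * sg 1 t (occ (beyond e z)) B \<partial>count_space (ksets 1))"
    unfolding sep_moment_def by (rule sg_sym)
  also have "\<dots> = (\<integral>\<^sup>+x. of_bool (x \<in> {x. profile e g x}) * ennreal (?q t x) \<partial>count_space UNIV)"
    unfolding nn_ksets_1 q by (simp add: occ_def)
  finally show ?thesis .
qed

section \<open>Admissible profiles\<close>

locale admissible_profile =
  fixes e :: "'d::finite" and g :: "'d \<Rightarrow> real \<Rightarrow> real"
  assumes g_nn: "i \<noteq> e \<Longrightarrow> 0 \<le> u \<Longrightarrow> 0 \<le> g i u"
    and gA: "i \<noteq> e \<Longrightarrow> condA (g i)" and gC: "i \<noteq> e \<Longrightarrow> condC (g i)"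
begin

lemma row_card:
  shows "finite (row e g j)" "real (card (row e g j)) = row_size e g j"
proof -
  define S where "S i = (if i = e then {- int j} else {- \<lfloor>g i (real j)\<rfloor> .. \<lfloor>g i (real j)\<rfloor>})" for i
  have eq: "row e g j = {x. \<forall>i. x $ i \<in> S i}"
  proof -
    have "(real_of_int \<bar>a\<bar> \<le> b) \<longleftrightarrow> (- \<lfloor>b\<rfloor> \<le> a \<and> a \<le> \<lfloor>b\<rfloor>)" for a b
      unfolding le_floor_iff[symmetric] abs_le_iff by auto
    then show ?thesis
      by (auto simp: row_def profile_def S_def)
  qed
  have fin: "finite (S i)" for i by (simp add: S_def)
  show "finite (row e g j)" unfolding eq by (rule card_vec_box[OF fin])
  have "card (row e g j) = (\<Prod>i\<in>UNIV. card (S i))"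
    unfolding eq by (rule card_vec_box[OF fin])
  also have "\<dots> = (\<Prod>i\<in>UNIV - {e}. card (S i))"
    by (subst prod.remove[of _ e]) (auto simp: S_def)
  finally have "real (card (row e g j)) = (\<Prod>i\<in>UNIV - {e}. real (card (S i)))" by simp
  also have "\<dots> = row_size e g j"
    unfolding row_size_def
  proof (rule prod.cong[OF refl])
    fix i assume "i \<in> UNIV - {e}"
    then have "0 \<le> \<lfloor>g i (real j)\<rfloor>" "i \<noteq> e" using g_nn by auto
    then show "real (card (S i)) = 2 * real_of_int \<lfloor>g i (real j)\<rfloor> + 1" by (simp add: S_def)
  qed
  finally show "real (card (row e g j)) = row_size e g j" .
qed

lemma row_size_ge_1: "1 \<le> row_size e g j"
  unfolding row_size_def using g_nn by (intro prod_ge_1) auto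

lemma row_size_le_cross_section: "row_size e g j \<le> cross_section e g (real j)"
  unfolding row_size_def cross_section_def using g_nn by (intro prod_mono) auto

text \<open>Rounding down costs at most a factor 3 per transverse coordinate, as
  \<open>2 * (f + 1) + 1 \<le> 3 * (2 * f + 1)\<close> for \<open>f \<ge> 0\<close>.\<close>

lemma cross_section_le_row_size: "cross_section e g (real j) \<le> 3 ^ (CARD('d) - 1) * row_size e g j"
proof -
  have "cross_section e g (real j) \<le> (\<Prod>i\<in>UNIV - {e}. 3 * (2 * real_of_int \<lfloor>g i (real j)\<rfloor> + 1))"
    unfolding cross_section_def
  proof (intro prod_mono conjI)
    fix i assume i: "i \<in> UNIV - {e}"
    have 0: "0 \<le> g i (real j)" using g_nn i by simp
    then show "0 \<le> 2 * g i (real j) + 1" by simp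
    have "g i (real j) \<le> real_of_int \<lfloor>g i (real j)\<rfloor> + 1" by linarith
    moreover have "0 \<le> real_of_int \<lfloor>g i (real j)\<rfloor>" using 0 by simp
    moreover have "2 * a + 1 \<le> 3 * (2 * f + 1)" if "a \<le> f + 1" "0 \<le> f" for a f :: real
      using that by (smt (verit))
    ultimately show "2 * g i (real j) + 1 \<le> 3 * (2 * real_of_int \<lfloor>g i (real j)\<rfloor> + 1)" by blast
  qed
  also have "\<dots> = 3 ^ (CARD('d) - 1) * row_size e g j"
    unfolding row_size_def prod.distrib by (simp add: card_Diff_subset)
  finally show ?thesis .
qed

lemma sum_profile_rows:
  fixes F :: "int \<Rightarrow> ennreal"
  shows "(\<integral>\<^sup>+w. of_bool (w \<in> {x. profile e g x}) * F (w $ e) \<partial>count_space UNIV)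
      = (\<Sum>j. ennreal (row_size e g j) * F (- int j))"
proof -
  have "(\<integral>\<^sup>+w. of_bool (w \<in> {x. profile e g x}) * F (w $ e) \<partial>count_space UNIV)
     = (\<integral>\<^sup>+w. (\<Sum>j. of_bool (w \<in> row e g j) * F (- int j)) \<partial>count_space UNIV)"
  proof (rule nn_integral_cong)
    fix w :: "int ^ 'd"
    show "of_bool (w \<in> {x. profile e g x}) * F (w $ e) = (\<Sum>j. of_bool (w \<in> row e g j) * F (- int j))"
    proof (cases "profile e g w")
      case True
      then have le: "w $ e \<le> 0" by (simp add: profile_def)
      have "(\<Sum>j. of_bool (w \<in> row e g j) * F (- int j))
          = (\<Sum>j\<in>{nat (- (w $ e))}. of_bool (w \<in> row e g j) * F (- int j))"
        by (rule suminf_finite) (auto simp: row_def)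
      also have "\<dots> = F (w $ e)" using True le by (simp add: row_def)
      finally show ?thesis using True by simp
    qed (simp add: row_def)
  qed
  also have "\<dots> = (\<Sum>j. \<integral>\<^sup>+w. of_bool (w \<in> row e g j) * F (- int j) \<partial>count_space UNIV)"
    by (rule nn_integral_suminf) simp
  also have "\<dots> = (\<Sum>j. ennreal (row_size e g j) * F (- int j))"
  proof (rule suminf_cong)
    fix j
    have "(\<integral>\<^sup>+w. of_bool (w \<in> row e g j) * F (- int j) \<partial>count_space UNIV) = (\<Sum>w\<in>row e g j. F (- int j))"
      by (rule nn_sum_finite[symmetric]) (use row_card(1) in auto)
    then show "(\<integral>\<^sup>+w. of_bool (w \<in> row e g j) * F (- int j) \<partial>count_space UNIV)
        = ennreal (row_size e g j) * F (- int j)"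
      by (simp add: row_card(2)[symmetric] ennreal_of_nat_eq_real_of_nat)
  qed
  finally show ?thesis .
qed

text \<open>By translation the walk from \<open>- j\<close> is the walk from 0 shifted by
  \<open>- j\<close>, so that one expectation serves all rows.\<close>

lemma sum_profile_ctp:
  assumes s: "0 \<le> s"
  shows "(\<integral>\<^sup>+w. of_bool (w \<in> {x. profile e g x}) * ennreal (ctp s (w $ e) A) \<partial>count_space UNIV)
    = (\<integral>\<^sup>+k. (\<Sum>j. ennreal (row_size e g j) * of_bool (k - int j \<in> A)) \<partial>measure_pmf (ctrw_pmf 0 s))"
proof -
  have "ennreal (ctp s (- int j) A) = (\<integral>\<^sup>+k. of_bool (k - int j \<in> A) \<partial>measure_pmf (ctrw_pmf 0 s))" for j
  proof -
    have "ennreal (ctp s (- int j) A) = emeasure (measure_pmf (ctrw_pmf 0 s)) {k. k - int j \<in> A}"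
      using ctp_shift[OF s, of 0 "- int j" A] by (simp add: ctp_def measure_pmf.emeasure_eq_measure)
    also have "\<dots> = (\<integral>\<^sup>+k. indicator {k. k - int j \<in> A} k \<partial>measure_pmf (ctrw_pmf 0 s))" by simp
    also have "\<dots> = (\<integral>\<^sup>+k. of_bool (k - int j \<in> A) \<partial>measure_pmf (ctrw_pmf 0 s))"
      by (intro nn_integral_cong) (auto split: split_indicator)
    finally show ?thesis .
  qed
  then show ?thesis
    using sum_profile_rows[of "\<lambda>k. ennreal (ctp s k A)"] by (simp add: nn_integral_suminf nn_integral_cmult)
qed

lemma layer_eq:
  assumes t: "0 \<le> t"
  shows "layer {x. profile e g x} e t Z
    = (\<integral>\<^sup>+k. of_bool (Z \<le> k) * ennreal (row_size e g (nat (k - Z))) \<partial>measure_pmf (ctrw_pmf 0 (t / real CARD('d))))"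
proof -
  have "(\<Sum>j. ennreal (row_size e g j) * of_bool (k - int j \<in> {Z})) = of_bool (Z
      \<le> k) * ennreal (row_size e g (nat (k - Z)))" for k
  proof (cases "Z \<le> k")
    case True
    have "(\<Sum>j. ennreal (row_size e g j) * of_bool (k - int j \<in> {Z}))
        = (\<Sum>j\<in>{nat (k - Z)}. ennreal (row_size e g j) * of_bool (k - int j \<in> {Z}))"
      by (rule suminf_finite) auto
    then show ?thesis using True by simp
  next
    case False
    have "ennreal (row_size e g j) * of_bool (k - int j \<in> {Z}) = 0" for j using False by auto
    then show ?thesis using False by simp
  qed
  then show ?thesis
    unfolding layer_def using sum_profile_ctp[of "t / real CARD('d)" "{Z}"] t by simp
qed

lemma expected_count_eq:
  assumes t: "0 \<le> t"
  shows "(\<integral>\<^sup>+w. of_bool (w \<in> {x. profile e g x}) * ennreal (ctp (t / real CARD('d)) (w $ e) {k. z < real_of_int k}) \<partial>count_space UNIV)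
    = (\<integral>\<^sup>+k. ennreal (\<Sum>j<nat (k - \<lfloor>z\<rfloor>). row_size e g j) \<partial>measure_pmf (ctrw_pmf 0 (t / real CARD('d))))"
proof -
  have "(\<Sum>j. ennreal (row_size e g j) * of_bool (k - int j \<in> {k. z < real_of_int k}))
      = ennreal (\<Sum>j<nat (k - \<lfloor>z\<rfloor>). row_size e g j)" for k
  proof -
    have iff: "z < real_of_int (k - int j) \<longleftrightarrow> j < nat (k - \<lfloor>z\<rfloor>)" for j
      using floor_less_iff[of z "k - int j"] by linarith
    have "(\<Sum>j. ennreal (row_size e g j) * of_bool (k - int j \<in> {k. z < real_of_int k}))
       = (\<Sum>j<nat (k - \<lfloor>z\<rfloor>). ennreal (row_size e g j) * of_bool (k - int j \<in> {k. z < real_of_int k}))"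
      by (rule suminf_finite) (use iff in auto)
    also have "\<dots> = (\<Sum>j<nat (k - \<lfloor>z\<rfloor>). ennreal (row_size e g j))"
      using iff by (intro sum.cong) auto
    also have "\<dots> = ennreal (\<Sum>j<nat (k - \<lfloor>z\<rfloor>). row_size e g j)"
      using row_size_ge_1 by (intro sum_ennreal) (metis order_trans zero_le_one)
    finally show ?thesis .
  qed
  then show ?thesis using sum_profile_ctp[of "t / real CARD('d)" "{k. z < real_of_int k}"] t by simp
qed

section \<open>Growth of the cross sections\<close>

lemma cross_section_mono: "0 \<le> u \<Longrightarrow> u \<le> v \<Longrightarrow> cross_section e g u \<le> cross_section e g v"
  unfolding cross_section_def
proof (intro prod_mono conjI)
  fix i assume a: "0 \<le> u" "u \<le> v" "i \<in> UNIV - {e}"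
  then show "0 \<le> 2 * g i u + 1" using g_nn[of i u] by simp
  have "g i u \<le> g i v" using gA[of i] a unfolding condA_def by (auto intro: mono_onD)
  then show "2 * g i u + 1 \<le> 2 * g i v + 1" by simp
qed

lemma cross_section_pos: "0 \<le> u \<Longrightarrow> 0 < cross_section e g u"
  unfolding cross_section_def using g_nn by (intro prod_pos) (auto simp: add_nonneg_pos)

lemma cross_section_ratio:
  "(\<lambda>j. cross_section e g (real (Suc j)) / cross_section e g (real j)) \<longlonglongrightarrow> 1"
proof -
  have "((\<lambda>u. \<Prod>i\<in>UNIV - {e}. (2 * g i (u + 1) + 1) / (2 * g i u + 1)) \<longlongrightarrow> (\<Prod>i\<in>UNIV - {e}. 1)) at_top"
    using g_nn gA gC by (intro tendsto_prod condC_ratio) auto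
  then have "((\<lambda>u. cross_section e g (u + 1) / cross_section e g u) \<longlongrightarrow> 1) at_top"
    by (simp add: cross_section_def prod_dividef)
  from filterlim_compose[OF this filterlim_real_sequentially] show ?thesis by (simp add: add.commute)
qed

lemma cross_section_Suc_le:
  obtains C where "1 \<le> C" "\<And>j. cross_section e g (real (Suc j)) \<le> C * cross_section e g (real j)"
proof -
  have "Bseq (\<lambda>j. cross_section e g (real (Suc j)) / cross_section e g (real j))"
    using cross_section_ratio by (intro convergent_imp_Bseq convergentI)
  then obtain K where K: "0 < K" "\<And>j. norm (cross_section e g (real (Suc j)) / cross_section e g (real j))
      \<le> K"
    unfolding Bseq_def by blast
  have "cross_section e g (real (Suc j)) \<le> max 1 K * cross_section e g (real j)" for j
  proof -
    have "cross_section e g (real (Suc j)) / cross_section e g (real j) \<le> max 1 K"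
      using order_trans[OF abs_ge_self K(2)[of j, unfolded real_norm_def]] by (rule order_trans) simp
    then show ?thesis using cross_section_pos[of "real j"] by (simp add: divide_le_eq del: of_nat_Suc)
  qed
  then show ?thesis using that[of "max 1 K"] by auto
qed

text \<open>Beyond some index the increments of the cross section are at most
  \<open>\<epsilon>\<close> times the row size, because consecutive ratios tend to 1; summing them
  telescopes. One row is thus negligible against all earlier rows together. The constant
  \<open>?c\<close> pays for passing from cross sections to row sizes.\<close>

lemma cross_section_le_sum:
  assumes \<epsilon>: "0 < \<epsilon>"
  obtains K where "0 \<le> K" "\<And>m. cross_section e g (real m) \<le> K + \<epsilon> * (\<Sum>i<m. row_size e g i)"
proof -
  let ?c = "3 ^ (CARD('d) - 1) :: real"
  have "\<forall>\<^sub>F j in sequentially. cross_section e g (real (Suc j)) / cross_section e g (real j) < 1 + \<epsilon> / ?c"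
    using \<epsilon> by (intro order_tendstoD[OF cross_section_ratio]) simp
  then obtain j0 where j0: "\<And>j. j0 \<le> j \<Longrightarrow> cross_section e g (real (Suc j)) / cross_section e g (real j) < 1 + \<epsilon> / ?c"
    unfolding eventually_sequentially by blast
  have N0: "0 \<le> row_size e g i" for i using row_size_ge_1[of i] by simp
  have "cross_section e g (real m) \<le> cross_section e g (real j0) + \<epsilon> * (\<Sum>i<m. row_size e g i)" for m
  proof (induction m)
    case 0
    show ?case using cross_section_mono[of 0 "real j0"] by simp
  next
    case (Suc m)
    show ?case
    proof (cases "j0 \<le> m")
      case True
      have "cross_section e g (real (Suc m)) \<le> (1 + \<epsilon> / ?c) * cross_section e g (real m)"
        using j0[OF True] cross_section_pos[of "real m"] by (simp add: divide_less_eq del: of_nat_Suc)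
      also have "\<dots> = cross_section e g (real m) + \<epsilon> / ?c * cross_section e g (real m)"
        by (simp add: algebra_simps)
      also have "\<dots> \<le> cross_section e g (real m) + \<epsilon> / ?c * (?c * row_size e g m)"
        using \<epsilon> cross_section_le_row_size[of m] by (intro add_left_mono mult_left_mono) auto
      also have "\<dots> \<le> cross_section e g (real j0) + \<epsilon> * (\<Sum>i<Suc m. row_size e g i)"
        using Suc by (simp add: algebra_simps)
      finally show ?thesis .
    next
      case False
      then have "cross_section e g (real (Suc m)) \<le> cross_section e g (real j0)"
        by (intro cross_section_mono) auto
      moreover have "0 \<le> \<epsilon> * (\<Sum>i<Suc m. row_size e g i)"
        using \<epsilon> N0 by (intro mult_nonneg_nonneg sum_nonneg) auto
      ultimately show ?thesis by linarith
    qed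
  qed
  then show ?thesis using that[of "cross_section e g (real j0)"] cross_section_pos[of "real j0"] by auto
qed

section \<open>Estimates for the tail of the walk and for the layers\<close>

lemma row_size_nonneg: "0 \<le> row_size e g j"
  using row_size_ge_1[of j] by simp

text \<open>If the walk ends beyond \<open>\<lfloor>z\<rfloor> + n\<close>, at least
  \<open>n\<close> nonempty rows are counted, which Markov's inequality charges to the expected
  count. Otherwise it ends in a window of \<open>n\<close> sites, each of probability at most
  \<open>1 / sqrt (t / d)\<close>.\<close>

lemma walk_tail_le:
  assumes t: "0 < t"
  shows "of_nat n * ennreal (walk_tail (t / real CARD('d)) z)
      \<le> expected_count e g t z + ennreal (real n * real n / sqrt (t / real CARD('d)))"
proof -
  let ?p = "measure_pmf (ctrw_pmf 0 (t / real CARD('d)))" and ?Z = "\<lfloor>z\<rfloor>"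
  have "{k. ?Z < k} = {k. ?Z + int n < k} \<union> {?Z <.. ?Z + int n}" by auto
  then have "ennreal (walk_tail (t / real CARD('d)) z)
      \<le> emeasure ?p {k. ?Z + int n < k} + emeasure ?p {?Z <.. ?Z + int n}"
    unfolding walk_tail_def ctp_def measure_pmf.emeasure_eq_measure[symmetric]
    by (metis emeasure_subadditive sets_measure_pmf UNIV_I sets_UNIV UNIV_I iso_tuple_UNIV_I)
  moreover have "emeasure ?p {?Z <.. ?Z + int n} \<le> ennreal (real n / sqrt (t / real CARD('d)))"
  proof -
    have "measure ?p {?Z <.. ?Z + int n} = (\<Sum>k\<in>{?Z <.. ?Z + int n}. measure ?p {k})"
      by (rule measure_pmf.finite_measure_eq_sum_singleton) auto
    also have "\<dots> \<le> (\<Sum>k\<in>{?Z <.. ?Z + int n}. 1 / sqrt (t / real CARD('d)))"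
      using t by (intro sum_mono) (auto simp: ctp_def[symmetric] intro!: ctp_le)
    also have "\<dots> = real n / sqrt (t / real CARD('d))" by simp
    finally show ?thesis by (simp add: measure_pmf.emeasure_eq_measure ennreal_leI)
  qed
  ultimately have "of_nat n * ennreal (walk_tail (t / real CARD('d)) z)
      \<le> of_nat n * (emeasure ?p {k. ?Z + int n < k} + ennreal (real n / sqrt (t / real CARD('d))))"
    by (intro mult_left_mono) (meson add_left_mono order_trans, simp)
  also have "\<dots> = of_nat n * emeasure ?p {k. ?Z + int n < k} + ennreal (real n * real n / sqrt (t / real CARD('d)))"
    by (simp add: distrib_left ennreal_of_nat_eq_real_of_nat flip: ennreal_mult')
  also have "of_nat n * emeasure ?p {k. ?Z + int n < k} \<le> expected_count e g t z"
  proof -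
    have "of_nat n * emeasure ?p {k. ?Z + int n < k} = (\<integral>\<^sup>+k. of_nat n * indicator {k. ?Z + int n < k} k \<partial>?p)"
      by (simp add: nn_integral_cmult_indicator)
    also have "\<dots> \<le> expected_count e g t z"
      unfolding expected_count_def
    proof (rule nn_integral_mono)
      fix k :: int
      have "of_nat n \<le> ennreal (\<Sum>j<nat (k - ?Z). row_size e g j)" if "?Z + int n < k"
      proof -
        have "real n \<le> (\<Sum>j<nat (k - ?Z). 1)" using that by simp
        also have "\<dots> \<le> (\<Sum>j<nat (k - ?Z). row_size e g j)" by (intro sum_mono row_size_ge_1)
        finally show ?thesis by (simp add: ennreal_of_nat_eq_real_of_nat ennreal_leI)
      qed
      then show "of_nat n * indicator {k. ?Z + int n < k} k \<le> ennreal (\<Sum>j<nat (k - ?Z). row_size e g j)"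
        by (auto split: split_indicator)
    qed
    finally show ?thesis .
  qed
  finally show ?thesis by (simp add: add_right_mono)
qed

lemma layer_next_le:
  assumes \<epsilon>: "0 < \<epsilon>"
  obtains K where "0 \<le> K"
    "\<And>t z. 0 \<le> t \<Longrightarrow> layer {x. profile e g x} e t (\<lfloor>z\<rfloor> + 1)
        \<le> ennreal K * ennreal (walk_tail (t / real CARD('d)) z) + ennreal \<epsilon> * expected_count e g t z"
proof -
  obtain K where K: "0 \<le> K" "\<And>m. cross_section e g (real m) \<le> K + \<epsilon> * (\<Sum>i<m. row_size e g i)"
    using cross_section_le_sum[OF \<epsilon>] by blast
  have "layer {x. profile e g x} e t (\<lfloor>z\<rfloor> + 1)
      \<le> ennreal K * ennreal (walk_tail (t / real CARD('d)) z) + ennreal \<epsilon> * expected_count e g t z"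
    if t: "0 \<le> t" for t z
  proof -
    let ?p = "measure_pmf (ctrw_pmf 0 (t / real CARD('d)))" and ?Z = "\<lfloor>z\<rfloor>"
    have "layer {x. profile e g x} e t (?Z + 1)
       = (\<integral>\<^sup>+k. of_bool (?Z + 1 \<le> k) * ennreal (row_size e g (nat (k - (?Z + 1)))) \<partial>?p)"
      by (rule layer_eq[OF t])
    also have "\<dots> \<le> (\<integral>\<^sup>+k. ennreal K * indicator {k. ?Z < k} k + ennreal \<epsilon> * ennreal (\<Sum>j<nat (k - ?Z). row_size e g j) \<partial>?p)"
    proof (rule nn_integral_mono)
      fix k :: int
      show "of_bool (?Z + 1 \<le> k) * ennreal (row_size e g (nat (k - (?Z + 1))))
        \<le> ennreal K * indicator {k. ?Z < k} k + ennreal \<epsilon> * ennreal (\<Sum>j<nat (k - ?Z). row_size e g j)"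
      proof (cases "?Z < k")
        case True
        let ?m = "nat (k - (?Z + 1))"
        have "row_size e g ?m \<le> cross_section e g (real ?m)"
          by (rule row_size_le_cross_section)
        also have "\<dots> \<le> K + \<epsilon> * (\<Sum>i<?m. row_size e g i)" by (rule K)
        also have "\<dots> \<le> K + \<epsilon> * (\<Sum>i<nat (k - ?Z). row_size e g i)"
          using \<epsilon> row_size_nonneg by (intro add_left_mono mult_left_mono sum_mono2) auto
        finally have "ennreal (row_size e g ?m) \<le> ennreal (K + \<epsilon> * (\<Sum>i<nat (k - ?Z). row_size e g i))"
          by (rule ennreal_leI)
        also have "\<dots> = ennreal K + ennreal \<epsilon> * ennreal (\<Sum>i<nat (k - ?Z). row_size e g i)"
          using K(1) \<epsilon> row_size_nonneg by (simp add: sum_nonneg flip: ennreal_mult)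
        finally show ?thesis using True by simp
      qed simp
    qed
    also have "\<dots> = ennreal K * ennreal (walk_tail (t / real CARD('d)) z) + ennreal \<epsilon> * expected_count e g t z"
      unfolding expected_count_def walk_tail_def ctp_def measure_pmf.emeasure_eq_measure[symmetric]
      by (simp add: nn_integral_add nn_integral_cmult nn_integral_cmult_indicator)
    finally show ?thesis .
  qed
  then show ?thesis using that K(1) by blast
qed

text \<open>Expresses the error through a single layer. Consecutive rows have comparable sizes,
  which treats the endpoints \<open>k > \<lfloor>z\<rfloor>\<close>; the one additional endpoint
  \<open>k = \<lfloor>z\<rfloor>\<close> has probability of order \<open>1 / sqrt t\<close>.\<close>

lemma layer_le_next:
  obtains D where "0 \<le> D"
    "\<And>t (z::real). 0 < t \<Longrightarrow> layer {x. profile e g x} e t \<lfloor>z\<rfloor>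
        \<le> ennreal (D / sqrt t) + ennreal D * layer {x. profile e g x} e t (\<lfloor>z\<rfloor> + 1)"
proof -
  obtain C where C: "1 \<le> C" "\<And>j. cross_section e g (real (Suc j)) \<le> C * cross_section e g (real j)"
    using cross_section_Suc_le by blast
  define C' where "C' = C * 3 ^ (CARD('d) - 1)"
  have C'0: "0 \<le> C'" using C(1) by (simp add: C'_def)
  have N_Suc: "row_size e g (Suc j) \<le> C' * row_size e g j" for j
  proof -
    have "row_size e g (Suc j) \<le> cross_section e g (real (Suc j))" by (rule row_size_le_cross_section)
    also have "\<dots> \<le> C * cross_section e g (real j)" by (rule C)
    also have "\<dots> \<le> C * (3 ^ (CARD('d) - 1) * row_size e g j)"
      using C(1) by (intro mult_left_mono cross_section_le_row_size) auto
    finally show ?thesis by (simp add: C'_def mult.assoc)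
  qed
  define D where "D = max C' (row_size e g 0 * sqrt (real CARD('d)))"
  have D: "C' \<le> D" "row_size e g 0 * sqrt (real CARD('d)) \<le> D" by (auto simp: D_def)
  have "layer {x. profile e g x} e t \<lfloor>z\<rfloor>
      \<le> ennreal (D / sqrt t) + ennreal D * layer {x. profile e g x} e t (\<lfloor>z\<rfloor> + 1)"
    if t: "0 < t" for t and z :: real
  proof -
    let ?p = "measure_pmf (ctrw_pmf 0 (t / real CARD('d)))" and ?Z = "\<lfloor>z\<rfloor>"
    have t0: "0 \<le> t" using t by simp
    have "layer {x. profile e g x} e t ?Z = (\<integral>\<^sup>+k. of_bool (?Z
        \<le> k) * ennreal (row_size e g (nat (k - ?Z))) \<partial>?p)"
      by (rule layer_eq[OF t0])
    also have "\<dots> \<le> (\<integral>\<^sup>+k. ennreal (row_size e g 0) * indicator {?Z} k + ennreal C' * (of_bool (?Z + 1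
        \<le> k) * ennreal (row_size e g (nat (k - (?Z + 1))))) \<partial>?p)"
    proof (rule nn_integral_mono)
      fix k :: int
      show "of_bool (?Z \<le> k) * ennreal (row_size e g (nat (k - ?Z)))
        \<le> ennreal (row_size e g 0) * indicator {?Z} k + ennreal C' * (of_bool (?Z + 1
            \<le> k) * ennreal (row_size e g (nat (k - (?Z + 1)))))"
      proof (cases "?Z + 1 \<le> k")
        case True
        have "nat (k - ?Z) = Suc (nat (k - (?Z + 1)))" using True by linarith
        then have "ennreal (row_size e g (nat (k - ?Z))) \<le> ennreal (C' * row_size e g (nat (k - (?Z + 1))))"
          using N_Suc by (metis ennreal_leI)
        also have "\<dots> = ennreal C' * ennreal (row_size e g (nat (k - (?Z + 1))))"
          using C'0 row_size_nonneg by (simp add: ennreal_mult)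
        finally show ?thesis using True by simp
      next
        case False
        then show ?thesis by (cases "k = ?Z") auto
      qed
    qed
    also have "\<dots> = ennreal (row_size e g 0) * emeasure ?p {?Z} + ennreal C' * layer {x. profile e g x} e t (?Z + 1)"
    proof -
      have L: "layer {x. profile e g x} e t (?Z + 1) = (\<integral>\<^sup>+k. of_bool (?Z + 1
          \<le> k) * ennreal (row_size e g (nat (k - (?Z + 1)))) \<partial>?p)"
        by (rule layer_eq[OF t0])
      show ?thesis unfolding L by (simp add: nn_integral_add nn_integral_cmult nn_integral_cmult_indicator)
    qed
    also have "\<dots> \<le> ennreal (D / sqrt t) + ennreal D * layer {x. profile e g x} e t (?Z + 1)"
    proof (intro add_mono mult_right_mono ennreal_leI D)
      have "ctp (t / real CARD('d)) 0 {?Z} \<le> 1 / sqrt (t / real CARD('d))"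
        using t by (intro ctp_le) simp
      then have "row_size e g 0 * ctp (t / real CARD('d)) 0 {?Z}
          \<le> row_size e g 0 * (1 / sqrt (t / real CARD('d)))"
        by (intro mult_left_mono row_size_nonneg)
      also have "\<dots> \<le> D / sqrt t"
        using D(2) t by (simp add: real_sqrt_divide divide_right_mono)
      finally show "ennreal (row_size e g 0) * emeasure ?p {?Z} \<le> ennreal (D / sqrt t)"
        using row_size_nonneg by (simp add: measure_pmf.emeasure_eq_measure ctp_def ennreal_leI flip: ennreal_mult)
    qed simp
    finally show ?thesis .
  qed
  moreover have "0 \<le> D" using C'0 D(1) by linarith
  ultimately show ?thesis using that by blast
qed

lemma walk_moment_nonneg: "0 \<le> walk_moment e g z t"
  unfolding walk_moment_def
proof (rule integral_nonneg_AE, rule AE_I2)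
  fix k :: int
  show "0 \<le> cross_section e g (real_of_int k - z) * of_bool (z < real_of_int k)"
    using cross_section_pos[of "real_of_int k - z"] by (cases "z < real_of_int k") auto
qed

text \<open>\<open>walk_moment\<close> is a Bochner integral, which would be 0 for a nonintegrable
  function, so integrability comes before the comparison. It follows from the finite expected count,
  which dominates since one row is at most the sum of the rows.\<close>

lemma layer_le_walk_moment:
  assumes t: "0 \<le> t" and fin: "expected_count e g t z < \<infinity>"
  shows "layer {x. profile e g x} e t (\<lfloor>z\<rfloor> + 1) \<le> ennreal (walk_moment e g z t)"
proof -
  let ?p = "measure_pmf (ctrw_pmf 0 (t / real CARD('d)))" and ?Z = "\<lfloor>z\<rfloor>"
  let ?f = "\<lambda>k. cross_section e g (real_of_int k - z) * of_bool (z < real_of_int k)"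
  note mono = cross_section_mono
  have zk: "z < real_of_int k \<longleftrightarrow> ?Z < k" for k using floor_less_iff[of z k] by simp
  have f_nn: "0 \<le> ?f k" for k
    using cross_section_pos[of "real_of_int k - z"] by (cases "z < real_of_int k") auto
  obtain C where C: "1 \<le> C" "\<And>j. cross_section e g (real (Suc j)) \<le> C * cross_section e g (real j)"
    using cross_section_Suc_le by blast
  define C' where "C' = C * 3 ^ (CARD('d) - 1)"
  have C'0: "0 \<le> C'" using C(1) by (simp add: C'_def)
  have up: "?f k \<le> C' * (\<Sum>j<nat (k - ?Z). row_size e g j)" for k
  proof (cases "?Z < k")
    case True
    let ?m = "nat (k - (?Z + 1))"
    have m: "nat (k - ?Z) = Suc ?m" using True by linarith
    have "?f k \<le> cross_section e g (real (Suc ?m))"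
      using True zk[of k] m of_int_floor_le[of z] by (auto intro!: mono)
    also have "\<dots> \<le> C * cross_section e g (real ?m)" by (rule C)
    also have "\<dots> \<le> C * (3 ^ (CARD('d) - 1) * row_size e g ?m)"
      using C(1) by (intro mult_left_mono cross_section_le_row_size) auto
    also have "\<dots> = C' * row_size e g ?m" by (simp add: C'_def)
    also have "\<dots> \<le> C' * (\<Sum>j<nat (k - ?Z). row_size e g j)"
      unfolding m using C'0 row_size_nonneg by (intro mult_left_mono member_le_sum) auto
    finally show ?thesis .
  next
    case False
    then show ?thesis using zk C'0 row_size_nonneg by (auto intro!: mult_nonneg_nonneg sum_nonneg)
  qed
  have "(\<integral>\<^sup>+k. ennreal (?f k) \<partial>?p) \<le> (\<integral>\<^sup>+k. ennreal C' * ennreal (\<Sum>j<nat (k - ?Z). row_size e g j) \<partial>?p)"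
    using up C'0 row_size_nonneg by (intro nn_integral_mono) (auto simp: sum_nonneg intro!: ennreal_leI simp flip: ennreal_mult)
  also have "\<dots> = ennreal C' * expected_count e g t z"
    by (simp add: expected_count_def nn_integral_cmult)
  also have "\<dots> < \<infinity>" using fin by (simp add: ennreal_mult_less_top)
  finally have int: "integrable ?p ?f" using f_nn by (intro integrableI_bounded) auto
  have "layer {x. profile e g x} e t (?Z + 1) = (\<integral>\<^sup>+k. of_bool (?Z + 1
      \<le> k) * ennreal (row_size e g (nat (k - (?Z + 1)))) \<partial>?p)"
    by (rule layer_eq[OF t])
  also have "\<dots> \<le> (\<integral>\<^sup>+k. ennreal (?f k) \<partial>?p)"
  proof (rule nn_integral_mono)
    fix k :: int
    have "row_size e g (nat (k - (?Z + 1))) \<le> cross_section e g (real_of_int k - z)" if "?Z < k"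
    proof -
      have "row_size e g (nat (k - (?Z + 1))) \<le> cross_section e g (real (nat (k - (?Z + 1))))"
        by (rule row_size_le_cross_section)
      \<comment> \<open>By \<open>z \<le> \<lfloor>z\<rfloor> + 1\<close> the argument grows from
        \<open>k - \<lfloor>z\<rfloor> - 1\<close> to \<open>k - z\<close>. For the layer at
        \<open>\<lfloor>z\<rfloor>\<close> the corresponding comparison would go the wrong
        way.\<close>
      also have "\<dots> \<le> cross_section e g (real_of_int k - z)"
      proof (rule mono)
        have "real (nat (k - (?Z + 1))) = real_of_int k - (real_of_int ?Z + 1)"
          using that by simp
        then show "real (nat (k - (?Z + 1))) \<le> real_of_int k - z"
          using real_of_int_floor_add_one_ge[of z] by linarith
      qed simp
      finally show ?thesis .
    qed
    then show "of_bool (?Z + 1 \<le> k) * ennreal (row_size e g (nat (k - (?Z + 1)))) \<le> ennreal (?f k)"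
      using zk[of k] by (cases "?Z < k") (auto intro: ennreal_leI)
  qed
  also have "\<dots> = ennreal (walk_moment e g z t)"
    unfolding walk_moment_def by (rule nn_integral_eq_integral[OF int]) (use f_nn in auto)
  finally show ?thesis .
qed

text \<open>In \<open>walk_tail_le\<close> divided by \<open>n\<close>, first \<open>n\<close> is
  taken so large that \<open>b / n\<close> is small, then \<open>t\<close> so large that the window
  of \<open>n\<close> sites has small probability.\<close>

lemma walk_tail_tendsto_0:
  assumes b: "\<forall>\<^sub>F t in at_top. expected_count e g t (z t) \<le> ennreal b" and b0: "0 \<le> b"
  shows "((\<lambda>t. walk_tail (t / real CARD('d)) (z t)) \<longlongrightarrow> 0) at_top"
proof (rule tendstoI)
  fix \<epsilon> :: real assume \<epsilon>: "0 < \<epsilon>"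
  obtain n :: nat where n: "2 * b / \<epsilon> < real n" "0 < n"
    using reals_Archimedean2[of "max 1 (2 * b / \<epsilon>)"] by auto
  have "((\<lambda>t. real n / sqrt (t / real CARD('d))) \<longlongrightarrow> 0) at_top"
    by (intro tendsto_divide_0[OF tendsto_const] filterlim_at_top_imp_at_infinity filterlim_compose[OF sqrt_at_top]
        filterlim_tendsto_pos_mult_at_top[OF tendsto_const, where c
            = "1 / real CARD('d)", simplified]) (auto intro: filterlim_ident)
  then have "\<forall>\<^sub>F t in at_top. real n / sqrt (t / real CARD('d)) < \<epsilon> / 2"
    using \<epsilon> by (intro order_tendstoD) auto
  then show "\<forall>\<^sub>F t in at_top. dist (walk_tail (t / real CARD('d)) (z t)) 0 < \<epsilon>"
    using b eventually_gt_at_top[of 0]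
  proof eventually_elim
    case (elim t)
    let ?w = "walk_tail (t / real CARD('d)) (z t)" and ?s = "sqrt (t / real CARD('d))"
    have w0: "0 \<le> ?w" by (simp add: walk_tail_def)
    have "ennreal (real n * ?w) \<le> ennreal (b + real n * real n / ?s)"
    proof -
      have "ennreal (real n * ?w) = of_nat n * ennreal ?w"
        using w0 by (simp add: ennreal_mult ennreal_of_nat_eq_real_of_nat)
      also have "\<dots> \<le> expected_count e g t (z t) + ennreal (real n * real n / ?s)"
        by (rule walk_tail_le[OF elim(3)])
      also have "\<dots> \<le> ennreal b + ennreal (real n * real n / ?s)"
        by (intro add_right_mono elim)
      finally show ?thesis using b0 elim by (simp flip: ennreal_plus)
    qed
    then have "real n * ?w \<le> b + real n * real n / ?s"
      using b0 elim by (subst (asm) ennreal_le_iff) auto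
    then have "?w \<le> b / real n + real n / ?s"
      using n by (simp add: field_simps)
    also have "b / real n < \<epsilon> / 2"
      using n \<epsilon> by (simp add: field_simps)
    finally have "?w < \<epsilon>" using elim(1) by linarith
    then show ?case using w0 by simp
  qed
qed

text \<open>The dimension enters only through \<open>I\<close>, a bound for the time integral of the
  transverse factor, and the conditions on the layer only through its bound \<open>\<sigma>\<close>.
  The error is of the order \<open>I * \<sigma>\<^sup>2 + I / t\<close>.\<close>

lemma poisson_limit:
  fixes M :: "'w measure" and \<eta> :: "real \<Rightarrow> 'w \<Rightarrow> 'd config"
  assumes S: "ssep M \<eta> (profile e g)" and l: "0 \<le> l"
    and lim: "((\<lambda>t. expected_count e g t (z t)) \<longlongrightarrow> ennreal l) at_top"
    and I: "\<forall>\<^sub>F t in at_top. 0 \<le> I t \<and> (\<integral>\<^sup>+s. ennreal (transverse_bound CARD('d) s) * indicator {0..t} s \<partial>lborel) \<le> ennreal (I t)"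
    and \<sigma>: "\<forall>\<^sub>F t in at_top. 0 \<le> \<sigma> t \<and> layer {x. profile e g x} e t (\<lfloor>z t\<rfloor> + 1) \<le> ennreal (\<sigma> t)"
    and I\<sigma>: "((\<lambda>t. I t * (\<sigma> t)\<^sup>2) \<longlongrightarrow> 0) at_top" and It: "((\<lambda>t. I t / t) \<longlongrightarrow> 0) at_top"
  shows "count_tends_to_poisson M e z \<eta> l"
proof -
  let ?R = "{x. profile e g x}" and ?d = "real CARD('d)"
  let ?EN = "\<lambda>t. expected_count e g t (z t)"
  have prob: "prob_space M" using S by (simp add: ssep_def)
  obtain u where u: "heat u" and u0: "\<And>x. u 0 x = of_bool (x \<in> ?R)"
    using ssep_heat[OF S] by auto
  define q where "q t s x = ctp (s / ?d) (x $ e) {k. z t < real_of_int k}" for t s and x :: "int ^ 'd"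
  have q: "heat (q t)" for t unfolding q_def by (rule heat_coordinate)
  have q0: "q t 0 x = of_bool (x \<in> beyond e (z t))" for t x by (simp add: q_def beyond_def)
  define v where "v t x = of_bool (x \<in> ?R) * ennreal (q t t x)" for t and x :: "int ^ 'd"
  have vm: "(\<integral>\<^sup>+x. v t x \<partial>count_space UNIV) = ?EN t" if "0 \<le> t" for t
  proof -
    have "(\<integral>\<^sup>+x. v t x \<partial>count_space UNIV)
      = (\<integral>\<^sup>+k. ennreal (\<Sum>j<nat (k - \<lfloor>z t\<rfloor>). row_size e g j) \<partial>measure_pmf (ctrw_pmf 0 (t / ?d)))"
      unfolding v_def q_def by (rule expected_count_eq[OF that])
    moreover have "?EN t = (\<integral>\<^sup>+k. ennreal (\<Sum>j<nat (k - \<lfloor>z t\<rfloor>). row_size e g j) \<partial>measure_pmf (ctrw_pmf 0 (t / ?d)))"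
      by (rule expected_count_def)
    ultimately show ?thesis by simp
  qed
  have EN: "(\<integral>\<^sup>+\<omega>. particles_beyond e (z t) (\<eta> t \<omega>) \<partial>M) = ?EN t" if "0 \<le> t" for t
    unfolding vm[OF that, symmetric] v_def q_def by (rule expected_particles_beyond[OF S that])
  have ENb: "\<forall>\<^sub>F t in at_top. ?EN t \<le> ennreal (l + 1)"
    using order_tendstoD(2)[OF lim, of "ennreal (l + 1)"] l
        by (auto simp: ennreal_less_iff elim: eventually_mono)
  define b where "b k t = sep_moment k t ?R (beyond e (z t))" for k t
  have b_le: "b k t \<le> esym (v t) k" if "0 \<le> t" for k t
    unfolding b_def v_def by (rule binomial_moment_le[OF q u q0 u0 that])
  have vlim: "((\<lambda>t. \<integral>\<^sup>+x. v t x \<partial>count_space UNIV) \<longlongrightarrow> ennreal l) at_top"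
  proof (rule Lim_transform_eventually[OF lim])
    show "\<forall>\<^sub>F t in at_top. ?EN t = (\<integral>\<^sup>+x. v t x \<partial>count_space UNIV)"
      using eventually_ge_at_top[of 0] by eventually_elim (simp add: vm)
  qed
  have esym_lim: "((\<lambda>t. esym (v t) k) \<longlongrightarrow> ennreal (l ^ k / fact k)) at_top" for k
  proof (rule esym_tendsto[OF vlim l])
    show "((\<lambda>t. ennreal (walk_tail (t / ?d) (z t))) \<longlongrightarrow> 0) at_top"
      using tendsto_ennrealI[OF walk_tail_tendsto_0[OF ENb]] l by simp
    show "\<forall>\<^sub>F t in at_top. \<forall>x. v t x \<le> ennreal (walk_tail (t / ?d) (z t))"
      using eventually_ge_at_top[of 0]
    proof (eventually_elim, intro allI)
      fix t :: real and x :: "int ^ 'd" assume t: "0 \<le> t"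
      show "v t x \<le> ennreal (walk_tail (t / ?d) (z t))"
      proof (cases "profile e g x")
        case True
        then have x: "x $ e \<le> 0" by (simp add: profile_def)
        have "q t t x = ctp (t / ?d) 0 {k. z t < real_of_int (k + x $ e)}"
          using ctp_shift[of "t / ?d" 0 "x $ e" "{k. z t < real_of_int k}"] t by (simp add: q_def)
        also have "\<dots> \<le> walk_tail (t / ?d) (z t)"
          unfolding walk_tail_def ctp_def
          by (rule measure_pmf.finite_measure_mono) (use x in \<open>auto simp: floor_less_iff\<close>)
        finally show ?thesis using True by (simp add: v_def ennreal_leI)
      qed (simp add: v_def)
    qed
  qed
  obtain D where D: "0 \<le> D"
    "\<And>t (z::real). 0 < t \<Longrightarrow> layer ?R e t \<lfloor>z\<rfloor> \<le> ennreal (D / sqrt t) + ennreal D * layer ?R e t (\<lfloor>z\<rfloor> + 1)"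
    by (rule layer_le_next) (rule that)
  \<comment> \<open>The leading 2 comes from the orientations of a bond, \<open>D\<close> from
    \<open>layer_le_next\<close>, and \<open>(l + 1) ^ (k - 2)\<close> from the particles off the
    bond, as the expected count is eventually at most \<open>l + 1\<close>.\<close>
  define err where "err k t = 2 * (D * (I t / t + 2 * (I t * (\<sigma> t)\<^sup>2))) * (l + 1) ^ (k - 2)" for k :: nat and t
  have b_ge: "\<forall>\<^sub>F t in at_top. esym (v t) k \<le> b k t + ennreal (err k t)" for k
    using I \<sigma> ENb eventually_gt_at_top[of 0]
  proof eventually_elim
    case (elim t)
    then have t: "0 \<le> t" and tp: "0 < t" and I0: "0 \<le> I t" and \<sigma>0: "0 \<le> \<sigma> t" by auto
    let ?L0 = "layer ?R e t \<lfloor>z t\<rfloor>" and ?L1 = "layer ?R e t (\<lfloor>z t\<rfloor> + 1)"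
    let ?T = "transverse_bound CARD('d)"
    let ?C = "2 * (?L0 * ?L1) * ?EN t ^ (k - 2)"
    have "(\<integral>\<^sup>+s. bond_energy (q t s) (u (t - s))
         * indicator {0..t} s * (\<integral>\<^sup>+x. v t x \<partial>count_space UNIV) ^ (k - 2) \<partial>lborel)
      \<le> (\<integral>\<^sup>+s. ?C * (ennreal (?T (t - s)) * indicator {0..t} s) \<partial>lborel)"
    proof (rule nn_integral_mono)
      fix s :: real
      show "bond_energy (q t s) (u (t - s))
         * indicator {0..t} s * (\<integral>\<^sup>+x. v t x \<partial>count_space UNIV) ^ (k - 2)
        \<le> ?C * (ennreal (?T (t - s)) * indicator {0..t} s)"
      proof (cases "s \<in> {0..t}")
        case True
        then have "bond_energy (q t s) (u (t - s))
          \<le> 2 * (ennreal (?T (t - s)) * ?L0 * ?L1)"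
          using energy_integrand_le[OF u u0, of s "t - s" e "z t"] by (simp add: q_def[abs_def])
        from mult_right_mono[OF this, of "?EN t ^ (k - 2)"] show ?thesis
          using True by (simp add: vm[OF t] mult_ac)
      qed simp
    qed
    also have "\<dots> = ?C * (\<integral>\<^sup>+s. ennreal (?T (t - s)) * indicator {0..t} s \<partial>lborel)"
      by (rule nn_integral_cmult) measurable
    also have "\<dots> = ?C * (\<integral>\<^sup>+s. ennreal (?T s) * indicator {0..t} s \<partial>lborel)"
      by (subst nn_integral_reflect[OF t transverse_bound_measurable]) simp
    also have "\<dots> \<le> (2 * (ennreal (D / sqrt t + D * \<sigma> t) * ennreal (\<sigma> t)) * ennreal (l + 1) ^ (k - 2)) * ennreal (I t)"
    proof -
      have "?L0 \<le> ennreal (D / sqrt t) + ennreal D * ?L1" by (rule D(2)[OF tp])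
      also have "\<dots> \<le> ennreal (D / sqrt t) + ennreal D * ennreal (\<sigma> t)"
        using elim by (intro add_left_mono mult_left_mono) auto
      also have "\<dots> = ennreal (D / sqrt t + D * \<sigma> t)"
        using D(1) \<sigma>0 t by (simp add: ennreal_mult)
      finally have "?L0 \<le> ennreal (D / sqrt t + D * \<sigma> t)" .
      then show ?thesis
        using elim by (intro mult_mono power_mono) auto
    qed
    also have "\<dots> = ennreal (2 * ((D / sqrt t + D * \<sigma> t) * \<sigma> t) * (l + 1) ^ (k - 2) * I t)"
    proof -
      define a where "a = D / sqrt t + D * \<sigma> t"
      define c where "c = (l + 1) ^ (k - 2)"
      have "0 \<le> l + 1" using l by simp
      then have p: "ennreal (l + 1) ^ (k - 2) = ennreal c" unfolding c_def by (rule ennreal_power)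
      have "0 \<le> a" "0 \<le> c" using D(1) \<sigma>0 t l by (auto simp: a_def c_def)
      then show ?thesis unfolding p a_def[symmetric] c_def[symmetric] using \<sigma>0 I0 by (simp add: ennreal_mult)
    qed
    also have "\<dots> \<le> ennreal (err k t)"
    proof (rule ennreal_leI)
      \<comment> \<open>AM-GM removes the cross term, so that only \<open>I t / t\<close> and \<open>I t * (\<sigma> t)\<^sup>2\<close> have to vanish.\<close>
      have "\<sigma> t / sqrt t \<le> 1 / t + (\<sigma> t)\<^sup>2"
      proof -
        have "0 \<le> (1 / sqrt t - \<sigma> t)\<^sup>2" by simp
        also have "\<dots> = 1 / t + (\<sigma> t)\<^sup>2 - 2 * (\<sigma> t / sqrt t)"
          using tp by (simp add: power2_diff power_divide)
        finally have "2 * (\<sigma> t / sqrt t) \<le> 1 / t + (\<sigma> t)\<^sup>2" by simp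
        moreover have "0 \<le> \<sigma> t / sqrt t" using \<sigma>0 t by simp
        ultimately show ?thesis by linarith
      qed
      then have "D * (\<sigma> t / sqrt t + (\<sigma> t)\<^sup>2) * I t \<le> D * (1 / t + 2 * (\<sigma> t)\<^sup>2) * I t"
        using D(1) I0 by (intro mult_right_mono mult_left_mono) auto
      moreover have "((D / sqrt t + D * \<sigma> t) * \<sigma> t) * I t = D * (\<sigma> t / sqrt t + (\<sigma> t)\<^sup>2) * I t"
        by (simp add: algebra_simps power2_eq_square)
      moreover have "D * (1 / t + 2 * (\<sigma> t)\<^sup>2) * I t = D * (I t / t + 2 * (I t * (\<sigma> t)\<^sup>2))"
        by (simp add: algebra_simps)
      ultimately have "((D / sqrt t + D * \<sigma> t) * \<sigma> t) * I t \<le> D * (I t / t + 2 * (I t * (\<sigma> t)\<^sup>2))" by linarith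
      then have "2 * (((D / sqrt t + D * \<sigma> t) * \<sigma> t) * I t) * (l + 1) ^ (k - 2) \<le> err k t"
        unfolding err_def using l by (intro mult_right_mono mult_left_mono) auto
      then show "2 * ((D / sqrt t + D * \<sigma> t) * \<sigma> t) * (l + 1) ^ (k - 2) * I t \<le> err k t"
        by (simp add: mult_ac)
    qed
    finally have "(\<integral>\<^sup>+s. bond_energy (q t s) (u (t - s))
         * indicator {0..t} s * (\<integral>\<^sup>+x. v t x \<partial>count_space UNIV) ^ (k - 2) \<partial>lborel) \<le> ennreal (err k t)" .
    then show ?case
      using binomial_moment_ge[OF q u q0 u0 t, of t k, folded v_def b_def]
          by (meson add_left_mono order_trans)
  qed
  have err0: "((\<lambda>t. ennreal (err k t)) \<longlongrightarrow> 0) at_top" for k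
  proof -
    have "((\<lambda>t. err k t) \<longlongrightarrow> 2 * (D * (0 + 2 * 0)) * (l + 1) ^ (k - 2)) at_top"
      unfolding err_def by (intro tendsto_intros It I\<sigma>)
    then show ?thesis using tendsto_ennrealI by force
  qed
  have b_lim: "(b k \<longlongrightarrow> ennreal (l ^ k / fact k)) at_top" for k
  proof (rule tendsto_squeeze_ennreal[OF esym_lim esym_lim err0 _ b_ge])
    show "\<forall>\<^sub>F t in at_top. b k t \<le> esym (v t) k"
      using eventually_ge_at_top[of 0] by eventually_elim (rule b_le)
  qed simp
  have b_bound: "\<forall>\<^sub>F t in at_top. \<forall>k. b k t \<le> ennreal ((l + 1) ^ k / fact k)"
    using ENb eventually_ge_at_top[of 0]
  proof (eventually_elim, intro allI)
    fix t :: real and k assume t: "?EN t \<le> ennreal (l + 1)" "0 \<le> t"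
    have "fact k * esym (v t) k \<le> ?EN t ^ k"
      using fact_esym_le[of k "v t"] vm[OF t(2)] by simp
    also have "\<dots> \<le> ennreal ((l + 1) ^ k)"
    proof -
      have "0 \<le> l + 1" using l by simp
      then show ?thesis unfolding ennreal_power[OF \<open>0 \<le> l + 1\<close>, symmetric] by (intro power_mono t) simp
    qed
    finally have "ennreal (1 / fact k) * (fact k * esym (v t) k)
        \<le> ennreal (1 / fact k) * ennreal ((l + 1) ^ k)"
      by (rule mult_left_mono) simp
    moreover have "ennreal (1 / fact k) * (fact k * x) = x" for x
    proof -
      have "(fact k :: ennreal) = ennreal (fact k)"
        by (metis ennreal_of_nat_eq_real_of_nat of_nat_fact)
      then show ?thesis
        unfolding mult.assoc[symmetric] by (simp flip: ennreal_mult)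
    qed
    moreover have "ennreal (1 / fact k) * ennreal ((l + 1) ^ k) = ennreal ((l + 1) ^ k / fact k)"
      using l by (simp flip: ennreal_mult)
    ultimately show "b k t \<le> ennreal ((l + 1) ^ k / fact k)"
      using order_trans[OF b_le[OF t(2)]] by simp
  qed
  show ?thesis
    unfolding count_tends_to_poisson_def converges_in_distr_def
  proof (intro allI impI)
    fix s :: "nat \<Rightarrow> real" assume s: "filterlim s at_top sequentially"
    \<comment> \<open>At negative times nothing is known about the process, not even measurability.
      Since \<open>s\<close> tends to infinity, cutting it off at 0 changes finitely many
      terms.\<close>
    define s' where "s' n = max 0 (s n)" for n
    have s'0: "0 \<le> s' n" for n by (simp add: s'_def)
    have "\<forall>\<^sub>F n in sequentially. 0 \<le> s n" using s by (simp add: filterlim_at_top)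
    then have ss': "\<forall>\<^sub>F n in sequentially. s' n = s n" by eventually_elim (simp add: s'_def)
    have s': "filterlim s' at_top sequentially"
      using filterlim_cong[OF refl refl ss'] s by simp
    define X where "X n \<omega> = card {x \<in> beyond e (z (s' n)). \<eta> (s' n) \<omega> x}" for n \<omega>
    have Xr: "enn2real (particles_beyond e (z (s' n)) (\<eta> (s' n) \<omega>)) = real (X n \<omega>)" for n \<omega>
      unfolding X_def by (rule particles_beyond_eq(2))
    have X_meas: "X n \<in> measurable M (count_space UNIV)" for n
    proof (subst measurable_count_space_eq2_countable, intro conjI ballI)
      fix a :: nat
      have "(\<lambda>\<omega>. enn2real (particles_beyond e (z (s' n)) (\<eta> (s' n) \<omega>))) \<in> borel_measurable M"
        by (intro measurable_compose[OF particles_beyond_measurable[OF S s'0]]) simp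
      then have "(\<lambda>\<omega>. real (X n \<omega>)) \<in> borel_measurable M" unfolding Xr .
      then have "(\<lambda>\<omega>. real (X n \<omega>)) -` {real a} \<inter> space M \<in> sets M" by (rule measurable_sets) simp
      moreover have "X n -` {a} \<inter> space M = (\<lambda>\<omega>. real (X n \<omega>)) -` {real a} \<inter> space M" by auto
      ultimately show "X n -` {a} \<inter> space M \<in> sets M" by simp
    qed auto
    have X_b: "\<forall>\<^sub>F n in sequentially. \<forall>k. (\<integral>\<^sup>+\<omega>. of_nat (X n \<omega> choose k) \<partial>M) = b k (s' n)"
    proof -
      have "\<forall>\<^sub>F n in sequentially. ?EN (s' n) \<le> ennreal (l + 1)"
        using ENb s' by (rule eventually_compose_filterlim)
      then show ?thesis
      proof (eventually_elim, intro allI)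
        fix n k assume "?EN (s' n) \<le> ennreal (l + 1)"
        then have "(\<integral>\<^sup>+\<omega>. particles_beyond e (z (s' n)) (\<eta> (s' n) \<omega>) \<partial>M) \<noteq> \<infinity>"
          unfolding EN[OF s'0] infinity_ennreal_def by (rule neq_top_trans[OF ennreal_neq_top])
        then show "(\<integral>\<^sup>+\<omega>. of_nat (X n \<omega> choose k) \<partial>M) = b k (s' n)"
          unfolding X_def b_def by (rule ssep_binomial_moment[OF S s'0])
      qed
    qed
    have "weak_conv_m (\<lambda>n. distr M borel (\<lambda>\<omega>. real (X n \<omega>))) (poisson_law l)"
    proof (rule poisson_convergence[OF prob X_meas l])
      show "0 \<le> l + 1" using l by simp
      show "(\<lambda>n. \<integral>\<^sup>+\<omega>. of_nat (X n \<omega> choose k) \<partial>M) \<longlonglongrightarrow> ennreal (l ^ k / fact k)" for k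
      proof (rule Lim_transform_eventually[OF filterlim_compose[OF b_lim s']])
        show "\<forall>\<^sub>F n in sequentially. b k (s' n) = (\<integral>\<^sup>+\<omega>. of_nat (X n \<omega> choose k) \<partial>M)"
          using X_b by eventually_elim simp
      qed
      have "\<forall>\<^sub>F n in sequentially. \<forall>k. b k (s' n) \<le> ennreal ((l + 1) ^ k / fact k)"
        using b_bound s' by (rule eventually_compose_filterlim)
      then show "\<forall>\<^sub>F n in sequentially. \<forall>k. (\<integral>\<^sup>+\<omega>. of_nat (X n \<omega> choose k) \<partial>M)
          \<le> ennreal ((l + 1) ^ k / fact k)"
        using X_b by eventually_elim auto
    qed
    then show "weak_conv_m (\<lambda>n. distr M borel (\<lambda>\<omega>. enn2real (particles_beyond e (z (s n)) (\<eta> (s n) \<omega>)))) (poisson_law l)"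
    proof (rule weak_conv_m_eventually_eq)
      show "\<forall>\<^sub>F n in sequentially. distr M borel (\<lambda>\<omega>. real (X n \<omega>))
        = distr M borel (\<lambda>\<omega>. enn2real (particles_beyond e (z (s n)) (\<eta> (s n) \<omega>)))"
        using ss' by eventually_elim (simp add: Xr[symmetric])
    qed
  qed
qed

text \<open>This settles \<open>d \<ge> 4\<close>, where \<open>I\<close> is constant: by
  \<open>layer_next_le\<close> the layer is at most a multiple of the vanishing tail plus an
  arbitrarily small fraction of the bounded expected count.\<close>

lemma layer_next_tendsto_0:
  assumes b: "\<forall>\<^sub>F t in at_top. expected_count e g t (z t) \<le> ennreal b" and b0: "0 \<le> b"
  shows "((\<lambda>t. layer {x. profile e g x} e t (\<lfloor>z t\<rfloor> + 1)) \<longlongrightarrow> 0) at_top"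
proof (rule order_tendstoI)
  fix a :: ennreal assume a: "0 < a"
  obtain r where r: "0 < r" "ennreal r \<le> a"
    using a by (cases a) (auto intro: that[of 1] that)
  \<comment> \<open>Gives \<open>\<epsilon> * b < r / 2\<close>; the \<open>+ 1\<close> guards
    against \<open>b = 0\<close>.\<close>
  define \<epsilon> where "\<epsilon> = r / (2 * (b + 1))"
  have \<epsilon>: "0 < \<epsilon>" "\<epsilon> * b < r / 2" using r b0 by (auto simp: \<epsilon>_def field_simps)
  obtain K where K: "0 \<le> K"
    "\<And>t z. 0 \<le> t \<Longrightarrow> layer {x. profile e g x} e t (\<lfloor>z\<rfloor> + 1)
        \<le> ennreal K * ennreal (walk_tail (t / real CARD('d)) z) + ennreal \<epsilon> * expected_count e g t z"
    by (rule layer_next_le[OF \<epsilon>(1)]) (rule that)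
  have "((\<lambda>t. K * walk_tail (t / real CARD('d)) (z t)) \<longlongrightarrow> K * 0) at_top"
    by (intro tendsto_mult_left walk_tail_tendsto_0[OF b b0])
  then have "\<forall>\<^sub>F t in at_top. K * walk_tail (t / real CARD('d)) (z t) < r / 2"
    using r by (intro order_tendstoD) auto
  then show "\<forall>\<^sub>F t in at_top. layer {x. profile e g x} e t (\<lfloor>z t\<rfloor> + 1) < a"
    using b eventually_ge_at_top[of 0]
  proof eventually_elim
    case (elim t)
    let ?w = "walk_tail (t / real CARD('d)) (z t)"
    have w0: "0 \<le> ?w" by (simp add: walk_tail_def)
    have "layer {x. profile e g x} e t (\<lfloor>z t\<rfloor> + 1)
        \<le> ennreal K * ennreal ?w + ennreal \<epsilon> * expected_count e g t (z t)"
      by (rule K(2)[OF elim(3)])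
    also have "\<dots> \<le> ennreal K * ennreal ?w + ennreal \<epsilon> * ennreal b"
      by (intro add_left_mono mult_left_mono elim) simp
    also have "\<dots> = ennreal (K * ?w + \<epsilon> * b)"
      using K(1) w0 \<epsilon>(1) b0 by (simp add: ennreal_mult)
    also have "\<dots> < ennreal r"
      using elim(1) \<epsilon> r by (intro ennreal_lessI) auto
    finally show ?case using r(2) by (rule less_le_trans)
  qed
qed simp

end

section \<open>Growth of the time integrals in each dimension\<close>

lemma inverse_sqrt_tendsto_0: "((\<lambda>t::real. c / sqrt t) \<longlongrightarrow> 0) at_top"
  by (intro tendsto_divide_0[OF tendsto_const] filterlim_at_top_imp_at_infinity sqrt_at_top)

lemma sqrt_over_tendsto_0: "((\<lambda>t. 4 * sqrt (1 + t) / t) \<longlongrightarrow> 0) at_top"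
proof (rule tendsto_sandwich[OF _ _ tendsto_const inverse_sqrt_tendsto_0[of 8]])
  show "\<forall>\<^sub>F t in at_top. 4 * sqrt (1 + t) / t \<le> 8 / sqrt t"
    using eventually_ge_at_top[of 1]
  proof eventually_elim
    case (elim t)
    have "sqrt (1 + t) \<le> sqrt (4 * t)" using elim by (intro real_sqrt_le_mono) simp
    then have "sqrt (1 + t) \<le> 2 * sqrt t" by (simp add: real_sqrt_mult)
    then have "4 * sqrt (1 + t) / t \<le> 4 * (2 * sqrt t) / t" using elim by (intro divide_right_mono) auto
    also have "\<dots> = 8 / sqrt t" using elim by (simp add: field_simps)
    finally show ?case .
  qed
  show "\<forall>\<^sub>F t in at_top. 0 \<le> 4 * sqrt (1 + t) / t"
    using eventually_ge_at_top[of 1] by eventually_elim simp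
qed

lemma ln_over_tendsto_0: "((\<lambda>t::real. 6 * ln (1 + t) / t) \<longlongrightarrow> 0) at_top"
proof (rule tendsto_sandwich[OF _ _ tendsto_const])
  show "\<forall>\<^sub>F t in at_top. 6 * ln (1 + t) / (t::real) \<le> 3 * (4 * sqrt (1 + t) / t)"
    using eventually_ge_at_top[of 1]
  proof eventually_elim
    case (elim t)
    have "ln (1 + t) = 2 * ln (sqrt (1 + t))" using elim by (simp add: ln_sqrt)
    also have "\<dots> \<le> 2 * sqrt (1 + t)" using elim ln_le_minus_one[of "sqrt (1 + t)"] by simp
    finally show ?case using elim by (simp add: divide_right_mono)
  qed
  show "((\<lambda>t. 3 * (4 * sqrt (1 + t) / t)) \<longlongrightarrow> 0) at_top"
    using tendsto_mult_left[OF sqrt_over_tendsto_0, of 3] by simp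
  show "\<forall>\<^sub>F t in at_top. 0 \<le> 6 * ln (1 + t) / (t::real)"
    using eventually_ge_at_top[of 1] by eventually_elim simp
qed

text \<open>Explains the rates: \<open>h\<close> is chosen so that \<open>h\<^sup>2\<close> is, up
  to a constant, the reciprocal of the time integral, which is of order \<open>sqrt t\<close> for
  \<open>d = 2\<close> and \<open>ln t\<close> for \<open>d = 3\<close>.\<close>

lemma smallo_square_tendsto_0:
  fixes W I h :: "real \<Rightarrow> real"
  assumes W: "W \<in> o[at_top](h)"
    and le: "\<forall>\<^sub>F t in at_top. h t \<noteq> 0 \<and> 0 \<le> I t \<and> I t * (h t)\<^sup>2 \<le> C"
  shows "((\<lambda>t. I t * (W t)\<^sup>2) \<longlongrightarrow> 0) at_top"
proof (rule tendsto_sandwich[OF _ _ tendsto_const])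
  have "((\<lambda>t. W t / h t) \<longlongrightarrow> 0) at_top" by (rule smalloD_tendsto[OF W])
  then have "((\<lambda>t. C * (W t / h t)\<^sup>2) \<longlongrightarrow> C * 0\<^sup>2) at_top" by (intro tendsto_intros)
  then show "((\<lambda>t. C * (W t / h t)\<^sup>2) \<longlongrightarrow> 0) at_top" by simp
  show "\<forall>\<^sub>F t in at_top. I t * (W t)\<^sup>2 \<le> C * (W t / h t)\<^sup>2"
    using le
  proof eventually_elim
    case (elim t)
    then have "I t * (W t)\<^sup>2 = (I t * (h t)\<^sup>2) * (W t / h t)\<^sup>2" by (simp add: power_divide)
    also have "\<dots> \<le> C * (W t / h t)\<^sup>2" using elim by (intro mult_right_mono) auto
    finally show ?case .
  qed
  show "\<forall>\<^sub>F t in at_top. 0 \<le> I t * (W t)\<^sup>2"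
    using le by eventually_elim simp
qed

theorem corollary4p3:
  fixes M :: "'w measure"
    and \<eta> :: "real \<Rightarrow> 'w \<Rightarrow> 'd::finite config"
    and e :: 'd
    and g :: "'d \<Rightarrow> real \<Rightarrow> real"
    and z :: "real \<Rightarrow> real"
    and lam :: real
  assumes "CARD('d) \<ge> 2"
    and "\<And>i u. i \<noteq> e \<Longrightarrow> 0 \<le> u \<Longrightarrow> 0 \<le> g i u"
    and "\<And>i. i \<noteq> e \<Longrightarrow> condA (g i)"
    and "\<And>i. i \<noteq> e \<Longrightarrow> condB (g i)"
    and "\<And>i. i \<noteq> e \<Longrightarrow> condC (g i)"
    and "ssep M \<eta> (profile e g)"
    and "0 \<le> lam"
    and "((\<lambda>t. \<integral>\<^sup>+\<omega>. particles_beyond e (z t) (\<eta> t \<omega>) \<partial>M) \<longlongrightarrow> ennreal lam) at_top"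
  shows "(CARD('d) \<ge> 4 \<longrightarrow> count_tends_to_poisson M e z \<eta> lam) \<and>
         (CARD('d) = 3 \<and> (\<lambda>t. walk_moment e g (z t) t) \<in> o[at_top](\<lambda>t. ln t powr (- 1 / 2))
            \<longrightarrow> count_tends_to_poisson M e z \<eta> lam) \<and>
         (CARD('d) = 2 \<and> (\<lambda>t. walk_moment e g (z t) t) \<in> o[at_top](\<lambda>t. t powr (- 1 / 4))
            \<longrightarrow> count_tends_to_poisson M e z \<eta> lam)"
proof -
  interpret admissible_profile e g
    using assms(2,3,5) by unfold_locales
  note S = assms(6)
  let ?L = "\<lambda>t. layer {x. profile e g x} e t (\<lfloor>z t\<rfloor> + 1)"
  have "(\<integral>\<^sup>+\<omega>. particles_beyond e (z t) (\<eta> t \<omega>) \<partial>M) = expected_count e g t (z t)" if t: "0 \<le> t" for t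
  proof -
    have "(\<integral>\<^sup>+\<omega>. particles_beyond e (z t) (\<eta> t \<omega>) \<partial>M)
      = (\<integral>\<^sup>+x. of_bool (x \<in> {x. profile e g x}) * ennreal (ctp (t / real CARD('d)) (x $ e) {k. z t < real_of_int k}) \<partial>count_space UNIV)"
      by (rule expected_particles_beyond[OF S t])
    also have "\<dots> = (\<integral>\<^sup>+k. ennreal (\<Sum>j<nat (k - \<lfloor>z t\<rfloor>). row_size e g j) \<partial>measure_pmf (ctrw_pmf 0 (t / real CARD('d))))"
      by (rule expected_count_eq[OF t])
    also have "\<dots> = expected_count e g t (z t)"
      by (rule expected_count_def[symmetric])
    finally show ?thesis .
  qed
  then have "\<forall>\<^sub>F t in at_top. (\<integral>\<^sup>+\<omega>. particles_beyond e (z t) (\<eta> t \<omega>) \<partial>M) = expected_count e g t (z t)"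
    using eventually_ge_at_top[of 0] by (rule eventually_mono[rotated])
  from Lim_transform_eventually[OF assms(8) this]
  have lim: "((\<lambda>t. expected_count e g t (z t)) \<longlongrightarrow> ennreal lam) at_top" .
  have b: "\<forall>\<^sub>F t in at_top. expected_count e g t (z t) < ennreal (lam + 1)"
    using order_tendstoD(2)[OF lim, of "ennreal (lam + 1)"] assms(7) by (simp add: ennreal_less_iff)
  have W: "\<forall>\<^sub>F t in at_top. 0 \<le> walk_moment e g (z t) t \<and> ?L t \<le> ennreal (walk_moment e g (z t) t)"
    using b eventually_ge_at_top[of 0]
  proof eventually_elim
    case (elim t)
    have "expected_count e g t (z t) < \<infinity>"
      using elim(1) by (rule less_trans) simp
    have "?L t \<le> ennreal (walk_moment e g (z t) t)"
      by (rule layer_le_walk_moment[OF elim(2) \<open>expected_count e g t (z t) < \<infinity>\<close>])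
    moreover have "0 \<le> walk_moment e g (z t) t"
      by (rule walk_moment_nonneg)
    ultimately show ?case by simp
  qed
  \<comment> \<open>In the applications, \<open>\<sigma>\<close> is the layer itself for
    \<open>d \<ge> 4\<close>, and for \<open>d = 2\<close> and \<open>d = 3\<close> the quantity
    \<open>walk_moment\<close>, which carries the assumed rate.\<close>
  note main = poisson_limit[OF S assms(7) lim]
  have "count_tends_to_poisson M e z \<eta> lam" if d: "4 \<le> CARD('d)"
  proof -
    let ?C = "2 * (sqrt (2 * real CARD('d))) ^ 3"
    have L0: "(?L \<longlongrightarrow> 0) at_top"
    proof (rule layer_next_tendsto_0)
      show "\<forall>\<^sub>F t in at_top. expected_count e g t (z t) \<le> ennreal (lam + 1)"
        using b by eventually_elim simp
      show "0 \<le> lam + 1" using assms(7) by simp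
    qed
    have "((\<lambda>t. ?C * (enn2real (?L t))\<^sup>2) \<longlongrightarrow> ?C * 0\<^sup>2) at_top"
      by (intro tendsto_intros tendsto_enn2real) (use L0 in auto)
    then have I\<sigma>: "((\<lambda>t. ?C * (enn2real (?L t))\<^sup>2) \<longlongrightarrow> 0) at_top" by simp
    show ?thesis
    proof (rule main)
      show "\<forall>\<^sub>F t in at_top. 0 \<le> ?C \<and> (\<integral>\<^sup>+s. ennreal (transverse_bound CARD('d) s) * indicator {0..t} s \<partial>lborel) \<le> ennreal ?C"
        using eventually_ge_at_top[of 0] by eventually_elim (simp add: transverse_integral_4[OF _ d])
      have "\<forall>\<^sub>F t in at_top. ?L t < 1" using L0 by (rule order_tendstoD) simp
      then show "\<forall>\<^sub>F t in at_top. 0 \<le> enn2real (?L t) \<and> ?L t \<le> ennreal (enn2real (?L t))"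
      proof eventually_elim
        case (elim t)
        then have "?L t < top" by (rule less_trans) simp
        then show ?case by (simp add: ennreal_enn2real)
      qed
      show "((\<lambda>t. ?C / t) \<longlongrightarrow> 0) at_top"
        by (intro tendsto_divide_0[OF tendsto_const] filterlim_at_top_imp_at_infinity filterlim_ident)
    qed (rule I\<sigma>)
  qed
  moreover have "count_tends_to_poisson M e z \<eta> lam"
    if d: "CARD('d) = 3" and o: "(\<lambda>t. walk_moment e g (z t) t) \<in> o[at_top](\<lambda>t. ln t powr (- 1 / 2))"
  proof (rule main)
    show "\<forall>\<^sub>F t in at_top. 0 \<le> 6 * ln (1 + t)
        \<and> (\<integral>\<^sup>+s. ennreal (transverse_bound CARD('d) s) * indicator {0..t} s \<partial>lborel)
        \<le> ennreal (6 * ln (1 + t))"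
      using eventually_ge_at_top[of 0] by eventually_elim (simp add: d transverse_integral_3)
    show "((\<lambda>t. 6 * ln (1 + t) * (walk_moment e g (z t) t)\<^sup>2) \<longlongrightarrow> 0) at_top"
    proof (rule smallo_square_tendsto_0[OF o])
      show "\<forall>\<^sub>F t in at_top. ln (t::real) powr (- 1 / 2) \<noteq> 0 \<and> 0
          \<le> 6 * ln (1 + t) \<and> 6 * ln (1 + t) * (ln t powr (- 1 / 2))\<^sup>2 \<le> 12"
        using eventually_ge_at_top[of 2]
      proof eventually_elim
        case (elim t)
        have ln0: "0 < ln t" using elim by simp
        \<comment> \<open>For \<open>t \<ge> 2\<close> this yields
          \<open>1 + t \<le> t\<^sup>2\<close>, hence \<open>ln (1 + t) \<le> 2 * ln t\<close> and
          the constant \<open>12 = 6 * 2\<close>.\<close>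
        have "2 * t \<le> t * t" using elim by (intro mult_right_mono) auto
        then have "1 + t \<le> t\<^sup>2" using elim unfolding power2_eq_square by linarith
        then have "ln (1 + t) \<le> ln (t\<^sup>2)" using elim by simp
        also have "\<dots> = 2 * ln t" using elim by (simp add: ln_realpow)
        finally have le: "ln (1 + t) \<le> 2 * ln t" .
        have "(ln t powr (- 1 / 2))\<^sup>2 = 1 / ln t"
          using ln0 by (simp add: power2_eq_square powr_minus_divide flip: powr_add)
        then show ?case using le ln0 elim by (simp add: divide_le_eq)
      qed
    qed
  qed (rule W ln_over_tendsto_0)+
  moreover have "count_tends_to_poisson M e z \<eta> lam"
    if d: "CARD('d) = 2" and o: "(\<lambda>t. walk_moment e g (z t) t) \<in> o[at_top](\<lambda>t. t powr (- 1 / 4))"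
  proof (rule main)
    show "\<forall>\<^sub>F t in at_top. 0 \<le> 4 * sqrt (1 + t)
        \<and> (\<integral>\<^sup>+s. ennreal (transverse_bound CARD('d) s) * indicator {0..t} s \<partial>lborel)
        \<le> ennreal (4 * sqrt (1 + t))"
      using eventually_ge_at_top[of 0] by eventually_elim (simp add: d transverse_integral_2)
    show "((\<lambda>t. 4 * sqrt (1 + t) * (walk_moment e g (z t) t)\<^sup>2) \<longlongrightarrow> 0) at_top"
    proof (rule smallo_square_tendsto_0[OF o])
      show "\<forall>\<^sub>F t in at_top. t powr (- 1 / 4) \<noteq> 0 \<and> 0
          \<le> 4 * sqrt (1 + t) \<and> 4 * sqrt (1 + t) * (t powr (- 1 / 4))\<^sup>2 \<le> 8"
        using eventually_ge_at_top[of 1]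
      proof eventually_elim
        case (elim t)
        \<comment> \<open>The crude bound \<open>1 + t \<le> 4 * t\<close> has an exact root, which
          produces the constant \<open>8 = 4 * 2\<close>.\<close>
        have "sqrt (1 + t) \<le> sqrt (4 * t)" using elim by (intro real_sqrt_le_mono) simp
        then have le: "sqrt (1 + t) \<le> 2 * sqrt t" by (simp add: real_sqrt_mult)
        have "(t powr (- 1 / 4))\<^sup>2 = 1 / sqrt t"
          using elim by (simp add: power2_eq_square powr_minus_divide powr_half_sqrt flip: powr_add)
        then show ?case using le elim by (simp add: divide_le_eq)
      qed
    qed
  qed (rule W sqrt_over_tendsto_0)+
  ultimately show ?thesis by blast
qed

end
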